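(* Let $m,n\ge0$, $k\ge1$ be integers with $m+n\ge1$, let $\boldsymbol z=(z_1,\dots,z_k)\in\mathbb C^k$ and $\boldsymbol\Lambda=(\Lambda_1,\dots,\Lambda_{m+n})\in\mathbb C^{m+n}$, and let $$G(\boldsymbol\Lambda,\boldsymbol z)=\Big(\delta_{a,b}(\partial_u-z_a)-\sum_{i=1}^{m+n}\frac{x_{i,a}\partial_{i,b}}{u-\Lambda_i}\Big)_{a,b=1,\dots,k}$$ be the $k\times k$ matrix with entries in $\mathcal D_u[\partial_u]$. The normal ordered expansion of its column determinant is $$\mathrm{cdet}\,G(\boldsymbol\Lambda,\boldsymbol z)=\sum_{\mathfrak a\subset\{1,\dots,k\}}\ \sum_{\substack{j_1,j_2\in J(\mathfrak a)\\ j_1\sim j_2}}c(j_1,j_2)\ \Big(\prod_{i=m+1}^{m+n}|j_2^{-1}(i)|!\Big)\ \boldsymbol x_{j_1}\,\boldsymbol\partial_{j_2}\ \prod_{a\in\mathfrak a}(u-\Lambda_{j_2(a)})^{-1}\ \prod_{a\notin\mathfrak a}(\partial_u-z_a),$$ where $J(\mathfrak a)$, $\sim$, $c(j_1,j_2)$, $\boldsymbol x_j$, $\boldsymbol\partial_j$ are as defined in the context.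
   Context: Everything is over $\mathbb C$; $[a,b]=ab-(-1)^{\bar a\bar b}ba$ is the supercommutator. Put $\bar i=\bar0$ for $1\le i\le m$, $\bar i=\bar1$ for $m+1\le i\le m+n$. $\mathcal D$ is the superalgebra generated by $x_{i,a},\partial_{i,a}$, $1\le i\le m+n$, $1\le a\le k$, with parities $\bar x_{i,a}=\bar\partial_{i,a}=\bar i$ and relations $[x_{i,a},x_{j,b}]=[\partial_{i,a},\partial_{j,b}]=0$, $[\partial_{i,a},x_{j,b}]=\delta_{i,j}\delta_{a,b}$. $\mathcal D_u=\mathcal D((u^{-1}))$ is the superalgebra of Laurent series in $u^{-1}$ over $\mathcal D$, with derivation $\partial_u=d/du$ ($u$ even and central over $\mathcal D$), and $\mathcal D_u[\partial_u]$ is the algebra of differential operators over it, i.e. $\partial_u f=f\partial_u+f'$ for $f\in\mathcal D_u$. Rational functions of $u$ are expanded in powers of $u^{-1}$. Column determinant: $\mathrm{cdet}\,G=\sum_{\sigma\in\mathfrak S_k}\mathrm{sgn}(\sigma)\,G_{\sigma(1),1}\cdots G_{\sigma(k),k}$. Normal ordering: an expression is normal ordered if in each monomial the generators appear from left to right in the order: first the $x$'s, then the $\partial_{i,a}$'s, then powers of $u$, then powers of $\partial_u$; the $x_{i,a}$ (and likewise the $\partial_{i,a}$) are arranged by increasing $a$, and for equal $a$ by increasing $i$. Combinatorial notation. Let $\mathfrak a=\{a_1<\dots<a_l\}\subset\{1,\dots,k\}$, $l=|\mathfrak a|$. $J(\mathfrak a)$ is the set of functions $j:\{1,\dots,k\}\to\{0,1,\dots,m+n\}$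 such that $j(a)=0$ if and only if $a\notin\mathfrak a$, and $|j^{-1}(i)|\le1$ for every $i\in\{1,\dots,m\}$. For $j_1,j_2\in J(\mathfrak a)$, $j_1\sim j_2$ means $|j_1^{-1}(i)|=|j_2^{-1}(i)|$ for all $i$. If $j_1\sim j_2$, $\sigma_{j_1,j_2}\in\mathfrak S_l$, acting on $\mathfrak a$ by $a_s\mapsto a_{\sigma_{j_1,j_2}(s)}$, is the unique permutation which maps $j_2^{-1}(i)$ onto $j_1^{-1}(i)$ by an increasing function for each $i=1,\dots,m+n$ (so $j_1(a_{\sigma_{j_1,j_2}(s)})=j_2(a_s)$). $\mathrm{sgn}(j_1,j_2)=(-1)^{\#}$, where $\#$ is the number of pairs $(s,s')$ with $1\le s<s'\le l$, $\sigma_{j_1,j_2}(s)<\sigma_{j_1,j_2}(s')$, $j_2(a_s)>m$ and $j_2(a_{s'})>m$. $c(j_1,j_2)=\mathrm{sgn}(j_1,j_2)\,\mathrm{sgn}(\sigma_{j_1,j_2})\,(-1)^l$, where $\mathrm{sgn}(\sigma_{j_1,j_2})$ is the usual sign of the permutation. For $j\in J(\mathfrak a)$: $\boldsymbol x_j=x_{j(a_1),a_1}x_{j(a_2),a_2}\cdots x_{j(a_l),a_l}$ and $\boldsymbol\partial_j=\partial_{j(a_1),a_1}\partial_{j(a_2),a_2}\cdots\partial_{j(a_l),a_l}$ (both equal to $1$ when $\mathfrak a=\emptyset$). *)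

theory Defs
  imports
    "HOL-Library.Poly_Mapping"
    "HOL-Library.Type_Length"
    "HOL-Library.FuncSet"
    "HOL-Library.Nat_Bijection"
    "HOL-Computational_Algebra.Polynomial"
    "HOL-Computational_Algebra.Formal_Laurent_Series"
    "HOL-Combinatorics.Permutations"
begin

section \<open>The Weyl superalgebra\<close>

text \<open>
  \<open>GX i a\<close> and \<open>GD i a\<close> stand for the generators \<open>x\<^sub>i\<^sub>,\<^sub>a\<close> and \<open>\<partial>\<^sub>i\<^sub>,\<^sub>a\<close>. The free associative
  algebra over the complex numbers is the monoid algebra of the free monoid on these
  letters; \<^typ>\<open>'a \<Rightarrow>\<^sub>0 'b\<close> wants the monoid in additive notation.
\<close>

datatype gen = GX nat nat | GD nat nat

datatype fword = FWord (letters: "gen list")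

instantiation fword :: monoid_add
begin
definition zero_fword where "0 = FWord []"
definition plus_fword where "v + w = FWord (letters v @ letters w)"
instance by standard (simp_all add: zero_fword_def plus_fword_def)
end

type_synonym free_alg = "fword \<Rightarrow>\<^sub>0 complex"

definition fgen :: "gen \<Rightarrow> free_alg" where
  "fgen g = Poly_Mapping.single (FWord [g]) 1"

inductive_set ideal_generated :: "'a::ring_1 set \<Rightarrow> 'a set" for R where
  zero: "0 \<in> ideal_generated R"
| step: "r \<in> R \<Longrightarrow> s \<in> ideal_generated R \<Longrightarrow> a * r * b + s \<in> ideal_generated R"

definition parity :: "nat \<Rightarrow> nat \<Rightarrow> nat" where
  "parity m i = (if i \<le> m then 0 else 1)"

text \<open>The supercommutator of homogeneous elements \<open>a\<close>, \<open>b\<close> of parities \<open>p\<close>, \<open>q\<close>.\<close>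

definition supercomm :: "nat \<Rightarrow> nat \<Rightarrow> 'a \<Rightarrow> 'a \<Rightarrow> 'a::ring_1" where
  "supercomm p q a b = a * b - (-1) ^ (p * q) * (b * a)"

definition index_range :: "nat \<Rightarrow> nat \<Rightarrow> nat \<Rightarrow> (nat \<times> nat) set" where
  "index_range m n k = {1..m + n} \<times> {1..k}"

text \<open>
  The letters carry arbitrary natural numbers as indices; the last two sets remove the
  letters whose indices are out of range.
\<close>

definition weyl_relators :: "nat \<Rightarrow> nat \<Rightarrow> nat \<Rightarrow> free_alg set" where
  "weyl_relators m n k =
     {supercomm (parity m i) (parity m j) (fgen (GX i a)) (fgen (GX j b)) | i a j b.
        (i, a) \<in> index_range m n k \<and> (j, b) \<in> index_range m n k} \<union>
     {supercomm (parity m i) (parity m j) (fgen (GD i a)) (fgen (GD j b)) | i a j b.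
        (i, a) \<in> index_range m n k \<and> (j, b) \<in> index_range m n k} \<union>
     {supercomm (parity m i) (parity m j) (fgen (GD i a)) (fgen (GX j b))
        - (if i = j \<and> a = b then 1 else 0) | i a j b.
        (i, a) \<in> index_range m n k \<and> (j, b) \<in> index_range m n k} \<union>
     {fgen (GX i a) | i a. (i, a) \<notin> index_range m n k} \<union>
     {fgen (GD i a) | i a. (i, a) \<notin> index_range m n k}"

definition weyl_ideal :: "nat \<Rightarrow> nat \<Rightarrow> nat \<Rightarrow> free_alg set" where
  "weyl_ideal m n k = ideal_generated (weyl_relators m n k)"

lemma ideal_generated_add:
  "p \<in> ideal_generated R \<Longrightarrow> q \<in> ideal_generated R \<Longrightarrow> p + q \<in> ideal_generated R"
  by (induction rule: ideal_generated.induct) (auto simp: add.assoc intro: ideal_generated.step)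

lemma ideal_generated_mult:
  "p \<in> ideal_generated R \<Longrightarrow> c * p * d \<in> ideal_generated R"
proof (induction rule: ideal_generated.induct)
  case (step r s a b)
  have "(c * a) * r * (b * d) + c * s * d \<in> ideal_generated R"
    using step by (intro ideal_generated.step) auto
  then show ?case by (simp add: algebra_simps)
qed (auto intro: ideal_generated.zero)

lemma ideal_generated_base: "r \<in> R \<Longrightarrow> r \<in> ideal_generated R"
  using ideal_generated.step[of r R 0 1 1] by (simp add: ideal_generated.zero)

lemma ideal_generated_multl: "p \<in> ideal_generated R \<Longrightarrow> c * p \<in> ideal_generated R"
  using ideal_generated_mult[of p R c 1] by simp

lemma ideal_generated_multr: "p \<in> ideal_generated R \<Longrightarrow> p * c \<in> ideal_generated R"
  using ideal_generated_mult[of p R 1 c] by simp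

lemma ideal_generated_uminus: "p \<in> ideal_generated R \<Longrightarrow> - p \<in> ideal_generated R"
  using ideal_generated_mult[of p R "-1" 1] by simp


subsection \<open>The ideal of relations is proper\<close>

text \<open>
  The free algebra acts on functions of occupation numbers \<open>s\<close>: even generators act as
  bosonic creation and annihilation operators, odd ones as fermionic operators with
  Jordan--Wigner signs (only the parity of \<open>s\<close> counts). This is used only to see that
  \<open>1 \<noteq> 0\<close> in the quotient.
\<close>

type_synonym fock = "(nat \<times> nat \<Rightarrow> nat) \<Rightarrow> complex"

definition jw_sign :: "nat \<Rightarrow> nat \<times> nat \<Rightarrow> (nat \<times> nat \<Rightarrow> nat) \<Rightarrow> complex" where
  "jw_sign m p s = (\<Prod>q\<in>{q. prod_encode q < prod_encode p \<and> m < fst q}. (-1) ^ s q)"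

fun gen_act :: "nat \<Rightarrow> nat \<Rightarrow> nat \<Rightarrow> gen \<Rightarrow> fock \<Rightarrow> fock" where
  "gen_act m n k (GX i a) f = (\<lambda>s. let p = (i, a) in
     if p \<notin> index_range m n k then 0
     else if i \<le> m then (if s p = 0 then 0 else f (s(p := s p - 1)))
     else if odd (s p) then jw_sign m p s * f (s(p := s p - 1)) else 0)"
| "gen_act m n k (GD i a) f = (\<lambda>s. let p = (i, a) in
     if p \<notin> index_range m n k then 0
     else if i \<le> m then of_nat (s p + 1) * f (s(p := s p + 1))
     else if even (s p) then jw_sign m p s * f (s(p := s p + 1)) else 0)"

definition word_act :: "nat \<Rightarrow> nat \<Rightarrow> nat \<Rightarrow> fword \<Rightarrow> fock \<Rightarrow> fock" where
  "word_act m n k w = foldr (gen_act m n k) (letters w)"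

definition free_act :: "nat \<Rightarrow> nat \<Rightarrow> nat \<Rightarrow> free_alg \<Rightarrow> fock \<Rightarrow> fock" where
  "free_act m n k p f = (\<lambda>s. \<Sum>w\<in>Poly_Mapping.keys p. Poly_Mapping.lookup p w * word_act m n k w f s)"

lemma jw_finite: "finite {q. prod_encode q < (N::nat) \<and> m < fst q}"
proof -
  have "{q. prod_encode q < N \<and> m < fst q} \<subseteq> prod_decode ` {..<N}"
    by (auto intro!: image_eqI[where x = "prod_encode (_, _)"])
  then show ?thesis by (rule finite_subset) simp
qed

lemma jw_upd:
  "jw_sign m p (s(q := v)) =
     (if prod_encode q < prod_encode p \<and> m < fst q
      then (-1) ^ v * (-1) ^ s q * jw_sign m p s else jw_sign m p s)"
proof (cases "prod_encode q < prod_encode p \<and> m < fst q")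
  case True
  let ?S = "{q. prod_encode q < prod_encode p \<and> m < fst q}"
  have q: "q \<in> ?S" using True by simp
  have "(\<Prod>r\<in>?S - {q}. (-1::complex) ^ (s(q := v)) r) = (\<Prod>r\<in>?S - {q}. (-1) ^ s r)"
    by (intro prod.cong) auto
  then have 1: "jw_sign m p (s(q := v)) = (-1) ^ v * (\<Prod>r\<in>?S - {q}. (-1) ^ s r)"
    unfolding jw_sign_def using prod.remove[OF jw_finite q, of "\<lambda>r. (-1) ^ (s(q := v)) r"] by simp
  have 2: "jw_sign m p s = (-1) ^ s q * (\<Prod>r\<in>?S - {q}. (-1) ^ s r)"
    unfolding jw_sign_def using prod.remove[OF jw_finite q, of "\<lambda>r. (-1) ^ s r"] by simp
  have "(-1::complex) ^ s q * (-1) ^ s q = 1"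
    by (simp flip: power_add mult_2)
  then show ?thesis using True unfolding 1 2 by (simp add: mult.assoc)
next
  case False
  then have "jw_sign m p (s(q := v)) = jw_sign m p s"
    unfolding jw_sign_def by (intro prod.cong) auto
  with False show ?thesis by (simp only: if_False)
qed

lemma jw_sq: "jw_sign m p s * jw_sign m p s = 1"
proof -
  have "(-1::complex) ^ t * (-1) ^ t = 1" for t :: nat by (simp flip: power_add mult_2)
  then show ?thesis unfolding jw_sign_def by (simp flip: prod.distrib)
qed

lemma jw_sq': "jw_sign m p s * (jw_sign m p s * c) = c"
  using jw_sq[of m p s] by (simp flip: mult.assoc)

lemma gen_act_add:
  "gen_act m n k g (\<lambda>s. f s + h s) = (\<lambda>s. gen_act m n k g f s + gen_act m n k g h s)"
  by (cases g) (auto simp: fun_eq_iff Let_def algebra_simps)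

lemma gen_act_scale: "gen_act m n k g (\<lambda>s. c * f s) = (\<lambda>s. c * gen_act m n k g f s)"
  by (cases g) (auto simp: fun_eq_iff Let_def algebra_simps)

lemma word_act_0: "word_act m n k 0 f = f"
  by (simp add: word_act_def zero_fword_def)

lemma word_act_plus: "word_act m n k (v + w) f = word_act m n k v (word_act m n k w f)"
  by (simp add: word_act_def plus_fword_def)

lemma word_act_add:
  "word_act m n k w (\<lambda>s. f s + h s) = (\<lambda>s. word_act m n k w f s + word_act m n k w h s)"
proof -
  have "foldr (gen_act m n k) gs (\<lambda>s. f s + h s) =
      (\<lambda>s. foldr (gen_act m n k) gs f s + foldr (gen_act m n k) gs h s)" for gs
    by (induction gs) (simp_all add: gen_act_add)
  then show ?thesis by (simp add: word_act_def)
qed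

lemma word_act_scale: "word_act m n k w (\<lambda>s. c * f s) = (\<lambda>s. c * word_act m n k w f s)"
proof -
  have "foldr (gen_act m n k) gs (\<lambda>s. c * f s) = (\<lambda>s. c * foldr (gen_act m n k) gs f s)" for gs
    by (induction gs) (simp_all add: gen_act_scale)
  then show ?thesis by (simp add: word_act_def)
qed

lemma free_act_superset:
  assumes "finite A" "Poly_Mapping.keys p \<subseteq> A"
  shows "free_act m n k p f s = (\<Sum>w\<in>A. Poly_Mapping.lookup p w * word_act m n k w f s)"
  unfolding free_act_def using assms
  by (intro sum.mono_neutral_left) (auto simp: in_keys_iff)

lemma free_act_plus: "free_act m n k (p + q) f s = free_act m n k p f s + free_act m n k q f s"
proof -
  let ?A = "Poly_Mapping.keys p \<union> Poly_Mapping.keys q"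
  have "Poly_Mapping.keys (p + q) \<subseteq> ?A" by (rule Poly_Mapping.keys_add)
  then show ?thesis
    by (simp add: free_act_superset[where A = ?A] lookup_add algebra_simps sum.distrib)
qed

lemma free_act_single: "free_act m n k (Poly_Mapping.single w c) f s = c * word_act m n k w f s"
  by (simp add: free_act_superset[where A = "{w}"])

lemma free_act_zero [simp]: "free_act m n k 0 f s = 0"
  by (simp add: free_act_def)

lemma free_act_uminus: "free_act m n k (- p) f s = - free_act m n k p f s"
  using free_act_plus[of m n k p "- p" f s] by (simp add: eq_neg_iff_add_eq_0 add.commute)

lemma free_act_diff: "free_act m n k (p - q) f s = free_act m n k p f s - free_act m n k q f s"
  using free_act_plus[of m n k p "- q" f s] by (simp add: free_act_uminus)

lemma free_act_one: "free_act m n k 1 f s = f s"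
  using free_act_single[of m n k 0 1 f s] by (simp add: word_act_0)

lemma free_act_add_right:
  "free_act m n k p (\<lambda>s. f s + h s) s = free_act m n k p f s + free_act m n k p h s"
  by (simp add: free_act_def word_act_add algebra_simps sum.distrib)

lemma free_act_zero_right: "free_act m n k p (\<lambda>s. 0) s = 0"
  using free_act_add_right[of m n k p "\<lambda>s. 0" "\<lambda>s. 0" s] by simp

lemma free_alg_induct [case_names single sum]:
  fixes p :: free_alg
  assumes single: "\<And>w c. P (Poly_Mapping.single w c)"
    and sum: "\<And>p q. P p \<Longrightarrow> P q \<Longrightarrow> P (p + q)"
  shows "P p"
proof -
  have "P (\<Sum>w\<in>A. Poly_Mapping.single w (Poly_Mapping.lookup p w))" if "finite A" for A
    using that
  proof (induction A)
    case empty
    show ?case using single[of undefined 0] by simp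
  qed (simp add: single sum)
  moreover have "p = (\<Sum>w\<in>Poly_Mapping.keys p. Poly_Mapping.single w (Poly_Mapping.lookup p w))"
    by (rule poly_mapping_eqI)
      (simp add: lookup_sum lookup_single when_def in_keys_iff)
  ultimately show ?thesis by (metis finite_keys)
qed

lemma free_act_mult: "free_act m n k (p * q) f s = free_act m n k p (free_act m n k q f) s"
proof (induction p rule: free_alg_induct)
  case (single v c)
  show ?case
  proof (induction q arbitrary: s rule: free_alg_induct)
    case (single w d)
    have "free_act m n k (Poly_Mapping.single w d) f = (\<lambda>s. d * word_act m n k w f s)"
      by (simp add: fun_eq_iff free_act_single)
    then show ?case
      by (simp add: mult_single free_act_single word_act_plus word_act_scale mult.assoc)
  next
    case (sum p q)
    have "free_act m n k (p + q) f = (\<lambda>s. free_act m n k p f s + free_act m n k q f s)"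
      by (simp add: fun_eq_iff free_act_plus)
    with sum show ?case by (simp add: distrib_left free_act_plus free_act_add_right)
  qed
next
  case (sum p q)
  then show ?case by (simp add: distrib_right free_act_plus)
qed

lemma free_act_gen: "free_act m n k (fgen g) f = gen_act m n k g f"
  by (simp add: fun_eq_iff fgen_def free_act_single word_act_def)

lemma free_act_supercomm:
  "free_act m n k (supercomm p q (fgen g) (fgen h)) f s =
     gen_act m n k g (gen_act m n k h f) s
       - (-1) ^ (p * q) * gen_act m n k h (gen_act m n k g f) s"
  by (cases "even (p * q)")
    (simp_all add: supercomm_def free_act_diff free_act_plus free_act_mult free_act_gen)

lemma weyl_relators_act:
  assumes "r \<in> weyl_relators m n k"
  shows "free_act m n k r f s = 0"
proof -
  have enc: "prod_encode p = prod_encode q \<longleftrightarrow> p = q" for p q :: "nat \<times> nat"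
    by (auto dest: injD[OF inj_prod_encode])
  consider
      (xx) i a j b where "r = supercomm (parity m i) (parity m j) (fgen (GX i a)) (fgen (GX j b))"
        "(i, a) \<in> index_range m n k" "(j, b) \<in> index_range m n k"
    | (dd) i a j b where "r = supercomm (parity m i) (parity m j) (fgen (GD i a)) (fgen (GD j b))"
        "(i, a) \<in> index_range m n k" "(j, b) \<in> index_range m n k"
    | (dx) i a j b where "r = supercomm (parity m i) (parity m j) (fgen (GD i a)) (fgen (GX j b))
          - (if i = j \<and> a = b then 1 else 0)"
        "(i, a) \<in> index_range m n k" "(j, b) \<in> index_range m n k"
    | (x) i a where "r = fgen (GX i a)" "(i, a) \<notin> index_range m n k"
    | (d) i a where "r = fgen (GD i a)" "(i, a) \<notin> index_range m n k"
    using assms unfolding weyl_relators_def by blast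
  then show ?thesis
  proof cases
    case xx
    show ?thesis
      unfolding xx(1) using xx(2,3) less_linear[of "prod_encode (i, a)" "prod_encode (j, b)"]
      by (cases "(i, a) = (j, b)")
        (auto simp: enc free_act_supercomm parity_def Let_def jw_upd fun_upd_twist)
  next
    case dd
    show ?thesis
      unfolding dd(1) using dd(2,3) less_linear[of "prod_encode (i, a)" "prod_encode (j, b)"]
      by (cases "(i, a) = (j, b)")
        (auto simp: enc free_act_supercomm parity_def Let_def jw_upd fun_upd_twist)
  next
    case dx
    show ?thesis
      unfolding dx(1) using dx(2,3) less_linear[of "prod_encode (i, a)" "prod_encode (j, b)"]
      by (cases "(i, a) = (j, b)")
        (auto simp: enc free_act_supercomm free_act_diff free_act_one parity_def Let_def jw_upd
          jw_sq jw_sq' fun_upd_twist fun_upd_idem algebra_simps)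
  qed (auto simp: free_act_gen Let_def)
qed

lemma one_notin_weyl_ideal: "1 \<notin> weyl_ideal m n k"
proof
  assume 1: "1 \<in> weyl_ideal m n k"
  have "free_act m n k p f s = 0" if "p \<in> weyl_ideal m n k" for p f s
    using that unfolding weyl_ideal_def
  proof (induction arbitrary: f s rule: ideal_generated.induct)
    case (step r t a b)
    have "free_act m n k r (free_act m n k b f) = (\<lambda>s. 0)"
      using weyl_relators_act[OF step(1)] by (simp add: fun_eq_iff)
    with step show ?case
      by (simp add: free_act_plus free_act_mult free_act_zero_right)
  qed simp
  from this[OF 1, of "\<lambda>s. 1"] show False by (simp add: free_act_one)
qed


subsection \<open>The quotient\<close>

text \<open>
  The integers \<open>m\<close>, \<open>n\<close>, \<open>k\<close> are carried by the type arguments as \<open>LENGTH('m)\<close>,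
  \<open>LENGTH('n)\<close>, \<open>LENGTH('k)\<close>; every natural number, zero included, is the length of a
  numeral type.
\<close>

quotient_type (overloaded) ('m, 'n, 'k) weyl = free_alg /
  "\<lambda>p q. p - q \<in> weyl_ideal LENGTH('m::len0) LENGTH('n::len0) LENGTH('k::len0)"
proof (rule equivpI)
  let ?I = "weyl_ideal LENGTH('m) LENGTH('n) LENGTH('k)"
  show "reflp (\<lambda>p q. p - q \<in> ?I)"
    by (auto intro!: reflpI simp: weyl_ideal_def ideal_generated.zero)
  show "symp (\<lambda>p q. p - q \<in> ?I)"
    by (rule sympI) (metis ideal_generated_uminus minus_diff_eq weyl_ideal_def)
  show "transp (\<lambda>p q. p - q \<in> ?I)"
    by (rule transpI)
      (metis (no_types, lifting) add_diff_cancel_right' add_diff_eq diff_add_cancel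
        ideal_generated_add weyl_ideal_def)
qed

instantiation weyl :: (len0, len0, len0) ring_1
begin

lift_definition zero_weyl :: "('a, 'b, 'c) weyl" is 0 .
lift_definition one_weyl :: "('a, 'b, 'c) weyl" is 1 .

lift_definition plus_weyl :: "('a, 'b, 'c) weyl \<Rightarrow> ('a, 'b, 'c) weyl \<Rightarrow> ('a, 'b, 'c) weyl" is "(+)"
  unfolding weyl_ideal_def using ideal_generated_add by (metis add_diff_add)

lift_definition uminus_weyl :: "('a, 'b, 'c) weyl \<Rightarrow> ('a, 'b, 'c) weyl" is uminus
  unfolding weyl_ideal_def using ideal_generated_uminus by (metis minus_diff_minus)

lift_definition minus_weyl :: "('a, 'b, 'c) weyl \<Rightarrow> ('a, 'b, 'c) weyl \<Rightarrow> ('a, 'b, 'c) weyl" is "(-)"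
proof -
  fix p q r s :: free_alg
  assume "p - q \<in> weyl_ideal LENGTH('a) LENGTH('b) LENGTH('c)"
    "r - s \<in> weyl_ideal LENGTH('a) LENGTH('b) LENGTH('c)"
  then have "(p - q) + - (r - s) \<in> weyl_ideal LENGTH('a) LENGTH('b) LENGTH('c)"
    unfolding weyl_ideal_def by (intro ideal_generated_add ideal_generated_uminus)
  then show "p - r - (q - s) \<in> weyl_ideal LENGTH('a) LENGTH('b) LENGTH('c)"
    by (simp add: algebra_simps)
qed

lift_definition times_weyl :: "('a, 'b, 'c) weyl \<Rightarrow> ('a, 'b, 'c) weyl \<Rightarrow> ('a, 'b, 'c) weyl" is "(*)"
proof -
  fix p q r s :: free_alg
  assume "p - q \<in> weyl_ideal LENGTH('a) LENGTH('b) LENGTH('c)"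
    "r - s \<in> weyl_ideal LENGTH('a) LENGTH('b) LENGTH('c)"
  then have "(p - q) * r + q * (r - s) \<in> weyl_ideal LENGTH('a) LENGTH('b) LENGTH('c)"
    unfolding weyl_ideal_def
    by (intro ideal_generated_add ideal_generated_multl ideal_generated_multr)
  then show "p * r - q * s \<in> weyl_ideal LENGTH('a) LENGTH('b) LENGTH('c)"
    by (simp add: algebra_simps)
qed

instance
proof
  fix a b c :: "('a, 'b, 'c) weyl"
  note abs = weyl.abs_eq_iff zero_weyl_def one_weyl_def plus_weyl.abs_eq minus_weyl.abs_eq
    uminus_weyl.abs_eq times_weyl.abs_eq
  have surj: "\<exists>p. x = abs_weyl p" for x :: "('a, 'b, 'c) weyl"
    by (induction x rule: weyl.abs_induct) blast
  obtain p q r where pqr: "a = abs_weyl p" "b = abs_weyl q" "c = abs_weyl r"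
    using surj[of a] surj[of b] surj[of c] by blast
  show "a * b * c = a * (b * c)" by (simp only: abs(2-) pqr mult.assoc)
  show "a + b + c = a + (b + c)" by (simp only: abs(2-) pqr add.assoc)
  show "a + b = b + a" by (simp only: abs(2-) pqr add.commute)
  show "0 + a = a" by (simp only: abs(2-) pqr add_0_left)
  show "- a + a = 0" by (simp only: abs(2-) pqr ab_left_minus)
  show "a - b = a + - b" by (simp only: abs(2-) pqr diff_conv_add_uminus)
  show "(a + b) * c = a * c + b * c" by (simp only: abs(2-) pqr distrib_right)
  show "a * (b + c) = a * b + a * c" by (simp only: abs(2-) pqr distrib_left)
  show "1 * a = a" by (simp only: abs(2-) pqr mult_1_left)
  show "a * 1 = a" by (simp only: abs(2-) pqr mult_1_right)
  show "(0 :: ('a, 'b, 'c) weyl) \<noteq> 1"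
  proof
    assume "(0 :: ('a, 'b, 'c) weyl) = 1"
    then have "0 - 1 \<in> weyl_ideal LENGTH('a) LENGTH('b) LENGTH('c)"
      by (simp only: zero_weyl_def one_weyl_def weyl.abs_eq_iff)
    then have "- (0 - 1) \<in> weyl_ideal LENGTH('a) LENGTH('b) LENGTH('c)"
      unfolding weyl_ideal_def by (rule ideal_generated_uminus)
    then show False using one_notin_weyl_ideal by simp
  qed
qed

end

lift_definition weyl_of_complex :: "complex \<Rightarrow> ('m::len0, 'n::len0, 'k::len0) weyl"
  is "\<lambda>c. Poly_Mapping.single 0 c" .

lift_definition weyl_gen :: "gen \<Rightarrow> ('m::len0, 'n::len0, 'k::len0) weyl" is fgen .

definition weyl_word :: "gen list \<Rightarrow> ('m::len0, 'n::len0, 'k::len0) weyl" where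
  "weyl_word gs = prod_list (map weyl_gen gs)"

lemma weyl_relations:
  fixes i j a b :: nat
  assumes "(i, a) \<in> index_range LENGTH('m::len0) LENGTH('n::len0) LENGTH('k::len0)"
    and "(j, b) \<in> index_range LENGTH('m) LENGTH('n) LENGTH('k)"
  defines "p \<equiv> parity LENGTH('m)"
  shows "supercomm (p i) (p j) (weyl_gen (GX i a)) (weyl_gen (GX j b)) = (0 :: ('m, 'n, 'k) weyl)"
    and "supercomm (p i) (p j) (weyl_gen (GD i a)) (weyl_gen (GD j b)) = (0 :: ('m, 'n, 'k) weyl)"
    and "supercomm (p i) (p j) (weyl_gen (GD i a)) (weyl_gen (GX j b)) =
           (if i = j \<and> a = b then 1 else 0 :: ('m, 'n, 'k) weyl)"
proof -
  have abs: "abs_weyl r = (0 :: ('m, 'n, 'k) weyl)"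
    if "r \<in> weyl_relators LENGTH('m) LENGTH('n) LENGTH('k)" for r
    using that unfolding zero_weyl_def weyl.abs_eq_iff weyl_ideal_def
    by (simp add: ideal_generated_base)
  have pow: "(-1 :: ('m, 'n, 'k) weyl) ^ t = abs_weyl ((-1) ^ t)" for t :: nat
    by (induction t) (simp_all add: one_weyl_def times_weyl.abs_eq uminus_weyl.abs_eq)
  have sc: "supercomm (p i) (p j) (weyl_gen g) (weyl_gen h) =
      (abs_weyl (supercomm (p i) (p j) (fgen g) (fgen h)) :: ('m, 'n, 'k) weyl)" for g h
    by (simp add: supercomm_def pow weyl_gen.abs_eq times_weyl.abs_eq minus_weyl.abs_eq)
  show "supercomm (p i) (p j) (weyl_gen (GX i a)) (weyl_gen (GX j b)) = (0 :: ('m, 'n, 'k) weyl)"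
    unfolding sc unfolding p_def
    by (rule abs, unfold weyl_relators_def, rule UnI1, rule UnI1, rule UnI1, rule UnI1, rule CollectI,
        rule exI[of _ i], rule exI[of _ a], rule exI[of _ j], rule exI[of _ b])
      (use assms in simp)
  show "supercomm (p i) (p j) (weyl_gen (GD i a)) (weyl_gen (GD j b)) = (0 :: ('m, 'n, 'k) weyl)"
    unfolding sc unfolding p_def
    by (rule abs, unfold weyl_relators_def, rule UnI1, rule UnI1, rule UnI1, rule UnI2, rule CollectI,
        rule exI[of _ i], rule exI[of _ a], rule exI[of _ j], rule exI[of _ b])
      (use assms in simp)
  have "abs_weyl (supercomm (p i) (p j) (fgen (GD i a)) (fgen (GX j b))
      - (if i = j \<and> a = b then 1 else 0)) = (0 :: ('m, 'n, 'k) weyl)"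
    unfolding p_def
    by (rule abs, unfold weyl_relators_def, rule UnI1, rule UnI1, rule UnI2, rule CollectI,
        rule exI[of _ i], rule exI[of _ a], rule exI[of _ j], rule exI[of _ b])
      (use assms in simp)
  then show "supercomm (p i) (p j) (weyl_gen (GD i a)) (weyl_gen (GX j b)) =
      (if i = j \<and> a = b then 1 else 0 :: ('m, 'n, 'k) weyl)"
    unfolding sc by (cases "i = j \<and> a = b") (auto simp: one_weyl_def simp flip: minus_weyl.abs_eq)
qed


section \<open>Laurent series and differential operators\<close>

text \<open>
  \<^typ>\<open>'a fls\<close> is read as the ring of Laurent series in \<open>u\<^sup>-\<^sup>1\<close>: the library's variable
  \<^term>\<open>fls_X\<close> is \<open>u\<^sup>-\<^sup>1\<close> and \<^term>\<open>fls_X_inv\<close> is \<open>u\<close>. With \<open>w = u\<^sup>-\<^sup>1\<close> one has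
  \<open>d/du = - w\<^sup>2 d/dw\<close>.
\<close>

definition u_deriv :: "'a::ring_1 fls \<Rightarrow> 'a fls" where
  "u_deriv f = - (fls_X ^ 2 * fls_deriv f)"

lemma u_deriv_u: "u_deriv (fls_X_inv :: 'a::ring_1 fls) = 1"
proof (rule fls_eqI)
  fix r :: int
  have "fls_nth (u_deriv (fls_X_inv :: 'a fls)) r = - (of_int (r - 1) * (if r = 0 then 1 else 0))"
    by (simp add: u_deriv_def fls_X_power_times_conv_shift)
  then show "fls_nth (u_deriv (fls_X_inv :: 'a fls)) r = fls_nth 1 r" by simp
qed

lemma u_deriv_add: "u_deriv (f + g) = u_deriv f + u_deriv g"
  by (simp add: u_deriv_def algebra_simps)

lemma u_deriv_0 [simp]: "u_deriv 0 = 0"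
  by (simp add: u_deriv_def)

lemma u_deriv_1 [simp]: "u_deriv 1 = 0"
  by (simp add: u_deriv_def)

lemma u_deriv_mult: "u_deriv (f * g) = u_deriv f * g + f * u_deriv g"
proof -
  have "f * (fls_X ^ 2 * fls_deriv g) = fls_X ^ 2 * (f * fls_deriv g)"
    by (metis fls_X_power_times_comm mult.assoc)
  then show ?thesis by (simp add: u_deriv_def algebra_simps)
qed

text \<open>
  A differential operator \<open>\<Sum>\<^sub>p f\<^sub>p \<partial>\<^sub>u\<^sup>p\<close> is stored as the polynomial with coefficients \<open>f\<^sub>p\<close>.
  Left multiplication by \<open>\<partial>\<^sub>u\<close> sends \<open>g \<partial>\<^sub>u\<^sup>q\<close> to \<open>g' \<partial>\<^sub>u\<^sup>q + g \<partial>\<^sub>u\<^sup>q\<^sup>+\<^sup>1\<close>, and the product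
  is determined by this.
\<close>

definition du_lmult :: "'a::ring_1 fls poly \<Rightarrow> 'a fls poly" where
  "du_lmult P = map_poly u_deriv P + pCons 0 P"

definition fun_lmult :: "'a::ring_1 fls \<Rightarrow> 'a fls poly \<Rightarrow> 'a fls poly" where
  "fun_lmult f P = map_poly ((*) f) P"

definition op_mult :: "'a::ring_1 fls poly \<Rightarrow> 'a fls poly \<Rightarrow> 'a fls poly" where
  "op_mult P Q = (\<Sum>p\<le>degree P. fun_lmult (coeff P p) ((du_lmult ^^ p) Q))"

lemma coeff_fun_lmult [simp]: "coeff (fun_lmult f P) i = f * coeff P i"
  by (simp add: fun_lmult_def coeff_map_poly)

lemma coeff_du_lmult:
  "coeff (du_lmult P) i = u_deriv (coeff P i) + (case i of 0 \<Rightarrow> 0 | Suc j \<Rightarrow> coeff P j)"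
  by (simp add: du_lmult_def coeff_map_poly coeff_pCons)

lemma du_lmult_add: "du_lmult (P + Q) = du_lmult P + du_lmult Q"
  by (rule poly_eqI) (auto simp: coeff_du_lmult u_deriv_add split: nat.split)

lemma du_lmult_0 [simp]: "du_lmult 0 = 0"
  by (rule poly_eqI) (auto simp: coeff_du_lmult split: nat.split)

lemma du_lmult_sum: "du_lmult (\<Sum>i\<in>A. F i) = (\<Sum>i\<in>A. du_lmult (F i))"
  by (induction A rule: infinite_finite_induct) (auto simp: du_lmult_add)

lemma du_lmult_pow_add: "(du_lmult ^^ p) (P + Q) = (du_lmult ^^ p) P + (du_lmult ^^ p) Q"
  by (induction p) (auto simp: du_lmult_add)

lemma fun_lmult_add: "fun_lmult f (P + Q) = fun_lmult f P + fun_lmult f Q"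
  by (rule poly_eqI) (auto simp: algebra_simps)

lemma fun_lmult_add_left: "fun_lmult (f + g) P = fun_lmult f P + fun_lmult g P"
  by (rule poly_eqI) (auto simp: algebra_simps)

lemma fun_lmult_0 [simp]: "fun_lmult f 0 = 0" "fun_lmult 0 P = 0"
  by (auto intro!: poly_eqI)

lemma fun_lmult_1 [simp]: "fun_lmult 1 P = P"
  by (auto intro!: poly_eqI)

lemma fun_lmult_sum: "fun_lmult f (\<Sum>i\<in>A. F i) = (\<Sum>i\<in>A. fun_lmult f (F i))"
  by (induction A rule: infinite_finite_induct) (auto simp: fun_lmult_add)

lemma fun_lmult_fun_lmult: "fun_lmult f (fun_lmult g P) = fun_lmult (f * g) P"
  by (rule poly_eqI) (auto simp: algebra_simps)

lemma du_fun_lmult: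
  "du_lmult (fun_lmult f P) = fun_lmult (u_deriv f) P + fun_lmult f (du_lmult P)"
  by (rule poly_eqI) (auto simp: coeff_du_lmult u_deriv_mult algebra_simps split: nat.split)

lemma op_mult_superset:
  assumes "degree P \<le> N"
  shows "op_mult P Q = (\<Sum>p\<le>N. fun_lmult (coeff P p) ((du_lmult ^^ p) Q))"
  unfolding op_mult_def using assms
  by (intro sum.mono_neutral_left) (auto simp: coeff_eq_0)

lemma op_mult_add_left: "op_mult (P + P') Q = op_mult P Q + op_mult P' Q"
proof -
  let ?N = "max (degree P) (degree P')"
  have "degree (P + P') \<le> ?N" by (rule degree_add_le_max)
  then show ?thesis
    by (simp add: op_mult_superset[where N = ?N] fun_lmult_add_left sum.distrib)
qed

lemma op_mult_add_right: "op_mult P (Q + Q') = op_mult P Q + op_mult P Q'"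
  by (simp add: op_mult_def du_lmult_pow_add fun_lmult_add sum.distrib)

lemma op_mult_0_left [simp]: "op_mult 0 Q = 0"
  by (simp add: op_mult_def)

lemma op_mult_sum_left: "op_mult (\<Sum>i\<in>A. F i) Q = (\<Sum>i\<in>A. op_mult (F i) Q)"
  by (induction A rule: infinite_finite_induct) (auto simp: op_mult_add_left)

lemma op_mult_fun_lmult: "op_mult (fun_lmult f P) Q = fun_lmult f (op_mult P Q)"
proof -
  have "degree (fun_lmult f P) \<le> degree P"
    by (rule degree_le) (simp add: coeff_eq_0)
  then have "op_mult (fun_lmult f P) Q =
      (\<Sum>p\<le>degree P. fun_lmult (f * coeff P p) ((du_lmult ^^ p) Q))"
    by (simp add: op_mult_superset)
  then show ?thesis by (simp add: op_mult_def fun_lmult_sum fun_lmult_fun_lmult)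
qed

lemma op_mult_du_lmult: "op_mult (du_lmult P) Q = du_lmult (op_mult P Q)"
proof -
  have "degree (du_lmult P) \<le> Suc (degree P)"
    by (rule degree_le) (auto simp: coeff_du_lmult coeff_eq_0 split: nat.split)
  then have "op_mult (du_lmult P) Q =
      (\<Sum>p\<le>Suc (degree P). fun_lmult (u_deriv (coeff P p)) ((du_lmult ^^ p) Q)) +
      (\<Sum>p\<le>Suc (degree P).
        fun_lmult (case p of 0 \<Rightarrow> 0 | Suc j \<Rightarrow> coeff P j) ((du_lmult ^^ p) Q))"
    by (simp only: op_mult_superset coeff_du_lmult fun_lmult_add_left sum.distrib)
  also have "(\<Sum>p\<le>Suc (degree P). fun_lmult (u_deriv (coeff P p)) ((du_lmult ^^ p) Q)) =
      (\<Sum>p\<le>degree P. fun_lmult (u_deriv (coeff P p)) ((du_lmult ^^ p) Q))"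
    by (simp add: coeff_eq_0)
  also have "(\<Sum>p\<le>Suc (degree P).
        fun_lmult (case p of 0 \<Rightarrow> 0 | Suc j \<Rightarrow> coeff P j) ((du_lmult ^^ p) Q)) =
      (\<Sum>p\<le>degree P. fun_lmult (coeff P p) (du_lmult ((du_lmult ^^ p) Q)))"
    by (simp add: sum.atMost_Suc_shift del: sum.atMost_Suc)
  finally show ?thesis
    by (simp add: op_mult_def du_lmult_sum du_fun_lmult sum.distrib)
qed

lemma op_mult_assoc: "op_mult (op_mult P Q) R = op_mult P (op_mult Q R)"
proof -
  have "op_mult ((du_lmult ^^ p) Q) R = (du_lmult ^^ p) (op_mult Q R)" for p
    by (induction p) (simp_all add: op_mult_du_lmult)
  then show ?thesis
    unfolding op_mult_def[of P] by (simp add: op_mult_sum_left op_mult_fun_lmult)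
qed

lemma op_mult_1_left: "op_mult [:1:] Q = Q"
  by (simp add: op_mult_def)

lemma op_mult_1_right: "op_mult P [:1:] = P"
proof -
  have "(du_lmult ^^ p) [:1:] = (monom 1 p :: 'a fls poly)" for p
    by (induction p)
      (auto intro!: poly_eqI simp: coeff_du_lmult monom_0 coeff_pCons split: nat.splits)
  then have "op_mult P [:1:] = (\<Sum>p\<le>degree P. fun_lmult (coeff P p) (monom 1 p))"
    by (simp add: op_mult_def)
  also have "\<dots> = P"
    by (rule poly_eqI) (simp add: coeff_sum coeff_eq_0 if_distrib[where f = "\<lambda>x. _ * x"] cong: if_cong)
  finally show ?thesis .
qed

typedef (overloaded) 'a diffop = "UNIV :: 'a::ring_1 fls poly set"
  morphisms op_poly Diffop ..

setup_lifting type_definition_diffop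

instantiation diffop :: (ring_1) ring_1
begin

lift_definition zero_diffop :: "'a diffop" is 0 .
lift_definition one_diffop :: "'a diffop" is "[:1:]" .
lift_definition plus_diffop :: "'a diffop \<Rightarrow> 'a diffop \<Rightarrow> 'a diffop" is "(+)" .
lift_definition minus_diffop :: "'a diffop \<Rightarrow> 'a diffop \<Rightarrow> 'a diffop" is "(-)" .
lift_definition uminus_diffop :: "'a diffop \<Rightarrow> 'a diffop" is uminus .
lift_definition times_diffop :: "'a diffop \<Rightarrow> 'a diffop \<Rightarrow> 'a diffop" is op_mult .

instance
  by standard
    (transfer, simp add: op_mult_assoc op_mult_1_left op_mult_1_right op_mult_add_left
      op_mult_add_right algebra_simps)+

end

definition op_fun :: "'a::ring_1 fls \<Rightarrow> 'a diffop" where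
  "op_fun f = Diffop [:f:]"

lift_definition op_du :: "'a::ring_1 diffop" is "[:0, 1:]" .

lemma op_fun_mult: "op_fun (f * g) = op_fun f * op_fun g"
  unfolding op_fun_def times_diffop.abs_eq
  by (intro arg_cong[where f = Diffop] poly_eqI) (simp add: op_mult_def coeff_pCons split: nat.split)

lemma op_du_op_fun: "op_du * op_fun f = op_fun f * op_du + op_fun (u_deriv f)"
  unfolding op_fun_def op_du_def times_diffop.abs_eq plus_diffop.abs_eq
  by (intro arg_cong[where f = Diffop] poly_eqI)
    (simp add: op_mult_def coeff_du_lmult coeff_pCons split: nat.split)


section \<open>The matrix and its column determinant\<close>

text \<open>Coefficientwise inclusion of the Laurent series with complex coefficients.\<close>

definition weyl_series :: "complex fls \<Rightarrow> ('m::len0, 'n::len0, 'k::len0) weyl fls" where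
  "weyl_series f = Abs_fls (\<lambda>r. weyl_of_complex (fls_nth f r))"

lemma weyl_series_nth:
  "fls_nth (weyl_series f :: ('m::len0, 'n::len0, 'k::len0) weyl fls) r = weyl_of_complex (fls_nth f r)"
proof -
  have "weyl_of_complex 0 = (0 :: ('m, 'n, 'k) weyl)"
    by (simp add: weyl_of_complex.abs_eq zero_weyl_def)
  moreover obtain N where "\<forall>r<N. fls_nth f r = 0" by (elim fls_nth_vanishes_belowE)
  ultimately have "\<forall>r<N. weyl_of_complex (fls_nth f r) = (0 :: ('m, 'n, 'k) weyl)" by simp
  then show ?thesis unfolding weyl_series_def by (rule nth_Abs_fls_lower_bound)
qed

text \<open>
  \<open>1/(u - c)\<close> expanded in powers of \<open>u\<^sup>-\<^sup>1\<close>: the inverse is taken in the field of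
  complex Laurent series in \<open>u\<^sup>-\<^sup>1\<close>.
\<close>

definition pole :: "complex \<Rightarrow> complex fls" where
  "pole c = inverse (fls_X_inv - fls_const c)"

definition op_complex :: "complex \<Rightarrow> ('m::len0, 'n::len0, 'k::len0) weyl diffop" where
  "op_complex c = op_fun (weyl_series (fls_const c))"

definition G_matrix :: "nat \<Rightarrow> (nat \<Rightarrow> complex) \<Rightarrow> (nat \<Rightarrow> complex) \<Rightarrow>
    nat \<Rightarrow> nat \<Rightarrow> ('m::len0, 'n::len0, 'k::len0) weyl diffop" where
  "G_matrix N \<Lambda> z a b =
     (if a = b then op_du - op_complex (z a) else 0)
       - (\<Sum>i = 1..N. op_fun (fls_const (weyl_gen (GX i a) * weyl_gen (GD i b))
                               * weyl_series (pole (\<Lambda> i))))"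

definition cdet :: "nat \<Rightarrow> (nat \<Rightarrow> nat \<Rightarrow> 'a) \<Rightarrow> 'a::ring_1" where
  "cdet k G = (\<Sum>\<sigma> | \<sigma> permutes {1..k}.
     of_int (sign \<sigma>) * prod_list (map (\<lambda>b. G (\<sigma> b) b) [1..<Suc k]))"


section \<open>Normal ordered words\<close>

fun gen_le :: "gen \<Rightarrow> gen \<Rightarrow> bool" where
  "gen_le (GX i a) (GX j b) \<longleftrightarrow> a < b \<or> a = b \<and> i \<le> j"
| "gen_le (GX i a) (GD j b) \<longleftrightarrow> True"
| "gen_le (GD i a) (GX j b) \<longleftrightarrow> False"
| "gen_le (GD i a) (GD j b) \<longleftrightarrow> a < b \<or> a = b \<and> i \<le> j"

definition normal_ordered :: "gen list \<Rightarrow> bool" where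
  "normal_ordered gs \<longleftrightarrow> sorted_wrt gen_le gs"


section \<open>Combinatorial data\<close>

definition fibre :: "nat \<Rightarrow> (nat \<Rightarrow> nat) \<Rightarrow> nat \<Rightarrow> nat set" where
  "fibre k j i = {a \<in> {1..k}. j a = i}"

definition J_set :: "nat \<Rightarrow> nat \<Rightarrow> nat \<Rightarrow> nat set \<Rightarrow> (nat \<Rightarrow> nat) set" where
  "J_set m n k \<aa> = {j \<in> {1..k} \<rightarrow>\<^sub>E {0..m + n}.
     (\<forall>a\<in>{1..k}. j a = 0 \<longleftrightarrow> a \<notin> \<aa>) \<and> (\<forall>i\<in>{1..m}. card (fibre k j i) \<le> 1)}"

definition J_equiv :: "nat \<Rightarrow> (nat \<Rightarrow> nat) \<Rightarrow> (nat \<Rightarrow> nat) \<Rightarrow> bool" where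
  "J_equiv k j1 j2 \<longleftrightarrow> (\<forall>i. card (fibre k j1 i) = card (fibre k j2 i))"

text \<open>\<open>elt \<aa> s\<close> is \<open>a\<^sub>s\<close>, the \<open>s\<close>-th smallest element of \<open>\<aa>\<close>, counting from \<open>s = 1\<close>.\<close>

definition elt :: "nat set \<Rightarrow> nat \<Rightarrow> nat" where
  "elt \<aa> s = sorted_list_of_set \<aa> ! (s - 1)"

definition J_perm :: "nat \<Rightarrow> nat \<Rightarrow> nat \<Rightarrow> nat set \<Rightarrow> (nat \<Rightarrow> nat) \<Rightarrow> (nat \<Rightarrow> nat) \<Rightarrow> nat \<Rightarrow> nat" where
  "J_perm m n k \<aa> j1 j2 = (THE \<sigma>. \<sigma> permutes {1..card \<aa>} \<and>
     (\<forall>i\<in>{1..m + n}.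
        let S = {s \<in> {1..card \<aa>}. elt \<aa> s \<in> fibre k j2 i} in
        (\<lambda>s. elt \<aa> (\<sigma> s)) ` S = fibre k j1 i \<and> strict_mono_on S (\<lambda>s. elt \<aa> (\<sigma> s))))"

definition J_sgn :: "nat \<Rightarrow> nat \<Rightarrow> nat \<Rightarrow> nat set \<Rightarrow> (nat \<Rightarrow> nat) \<Rightarrow> (nat \<Rightarrow> nat) \<Rightarrow> int" where
  "J_sgn m n k \<aa> j1 j2 = (let \<sigma> = J_perm m n k \<aa> j1 j2 in
     (-1) ^ card {(s, s'). 1 \<le> s \<and> s < s' \<and> s' \<le> card \<aa> \<and> \<sigma> s < \<sigma> s'
                     \<and> j2 (elt \<aa> s) > m \<and> j2 (elt \<aa> s') > m})"

definition J_coeff :: "nat \<Rightarrow> nat \<Rightarrow> nat \<Rightarrow> nat set \<Rightarrow> (nat \<Rightarrow> nat) \<Rightarrow> (nat \<Rightarrow> nat) \<Rightarrow> int" where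
  "J_coeff m n k \<aa> j1 j2 =
     J_sgn m n k \<aa> j1 j2 * sign (J_perm m n k \<aa> j1 j2) * (-1) ^ card \<aa>"

definition x_word :: "nat set \<Rightarrow> (nat \<Rightarrow> nat) \<Rightarrow> gen list" where
  "x_word \<aa> j = map (\<lambda>a. GX (j a) a) (sorted_list_of_set \<aa>)"

definition d_word :: "nat set \<Rightarrow> (nat \<Rightarrow> nat) \<Rightarrow> gen list" where
  "d_word \<aa> j = map (\<lambda>a. GD (j a) a) (sorted_list_of_set \<aa>)"

end

theory Submission
  imports Defs
begin

text \<open>
  Multiply out the columns from right to left, normal ordering after each step. Moving
  \<open>\<partial>\<^bsub>i,b\<^esub>\<close> past the later columns produces one correction for the column \<open>c\<close> with
  \<open>\<sigma>(c) = b\<close>: there \<open>x\<^bsub>i,b\<^esub>\<close> becomes \<open>x\<^bsub>i,\<sigma>(b)\<^esub>\<close> and \<open>(u - \<Lambda>\<^sub>i)\<^sup>-\<^sup>1\<close> is squared. Moving \<open>\<partial>\<^sub>u\<close>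
  differentiates \<open>(u - \<Lambda>\<^sub>i)\<^sup>-\<^sup>1\<close> in each later column \<open>c\<close>. The first correction for \<open>\<sigma>\<close> and the second
  for \<open>\<sigma> \<circ> (b c)\<close> have equal size and opposite signatures, so all corrections cancel and the
  determinant equals its normal ordered version. In the latter, the terms with given labels
  \<open>j\<^sub>2\<close> of the columns are sorted; the sign of \<open>\<sigma>\<close> times the sign of the sorting depends only on
  \<open>j\<^sub>1 = j\<^sub>2 \<circ> \<sigma>\<^sup>-\<^sup>1\<close>, and the permutations with the same \<open>j\<^sub>1\<close> differ by permutations of the
  fibres of \<open>j\<^sub>2\<close>.
\<close>

section \<open>Cancellation of the corrections\<close>

text \<open>Why the corrections match: if \<sigma>(c) = b, then \<tau> = \<sigma> \<circ> (b c)
  fixes b and sends c to \<sigma>(b). So column b of \<tau> offers its diagonal term, whose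
  derivative hits the pole in column c, now with row \<sigma>(b). The direction from right to left
  matters because \<sigma> and \<tau> agree on the columns before b, which are not yet expanded. Why
  the final sign depends only on the labels: a permutation of a fibre of \<open>j2\<close>
  multiplies the sign of \<sigma> by its own sign. If the label is odd, sorting the x's yields that
  sign once more, so the terms agree and a factorial counts them. If it is even, sorting yields
  nothing and the terms cancel; this leaves even labels used at most once, as \<open>J_set\<close>
  demands. Where the count in \<open>J_sgn\<close> comes from: each pair x, d encloses the later
  columns, so the d's appear in reverse order, and turning them around costs one sign for every pair
  of odd labels. Together with the inversions met in sorting the x's this leaves the pairs that
  \<sigma> keeps in order. The power of -1 with exponent l is the minus sign of the sum in each
  entry.\<close>

definition koszul :: "nat \<Rightarrow> nat \<Rightarrow> nat \<Rightarrow> 'a::ring_1" where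
  "koszul m i j = (if m < i \<and> m < j then -1 else 1)"

lemma koszul_cases: "koszul m i j = (1 :: 'a::ring_1) \<or> koszul m i j = (-1 :: 'a)"
  by (simp add: koszul_def)

lemma koszul_sq: "koszul m i j * koszul m i j = 1"
  "koszul m i j * (koszul m i j * x) = x"
  by (simp_all add: koszul_def)

lemma koszul_sym: "koszul m i j = koszul m j i"
  by (auto simp: koszul_def)

text \<open>All that the calculation uses about the entries of the matrix. In \<open>T_F\<close>,
  \<open>F i\<close> plays 1/(u - \<Lambda>_i), whose derivative is minus its square, and
  \<open>T a\<close> plays d/du minus a constant. The relations of \<open>X\<close> and
  \<open>D\<close> are confined to the index range because generators outside it vanish in the Weyl
  quotient, where \<open>D_X\<close> at equal indices would read 0 = 1.\<close>

locale capelli_system =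
  fixes m r k :: nat
    and X D :: "nat \<Rightarrow> nat \<Rightarrow> 'r::ring_1"
    and F T :: "nat \<Rightarrow> 'r"
  assumes X_X: "\<lbrakk>i \<in> {1..r}; j \<in> {1..r}; a \<in> {1..k}; b \<in> {1..k}\<rbrakk>
      \<Longrightarrow> X i a * X j b = koszul m i j * (X j b * X i a)"
    and D_D: "\<lbrakk>i \<in> {1..r}; j \<in> {1..r}; a \<in> {1..k}; b \<in> {1..k}\<rbrakk>
      \<Longrightarrow> D i a * D j b = koszul m i j * (D j b * D i a)"
    and D_X: "\<lbrakk>i \<in> {1..r}; j \<in> {1..r}; a \<in> {1..k}; b \<in> {1..k}\<rbrakk>
      \<Longrightarrow> D i a * X j b = koszul m i j * (X j b * D i a) + (if i = j \<and> a = b then 1 else 0)"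
    and F_X: "F i * X j b = X j b * F i"
    and F_D: "F i * D j b = D j b * F i"
    and F_F: "F i * F j = F j * F i"
    and T_X: "T a * X j b = X j b * T a"
    and T_D: "T a * D j b = D j b * T a"
    and T_F: "T a * F i = F i * T a - F i * F i"
    and T_T: "T a * T b = T b * T a"
begin

text \<open>\<open>F i\<close> stands between \<open>X\<close> and \<open>D\<close>, while
  \<open>G_matrix\<close> has it at the end. It commutes with both, and this form matches the
  sandwich in \<open>normal_prod\<close>.\<close>

definition gmat :: "nat \<Rightarrow> nat \<Rightarrow> 'r" where
  "gmat a b = (if a = b then T b else 0) - (\<Sum>i=1..r. X i a * F i * D i b)"

text \<open>
  The normal ordered product of the entries \<open>(a, b)\<close> of the list. Sandwiching the rest of the
  product between \<open>x\<^bsub>i,a\<^esub>\<close> and \<open>\<partial>\<^bsub>i,b\<^esub>\<close> puts the generators into the order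
  \<open>x \<dots> x \<partial> \<dots> \<partial>\<close> without producing a sign.
\<close>

fun normal_prod :: "(nat \<times> nat) list \<Rightarrow> 'r" where
  "normal_prod [] = 1"
| "normal_prod ((a, b) # ps) = (if a = b then normal_prod ps * T b else 0)
     - (\<Sum>i=1..r. X i a * F i * normal_prod ps * D i b)"

text \<open>
  The part of the derivative of \<open>normal_prod\<close> with respect to \<open>u\<close>, with opposite sign, that
  comes from the summand with index \<open>i\<close> in column \<open>c\<close>.
\<close>

fun marked_prod :: "nat \<Rightarrow> nat \<Rightarrow> (nat \<times> nat) list \<Rightarrow> 'r" where
  "marked_prod i c [] = 0"
| "marked_prod i c ((a, b) # ps) =
     (if b = c then - (X i a * F i * F i * normal_prod ps * D i b)
      else (if a = b then marked_prod i c ps * T b else 0)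
        - (\<Sum>j=1..r. X j a * F j * marked_prod i c ps * D j b))"

text \<open>Leibniz rule: the commutator with \<open>T e\<close> kills every \<open>X\<close>,
  \<open>D\<close> and \<open>T\<close> and sends \<open>F i\<close> to its negative square,
  whatever \<open>e\<close> is. Distinct columns let \<open>c\<close> single out the factor whose
  \<open>F\<close> is hit.\<close>

lemma T_normal_prod:
  assumes "distinct (map snd ps)"
  shows "T e * normal_prod ps = normal_prod ps * T e
    - (\<Sum>c\<in>snd ` set ps. \<Sum>i=1..r. marked_prod i c ps)"
  using assms
proof (induction ps)
  case (Cons p ps)
  obtain a b where p: "p = (a, b)" by fastforce
  let ?S = "snd ` set ps"
  let ?M = "\<Sum>c\<in>?S. \<Sum>i=1..r. marked_prod i c ps"
  have b: "b \<notin> ?S" using Cons.prems p by auto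
  have IH: "T e * normal_prod ps = normal_prod ps * T e - ?M" using Cons by simp
  have TXF: "T e * (X j a * F j * w * D j b)
      = X j a * F j * (T e * w) * D j b - X j a * F j * F j * w * D j b" for j w
  proof -
    have "T e * (X j a * F j * w * D j b) = X j a * (T e * F j) * w * D j b"
      by (metis T_X mult.assoc)
    then show ?thesis by (simp add: T_F algebra_simps)
  qed
  have DT: "X j a * F j * w * D j b * T e = X j a * F j * (w * T e) * D j b" for j w
    by (metis T_D mult.assoc)
  have Mb: "(\<Sum>i=1..r. marked_prod i b (p # ps)) = - (\<Sum>i=1..r. X i a * F i * F i * normal_prod ps * D i b)"
    by (simp add: p sum_negf)
  have Mc: "(\<Sum>c\<in>?S. \<Sum>i=1..r. marked_prod i c (p # ps)) =
     (if a = b then ?M * T b else 0) - (\<Sum>j=1..r. X j a * F j * ?M * D j b)"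
  proof -
    have "(\<Sum>c\<in>?S. \<Sum>i=1..r. marked_prod i c (p # ps)) =
      (\<Sum>c\<in>?S. \<Sum>i=1..r. (if a = b then marked_prod i c ps * T b else 0)
        - (\<Sum>j=1..r. X j a * F j * marked_prod i c ps * D j b))"
      using b by (intro sum.cong refl) (auto simp: p)
    also have "\<dots> = (\<Sum>c\<in>?S. \<Sum>i=1..r. (if a = b then marked_prod i c ps * T b else 0))
       - (\<Sum>c\<in>?S. \<Sum>i=1..r. \<Sum>j=1..r. X j a * F j * marked_prod i c ps * D j b)"
      by (simp add: sum_subtractf)
    also have "(\<Sum>c\<in>?S. \<Sum>i=1..r. (if a = b then marked_prod i c ps * T b else 0)) = 
       (if a = b then ?M * T b else 0)"
      by (simp add: sum_distrib_right)
    also have "(\<Sum>c\<in>?S. \<Sum>i=1..r. \<Sum>j=1..r. X j a * F j * marked_prod i c ps * D j b)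
      = (\<Sum>j=1..r. \<Sum>c\<in>?S. \<Sum>i=1..r. X j a * F j * marked_prod i c ps * D j b)"
      by (subst sum.swap[of _ "{1..r}"], subst sum.swap[of _ ?S]) (rule refl)
    finally show ?thesis by (simp add: sum_distrib_left sum_distrib_right)
  qed
  have T1: "T e * (if a = b then normal_prod ps * T b else 0) =
      (if a = b then normal_prod ps * T b else 0) * T e - (if a = b then ?M * T b else 0)"
  proof -
    have "T e * (normal_prod ps * T b) = (normal_prod ps * T e - ?M) * T b"
      using IH by (metis mult.assoc)
    also have "\<dots> = normal_prod ps * T b * T e - ?M * T b"
      by (simp add: left_diff_distrib mult.assoc T_T)
    finally show ?thesis by simp
  qed
  have T2: "T e * (\<Sum>j=1..r. X j a * F j * normal_prod ps * D j b) = 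
     (\<Sum>j=1..r. X j a * F j * normal_prod ps * D j b) * T e
     - (\<Sum>j=1..r. X j a * F j * ?M * D j b) - (\<Sum>j=1..r. X j a * F j * F j * normal_prod ps * D j b)"
    unfolding sum_distrib_left[of "T e"] sum_distrib_right[of _ _ "T e"] sum_subtractf[symmetric]
    by (rule sum.cong[OF refl], simp only: TXF IH DT) (simp add: algebra_simps)
  have "(\<Sum>c\<in>snd ` set (p # ps). \<Sum>i=1..r. marked_prod i c (p # ps)) =
     (\<Sum>i=1..r. marked_prod i b (p # ps)) + (\<Sum>c\<in>?S. \<Sum>i=1..r. marked_prod i c (p # ps))"
    using b by (simp add: p)
  then show ?case
    unfolding Mb Mc using T1 T2
    by (simp add: p right_diff_distrib left_diff_distrib)
qed simp

text \<open>No contraction can occur, as \<open>e\<close> is not a row. In each factor the signs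
  from passing \<open>X j a\<close> and \<open>D j b\<close> are equal and cancel.\<close>

lemma D_normal_prod_notin:
  assumes "i \<in> {1..r}" "e \<in> {1..k}" "set ps \<subseteq> {1..k} \<times> {1..k}" "e \<notin> fst ` set ps"
  shows "D i e * normal_prod ps = normal_prod ps * D i e"
  using assms(3,4)
proof (induction ps)
  case (Cons p ps)
  obtain a b where p: "p = (a, b)" by fastforce
  have ab: "a \<in> {1..k}" "b \<in> {1..k}" "a \<noteq> e" using Cons.prems p by auto
  have IH: "D i e * normal_prod ps = normal_prod ps * D i e" using Cons by auto
  have "D i e * (X j a * F j * normal_prod ps * D j b) = X j a * F j * normal_prod ps * D j b * D i e"
    if j: "j \<in> {1..r}" for j
  proof -
    have "D i e * (X j a * F j * normal_prod ps * D j b)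
       = koszul m i j * (X j a * (D i e * F j) * normal_prod ps * D j b)"
      using D_X[OF assms(1) j assms(2) ab(1)] ab by (simp flip: mult.assoc)
    also have "\<dots> = koszul m i j * (X j a * F j * normal_prod ps * (D i e * D j b))"
      by (simp add: mult.assoc flip: F_D) (simp add: IH flip: mult.assoc)
    also have "\<dots> = X j a * F j * normal_prod ps * D j b * D i e"
      using koszul_cases[where 'a='r, of m i j] D_D[OF assms(1) j assms(2) ab(2)]
      by (elim disjE) (simp_all add: mult.assoc)
    finally show ?thesis .
  qed
  then have "D i e * (\<Sum>j=1..r. X j a * F j * normal_prod ps * D j b) =
      (\<Sum>j=1..r. X j a * F j * normal_prod ps * D j b) * D i e"
    unfolding sum_distrib_left sum_distrib_right by (intro sum.cong refl) auto
  moreover have "D i e * (normal_prod ps * T b) = normal_prod ps * T b * D i e"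
    by (metis IH T_D mult.assoc)
  ultimately show ?case by (simp add: p algebra_simps)
qed simp

text \<open>Rows are distinct, so \<open>D i e\<close> contracts only with \<open>X i e\<close>, in
  column \<open>c\<close>; this uses up that generator and leaves \<open>F i\<close> and
  \<open>D i c\<close> with a minus sign. As \<open>X i a * F i\<close> is carried into the gap, it
  picks up the same signs as \<open>D i e\<close> did on its way, so all of them cancel. Since
  \<open>e\<close> is not a column, the factor with row \<open>e\<close> has no diagonal
  part.\<close>

lemma D_normal_prod:
  assumes i: "i \<in> {1..r}" and e: "e \<in> {1..k}" and a: "a \<in> {1..k}"
    and "set ps \<subseteq> {1..k} \<times> {1..k}" "distinct (map fst ps)" "distinct (map snd ps)"
    and "e \<notin> snd ` set ps" "(e, c) \<in> set ps"
  shows "X i a * F i * (D i e * normal_prod ps - normal_prod ps * D i e)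
    = marked_prod i c (map (\<lambda>(s, t). (if s = e then a else s, t)) ps)"
  using assms(4-)
proof (induction ps)
  case (Cons p ps)
  obtain s t where p: "p = (s, t)" by fastforce
  have st: "s \<in> {1..k}" "t \<in> {1..k}" "t \<noteq> e" using Cons.prems p by auto
  let ?N = "normal_prod ps"
  have DX: "D i e * (X j s * F j * ?N * D j t) = 
      koszul m i j * (X j s * F j * (D i e * ?N) * D j t)
        + (if i = j \<and> e = s then F j * ?N * D j t else 0)"
    if j: "j \<in> {1..r}" for j
  proof -
    have "D i e * (X j s * F j * ?N * D j t)
       = koszul m i j * (X j s * (D i e * F j) * ?N * D j t)
         + (if i = j \<and> e = s then F j * ?N * D j t else 0)"
      using D_X[OF i j e st(1)] by (simp add: distrib_right flip: mult.assoc)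
    then show ?thesis by (simp add: mult.assoc flip: F_D)
  qed
  have DD: "X j s * F j * ?N * D j t * D i e = koszul m i j * (X j s * F j * (?N * D i e) * D j t)"
    if j: "j \<in> {1..r}" for j
    using koszul_cases[where 'a='r, of m i j] D_D[OF j i st(2) e]
    unfolding koszul_sym[of m j i] by (elim disjE) (simp_all add: mult.assoc)
  \<comment> \<open>The sign from \<open>X j s\<close> on the left equals the sign from
    \<open>D j t\<close> on the right, so the commutator moves inside the sandwich; a contraction is
    added only when \<open>s = e\<close>.\<close>
  have comm: "D i e * (\<Sum>j=1..r. X j s * F j * ?N * D j t) - (\<Sum>j=1..r. X j s * F j * ?N * D j t) * D i e
     = (\<Sum>j=1..r. koszul m i j * (X j s * F j * (D i e * ?N - ?N * D i e) * D j t))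
       + (if e = s then F i * ?N * D i t else 0)"
  proof -
    have "D i e * (\<Sum>j=1..r. X j s * F j * ?N * D j t) - (\<Sum>j=1..r. X j s * F j * ?N * D j t) * D i e
     = (\<Sum>j=1..r. koszul m i j * (X j s * F j * (D i e * ?N - ?N * D i e) * D j t)
       + (if i = j \<and> e = s then F j * ?N * D j t else 0))"
      unfolding sum_distrib_left sum_distrib_right sum_subtractf[symmetric]
      by (rule sum.cong[OF refl], simp only: DX DD) (simp add: algebra_simps)
    also have "\<dots> = (\<Sum>j=1..r. koszul m i j * (X j s * F j * (D i e * ?N - ?N * D i e) * D j t))
       + (\<Sum>j=1..r. if i = j then (if e = s then F j * ?N * D j t else 0) else 0)"
      unfolding sum.distrib by (intro arg_cong2[where f = "(+)"] sum.cong refl) auto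
    finally show ?thesis using i by simp
  qed
  show ?case
  proof (cases "s = e")
    case True
    have tc: "t = c"
      using Cons.prems True p by (auto simp: rev_image_eqI)
    have e': "e \<notin> fst ` set ps" using Cons.prems p True by auto
    then have zero: "D i e * ?N - ?N * D i e = 0"
      using D_normal_prod_notin[OF i e, of ps] Cons.prems by simp
    have "map (\<lambda>(s, t). (if s = e then a else s, t)) ps = ps"
      using e' by (intro map_idI) (auto simp: rev_image_eqI)
    moreover have "X i a * F i * (D i e * normal_prod (p # ps) - normal_prod (p # ps) * D i e) =
       - (X i a * F i * F i * ?N * D i t)"
    proof -
      have "D i e * normal_prod (p # ps) - normal_prod (p # ps) * D i e = 
        - (D i e * (\<Sum>j=1..r. X j s * F j * ?N * D j t) - (\<Sum>j=1..r. X j s * F j * ?N * D j t) * D i e)"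
        using st True by (simp add: p)
      also have "\<dots> = - (F i * ?N * D i t)" unfolding comm zero using True by simp
      finally show ?thesis by (simp add: mult.assoc)
    qed
    ultimately show ?thesis by (simp add: p True tc)
  next
    case False
    have ps: "(e, c) \<in> set ps" using Cons.prems False p by auto
    then have tc: "t \<noteq> c" using Cons.prems p by (auto simp: rev_image_eqI)
    define H where "H = D i e * ?N - ?N * D i e"
    let ?M = "marked_prod i c (map (\<lambda>(s, t). (if s = e then a else s, t)) ps)"
    have IH: "X i a * F i * H = ?M"
      using Cons.IH Cons.prems ps unfolding H_def by auto
    have DT: "D i e * (?N * T t) - ?N * T t * D i e = H * T t"
      by (simp add: H_def algebra_simps T_D)
    have "D i e * normal_prod (p # ps) - normal_prod (p # ps) * D i e = 
        (if s = t then H * T t else 0)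
        - (D i e * (\<Sum>j=1..r. X j s * F j * ?N * D j t) - (\<Sum>j=1..r. X j s * F j * ?N * D j t) * D i e)"
      using DT by (simp add: p algebra_simps)
    also have "\<dots> = (if s = t then H * T t else 0)
       - (\<Sum>j=1..r. koszul m i j * (X j s * F j * H * D j t))"
      unfolding comm H_def using False by simp
    finally have eq: "X i a * F i * (D i e * normal_prod (p # ps) - normal_prod (p # ps) * D i e) = 
       (if s = t then X i a * F i * H * T t else 0)
       - (\<Sum>j=1..r. X i a * F i * (koszul m i j * (X j s * F j * H * D j t)))"
      by (cases "s = t") (simp_all add: right_diff_distrib sum_distrib_left mult.assoc)
    \<comment> \<open>Carrying \<open>X i a\<close> past \<open>X j s\<close> produces a second
      Koszul sign, which undoes the one left by \<open>D i e\<close>.\<close>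
    have XX: "X i a * F i * (koszul m i j * (X j s * F j * H * D j t)) = X j s * F j * ?M * D j t"
      if j: "j \<in> {1..r}" for j
    proof -
      have "X i a * F i * (koszul m i j * (X j s * F j * H * D j t))
         = koszul m i j * (X i a * (F i * X j s) * F j * H * D j t)"
        using koszul_cases[where 'a='r, of m i j] by (elim disjE) (simp_all add: mult.assoc)
      also have "\<dots> = koszul m i j * ((X i a * X j s) * (F i * F j) * H * D j t)"
        unfolding F_X by (simp only: mult.assoc)
      also have "\<dots> = X j s * X i a * (F j * F i) * H * D j t"
        unfolding X_X[OF i j a st(1)] F_F[of i j] by (simp add: mult.assoc koszul_sq)
      also have "\<dots> = X j s * (X i a * F j) * (F i * H) * D j t"
        by (simp add: mult.assoc)
      also have "\<dots> = X j s * (F j * X i a) * (F i * H) * D j t"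
        unfolding F_X ..
      also have "\<dots> = X j s * F j * ?M * D j t"
        unfolding IH[symmetric] mult.assoc ..
      finally show ?thesis .
    qed
    have "(\<Sum>j=1..r. X i a * F i * (koszul m i j * (X j s * F j * H * D j t)))
        = (\<Sum>j=1..r. X j s * F j * ?M * D j t)"
      by (rule sum.cong[OF refl XX])
    then show ?thesis
      unfolding eq IH using tc False by (simp add: p)
  qed
qed simp

text \<open>Columns \<open>t + 1, ..., k\<close>: here \<open>t\<close> is the number of columns
  still to be multiplied in.\<close>

abbreviation graph_list :: "(nat \<Rightarrow> nat) \<Rightarrow> nat \<Rightarrow> (nat \<times> nat) list" where
  "graph_list \<sigma> t \<equiv> map (\<lambda>b. (\<sigma> b, b)) [Suc t..<Suc k]"

text \<open>One quantity serves both kinds of correction: it is what differentiation produces when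
  \<sigma> fixes \<open>b\<close>, and a contraction for a permutation is the same expression at its
  composite with \<open>transpose b c\<close>.\<close>

definition correction :: "(nat \<Rightarrow> nat) \<Rightarrow> nat \<Rightarrow> nat \<Rightarrow> 'r" where
  "correction \<sigma> b c = (\<Sum>i=1..r. marked_prod i c (graph_list \<sigma> b))"

text \<open>Only if \<open>\<sigma> b = b\<close> is there a \<open>T b\<close> to move. The
  contraction renames row \<open>b\<close> of column \<open>c\<close> to \<open>\<sigma> b\<close>,
  and the renamed list is the graph of \<open>\<sigma> \<circ> transpose b c\<close> beyond column
  \<open>b\<close>; if \<open>b\<close> is the row of no later column, nothing is
  contracted.\<close>

lemma gmat_normal_prod:
  assumes \<sigma>: "\<sigma> permutes {1..k}" and t: "t < k"
  defines "b \<equiv> Suc t"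
  shows "gmat (\<sigma> b) b * normal_prod (graph_list \<sigma> b) = normal_prod (graph_list \<sigma> t)
    - (\<Sum>c=Suc b..k. (if \<sigma> b = b then correction \<sigma> b c else 0)
        + (if \<sigma> c = b then correction (\<sigma> \<circ> transpose b c) b c else 0))"
proof -
  let ?ps = "graph_list \<sigma> b" and ?a = "\<sigma> b"
  let ?N = "normal_prod ?ps"
  have b: "b \<in> {1..k}" using t by (simp add: b_def)
  have a: "?a \<in> {1..k}" using permutes_in_image[OF \<sigma>] b by simp
  have inj: "\<sigma> x = \<sigma> y \<longleftrightarrow> x = y" for x y using permutes_inj[OF \<sigma>] by (simp add: inj_eq)
  have ps: "set ?ps \<subseteq> {1..k} \<times> {1..k}" 
  proof -
    have "\<sigma> x \<in> {1..k}" if "x \<in> {1..k}" for x using permutes_in_image[OF \<sigma>] that by simp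
    then show ?thesis by fastforce
  qed
  have fst_ps: "map fst ?ps = map \<sigma> [Suc b..<Suc k]" and snd_ps: "map snd ?ps = [Suc b..<Suc k]"
    by (simp_all add: comp_def map_idI)
  have df: "distinct (map fst ?ps)"
    unfolding fst_ps distinct_map using inj by (auto intro: inj_onI)
  have ds: "distinct (map snd ?ps)" unfolding snd_ps by simp
  have sset: "snd ` set ?ps = {Suc b..k}"
    unfolding set_map[symmetric] snd_ps by auto
  have e: "b \<notin> snd ` set ?ps" unfolding sset by simp
  have cons: "graph_list \<sigma> t = (?a, b) # ?ps"
    using t by (subst upt_conv_Cons) (simp_all add: b_def)
  have "(\<Sum>i=1..r. X i ?a * F i * D i b) * ?N - (\<Sum>i=1..r. X i ?a * F i * ?N * D i b)
      = (\<Sum>i=1..r. X i ?a * F i * (D i b * ?N - ?N * D i b))"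
    by (simp add: sum_distrib_left sum_distrib_right algebra_simps flip: sum_subtractf)
  also have "\<dots> = (\<Sum>c=Suc b..k. if \<sigma> c = b then correction (\<sigma> \<circ> transpose b c) b c else 0)"
  proof (cases "\<exists>c\<in>{Suc b..k}. \<sigma> c = b")
    case True
    then obtain c where c: "c \<in> {Suc b..k}" "\<sigma> c = b" by blast
    then have bc: "(b, c) \<in> set ?ps" by (auto simp: image_iff)
    have eq: "map (\<lambda>(s, t). (if s = b then ?a else s, t)) ?ps = graph_list (\<sigma> \<circ> transpose b c) b"
      using c inj by (auto simp: transpose_def)
    have "(\<Sum>i=1..r. X i ?a * F i * (D i b * ?N - ?N * D i b))
      = correction (\<sigma> \<circ> transpose b c) b c"
      unfolding correction_def
    proof (rule sum.cong[OF refl])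
      fix i assume i: "i \<in> {1..r}"
      show "X i ?a * F i * (D i b * ?N - ?N * D i b)
          = marked_prod i c (graph_list (\<sigma> \<circ> transpose b c) b)"
        using D_normal_prod[OF i b a ps df ds e bc] unfolding eq .
    qed
    also have "\<dots> = (\<Sum>c'\<in>{c}. if \<sigma> c' = b then correction (\<sigma> \<circ> transpose b c') b c' else 0)"
      using c by simp
    also have "\<dots> = (\<Sum>c=Suc b..k. if \<sigma> c = b then correction (\<sigma> \<circ> transpose b c) b c else 0)"
      using c inj by (intro sum.mono_neutral_left) auto
    finally show ?thesis .
  next
    case False
    then have "b \<notin> fst ` set ?ps" by auto
    then have "(\<Sum>i=1..r. X i ?a * F i * (D i b * ?N - ?N * D i b)) = 0"
      by (intro sum.neutral ballI) (simp add: D_normal_prod_notin[OF _ b ps] del: upt_Suc)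
    with False show ?thesis by simp
  qed
  finally have 1: "(\<Sum>i=1..r. X i ?a * F i * D i b) * ?N = (\<Sum>i=1..r. X i ?a * F i * ?N * D i b)
     + (\<Sum>c=Suc b..k. if \<sigma> c = b then correction (\<sigma> \<circ> transpose b c) b c else 0)"
    by (simp add: algebra_simps)
  have 2: "T b * ?N = ?N * T b - (\<Sum>c=Suc b..k. correction \<sigma> b c)"
    unfolding correction_def using T_normal_prod[OF ds, of b] unfolding sset .
  show ?thesis
    unfolding cons gmat_def left_diff_distrib 1 sum.distrib using 2 by simp
qed

text \<open>\<open>S t\<close> has its first \<open>t\<close> columns multiplied as they stand and
  the others normal ordered, so it joins the determinant at \<open>t = k\<close> to the normal
  ordered sum at \<open>t = 0\<close>. Each step changes nothing, since composing with
  \<open>transpose (t + 1) c\<close> reverses the sign and exchanges the two kinds of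
  correction.\<close>

lemma cdet_gmat:
  "cdet k gmat = (\<Sum>\<sigma> | \<sigma> permutes {1..k}. of_int (sign \<sigma>) * normal_prod (graph_list \<sigma> 0))"
proof -
  let ?P = "{\<sigma>. \<sigma> permutes {1..k}}"
  define pre where "pre \<sigma> t = prod_list (map (\<lambda>b. gmat (\<sigma> b) b) [1..<Suc t])" for \<sigma> t
  define S where "S t = (\<Sum>\<sigma>\<in>?P. of_int (sign \<sigma>) * (pre \<sigma> t * normal_prod (graph_list \<sigma> t)))" for t
  have step: "S (Suc t) = S t" if t: "t < k" for t
  proof -
    let ?b = "Suc t"
    \<comment> \<open>\<open>A\<close> collects the effect of differentiation on column
      \<open>c\<close>, \<open>B\<close> that of contraction with column \<open>c\<close>.\<close>
    define A where "A c \<sigma> = of_int (sign \<sigma>) * (pre \<sigma> t * (if \<sigma> ?b = ?b then correction \<sigma> ?b c else 0))" for c \<sigma>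
    define B where "B c \<sigma> = of_int (sign \<sigma>) * (pre \<sigma> t *
        (if \<sigma> c = ?b then correction (\<sigma> \<circ> transpose ?b c) ?b c else 0))" for c \<sigma>
    have AB: "A c (\<sigma> \<circ> transpose ?b c) = - B c \<sigma>" if c: "c \<in> {Suc ?b..k}" and \<sigma>: "\<sigma> \<in> ?P" for c \<sigma>
    proof -
      have "permutation \<sigma>" using \<sigma> by (auto simp: permutation_permutes)
      then have sg: "sign (\<sigma> \<circ> transpose ?b c) = - sign \<sigma>"
        using c by (simp add: sign_compose permutation_swap_id sign_swap_id)
      have "pre (\<sigma> \<circ> transpose ?b c) t = pre \<sigma> t"
        unfolding pre_def using c
        by (intro arg_cong[where f = prod_list] map_cong refl) (auto simp: transpose_def)
      then show ?thesis by (simp add: A_def B_def sg)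
    qed
    have cancel: "(\<Sum>\<sigma>\<in>?P. A c \<sigma> + B c \<sigma>) = 0" if c: "c \<in> {Suc ?b..k}" for c
    proof -
      have tr: "transpose ?b c permutes {1..k}"
        using c t by (intro permutes_swap_id) auto
      have "(\<Sum>\<sigma>\<in>?P. A c \<sigma>) = (\<Sum>\<sigma>\<in>?P. A c (\<sigma> \<circ> transpose ?b c))"
        by (rule sum_permutations_compose_right[OF tr])
      also have "\<dots> = - (\<Sum>\<sigma>\<in>?P. B c \<sigma>)"
        using AB[OF c] by (simp add: sum_negf)
      finally show ?thesis by (simp add: sum.distrib)
    qed
    have "S (Suc t) = (\<Sum>\<sigma>\<in>?P. of_int (sign \<sigma>) * (pre \<sigma> t * normal_prod (graph_list \<sigma> t))
        - (\<Sum>c=Suc ?b..k. A c \<sigma> + B c \<sigma>))"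
      unfolding S_def
    proof (rule sum.cong[OF refl])
      fix \<sigma> assume "\<sigma> \<in> ?P"
      then have \<sigma>: "\<sigma> permutes {1..k}" by simp
      have "pre \<sigma> (Suc t) * normal_prod (graph_list \<sigma> (Suc t)) = pre \<sigma> t *
          (gmat (\<sigma> ?b) ?b * normal_prod (graph_list \<sigma> ?b))"
        by (simp add: pre_def mult.assoc)
      also note gmat_normal_prod[OF \<sigma> t]
      finally show "of_int (sign \<sigma>) * (pre \<sigma> (Suc t) * normal_prod (graph_list \<sigma> (Suc t))) =
         of_int (sign \<sigma>) * (pre \<sigma> t * normal_prod (graph_list \<sigma> t)) - (\<Sum>c=Suc ?b..k. A c \<sigma> + B c \<sigma>)"
        unfolding A_def B_def
        by (simp only: right_diff_distrib sum_distrib_left distrib_left)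
    qed
    also have "\<dots> = S t - (\<Sum>\<sigma>\<in>?P. \<Sum>c=Suc ?b..k. A c \<sigma> + B c \<sigma>)"
      by (simp add: S_def sum_subtractf)
    also have "(\<Sum>\<sigma>\<in>?P. \<Sum>c=Suc ?b..k. A c \<sigma> + B c \<sigma>) = 0"
      by (subst sum.swap) (use cancel in simp)
    finally show ?thesis by simp
  qed
  have "S t = S 0" if "t \<le> k" for t
    using that by (induction t) (auto simp: step)
  then have "S k = S 0" by blast
  moreover have "S k = cdet k gmat" by (simp add: S_def cdet_def pre_def)
  moreover have "S 0 = (\<Sum>\<sigma>\<in>?P. of_int (sign \<sigma>) * normal_prod (graph_list \<sigma> 0))"
    by (simp add: S_def pre_def)
  ultimately show ?thesis by simp
qed

end

section \<open>Signs of permutations and of sorting\<close>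

definition incr_pairs :: "nat set \<Rightarrow> (nat \<times> nat) set" where
  "incr_pairs S = {(b, c). b \<in> S \<and> c \<in> S \<and> b < c}"

text \<open>Unlike \<open>sign\<close>, this makes sense on a set that \<open>f\<close> does not
  preserve: it will be applied to a permutation of \<open>\<aa>\<close>, but on the odd positions
  only.\<close>

definition inv_sign :: "nat set \<Rightarrow> (nat \<Rightarrow> nat) \<Rightarrow> int" where
  "inv_sign S f = (\<Prod>(b, c)\<in>incr_pairs S. if f c < f b then -1 else 1)"

lemma finite_incr_pairs: "finite S \<Longrightarrow> finite (incr_pairs S)"
  by (rule finite_subset[of _ "S \<times> S"]) (auto simp: incr_pairs_def)

lemma prod_incr_pairs_insert:
  fixes g :: "nat \<times> nat \<Rightarrow> 'a::comm_monoid_mult"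
  assumes "finite S" and "\<And>c. c \<in> S \<Longrightarrow> b < c"
  shows "prod g (incr_pairs (insert b S)) = (\<Prod>c\<in>S. g (b, c)) * prod g (incr_pairs S)"
proof -
  have "incr_pairs (insert b S) = Pair b ` S \<union> incr_pairs S"
    using assms(2) by (fastforce simp: incr_pairs_def)
  moreover have "Pair b ` S \<inter> incr_pairs S = {}"
    using assms(2) by (auto simp: incr_pairs_def)
  moreover have "prod g (Pair b ` S) = (\<Prod>c\<in>S. g (b, c))"
    by (subst prod.reindex) (auto simp: inj_on_def)
  ultimately show ?thesis
    using assms(1) by (simp add: prod.union_disjoint finite_incr_pairs)
qed

lemma prod_minus_one_if:
  assumes "finite A"
  shows "(\<Prod>x\<in>A. if P x then -1 else 1 :: 'a::comm_ring_1) = (-1) ^ card {x \<in> A. P x}"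
  using assms by (simp add: prod.If_cases Int_def)

lemma inv_sign_card:
  assumes "finite S"
  shows "inv_sign S f = (-1) ^ card {(b, c). (b, c) \<in> incr_pairs S \<and> f c < f b}"
proof -
  have "inv_sign S f = (\<Prod>x\<in>incr_pairs S. if f (snd x) < f (fst x) then -1 else 1)"
    unfolding inv_sign_def by (rule prod.cong) auto
  also have "\<dots> = (-1) ^ card {x \<in> incr_pairs S. f (snd x) < f (fst x)}"
    by (rule prod_minus_one_if[OF finite_incr_pairs[OF assms]])
  also have "{x \<in> incr_pairs S. f (snd x) < f (fst x)} = {(b, c). (b, c) \<in> incr_pairs S \<and> f c < f b}"
    by auto
  finally show ?thesis .
qed

text \<open>Listing the images of a pair in increasing order gives a bijection \<open>g\<close> of
  \<open>incr_pairs S\<close>. The order of a pair is reversed by \<open>f \<circ> p\<close> when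
  exactly one of \<open>p\<close>, at the pair, and \<open>f\<close>, at its image under
  \<open>g\<close>, reverses it; injectivity of \<open>f\<close> excludes ties.\<close>

lemma inv_sign_compose:
  assumes fin: "finite S" and p: "p permutes S" and f: "inj_on f S"
  shows "inv_sign S (f \<circ> p) = inv_sign S f * inv_sign S p"
proof -
  define g where "g = (\<lambda>(b, c). (min (p b) (p c), max (p b) (p c)))"
  have pS: "p b \<in> S \<longleftrightarrow> b \<in> S" for b using permutes_in_image[OF p] .
  have inj: "p b = p c \<longleftrightarrow> b = c" for b c using permutes_inj[OF p] by (simp add: inj_eq)
  have "g ` incr_pairs S \<subseteq> incr_pairs S"
  proof (rule image_subsetI)
    fix x assume "x \<in> incr_pairs S"
    then obtain b c where "x = (b, c)" "b \<in> S" "c \<in> S" "p b \<noteq> p c"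
      by (auto simp: incr_pairs_def inj)
    then show "g x \<in> incr_pairs S"
      by (auto simp: g_def incr_pairs_def min_def max_def pS)
  qed
  moreover have injg: "inj_on g (incr_pairs S)"
  proof (rule inj_onI)
    fix x y assume xy: "x \<in> incr_pairs S" "y \<in> incr_pairs S" "g x = g y"
    obtain b c where x: "x = (b, c)" by fastforce
    obtain d e where y: "y = (d, e)" by fastforce
    have "min (p b) (p c) = min (p d) (p e)" "max (p b) (p c) = max (p d) (p e)"
      using xy(3) by (auto simp: g_def x y)
    then have "p b = p d \<and> p c = p e \<or> p b = p e \<and> p c = p d"
      by (auto simp: min_def max_def split: if_splits)
    then show "x = y" using xy(1,2) by (auto simp: x y incr_pairs_def inj)
  qed
  ultimately have img: "g ` incr_pairs S = incr_pairs S"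
    using endo_inj_surj finite_incr_pairs[OF fin] by blast
  let ?s = "\<lambda>h (b, c). if h c < (h b :: nat) then -1 else (1 :: int)"
  have "inv_sign S f = prod (?s f) (g ` incr_pairs S)"
    by (simp add: inv_sign_def img)
  also have "\<dots> = (\<Prod>x\<in>incr_pairs S. ?s f (g x))"
    by (subst prod.reindex[OF injg]) simp
  finally have "inv_sign S f * inv_sign S p = (\<Prod>x\<in>incr_pairs S. ?s f (g x) * ?s p x)"
    by (simp add: inv_sign_def prod.distrib)
  also have "\<dots> = inv_sign S (f \<circ> p)"
    unfolding inv_sign_def
  proof (rule prod.cong[OF refl])
    fix x assume "x \<in> incr_pairs S"
    then obtain b c where x: "x = (b, c)" "b \<in> S" "c \<in> S" "b < c" by (auto simp: incr_pairs_def)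
    then have "f (p b) \<noteq> f (p c)" using f pS inj by (auto dest: inj_onD)
    with x show "?s f (g x) * ?s p x = ?s (f \<circ> p) x"
      using inj[of b c] by (auto simp: g_def min_def max_def)
  qed
  finally show ?thesis by simp
qed

text \<open>The inverted pairs are \<open>(a, c)\<close> and, for each \<open>x\<close> of
  \<open>S\<close> strictly between, both \<open>(a, x)\<close> and \<open>(x, c)\<close>: an odd
  number.\<close>

lemma inv_sign_transpose:
  assumes fin: "finite S" and "a \<in> S" "c \<in> S" "a < c"
  shows "inv_sign S (transpose a c) = -1"
proof -
  define M where "M = {x \<in> S. a < x \<and> x < c}"
  have M: "finite M" using fin by (simp add: M_def)
  have "{(x, y). (x, y) \<in> incr_pairs S \<and> transpose a c y < transpose a c x}
      = insert (a, c) (Pair a ` M \<union> (\<lambda>x. (x, c)) ` M)"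
    using assms(2-) by (auto simp: incr_pairs_def M_def transpose_def split: if_splits)
  moreover have "card (insert (a, c) (Pair a ` M \<union> (\<lambda>x. (x, c)) ` M)) = Suc (2 * card M)"
  proof -
    have "card (Pair a ` M \<union> (\<lambda>x. (x, c)) ` M) = card (Pair a ` M) + card ((\<lambda>x. (x, c)) ` M)"
      using M by (intro card_Un_disjoint) (auto simp: M_def)
    also have "\<dots> = 2 * card M"
      by (simp add: card_image inj_on_def)
    finally show ?thesis
      using M by (subst card_insert_disjoint) (auto simp: M_def)
  qed
  ultimately show ?thesis by (simp add: inv_sign_card[OF fin])
qed

text \<open>Both sides are 1 at the identity and change sign under composition with a
  transposition.\<close>

lemma inv_sign_permutes:
  assumes "p permutes S" "finite S"
  shows "inv_sign S p = sign p"
  using assms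
proof (induction rule: permutes_induct)
  case id
  show ?case by (auto simp: inv_sign_def incr_pairs_def intro!: prod.neutral)
next
  case (swap a b p)
  have tr: "inv_sign S (transpose a b) = -1"
    using inv_sign_transpose[OF assms(2), of a b] inv_sign_transpose[OF assms(2), of b a] swap
    by (cases "a < b") (auto simp: transpose_commute)
  have "permutation p" using swap assms(2) by (auto simp: permutation_permutes)
  then have "sign (transpose a b \<circ> p) = - sign p"
    using swap by (simp add: sign_compose permutation_swap_id sign_swap_id)
  moreover have "inv_sign S (transpose a b \<circ> p) = - inv_sign S p"
    using tr by (subst inv_sign_compose[OF assms(2)]) (use swap in \<open>auto intro: inj_onI dest: injD[OF bij_is_inj[OF bij_transpose]]\<close>)
  ultimately show ?case using \<open>inv_sign S p = sign p\<close> by (simp only:)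
qed

text \<open>Here \<open>P\<close> selects the odd letters: only inversions between two of them count.\<close>

primrec sort_sign :: "(nat \<Rightarrow> bool) \<Rightarrow> nat list \<Rightarrow> int" where
  "sort_sign P [] = 1"
| "sort_sign P (c # cs) = prod_list (map (\<lambda>d. if P c \<and> P d \<and> d < c then -1 else 1) cs) * sort_sign P cs"

text \<open>Passes from letters to positions: \<open>sort_sign\<close> tests oddness on the values
  of \<open>f\<close>, \<open>inv_sign\<close> selects positions, and \<open>Q\<close> is oddness
  read off at the position.\<close>

lemma sort_sign_map:
  assumes "sorted_wrt (<) L" "\<And>b. b \<in> set L \<Longrightarrow> P (f b) \<longleftrightarrow> Q b"
  shows "sort_sign P (map f L) = inv_sign {b \<in> set L. Q b} f"
  using assms
proof (induction L)
  case (Cons b L)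
  let ?S = "{b \<in> set L. Q b}"
  have IH: "sort_sign P (map f L) = inv_sign ?S f" using Cons by simp
  have dist: "distinct L" using Cons.prems strict_sorted_iff by auto
  have "prod_list (map (\<lambda>d. if P (f b) \<and> P d \<and> d < f b then -1 else (1::int)) (map f L))
      = (\<Prod>c\<in>set L. if Q b \<and> Q c \<and> f c < f b then -1 else 1)"
    unfolding map_map prod.distinct_set_conv_list[OF dist]
    using Cons.prems(2) by (intro arg_cong[where f = prod_list] map_cong) auto
  also have "\<dots> = (if Q b then (\<Prod>c\<in>?S. if f c < f b then -1 else 1) else 1)"
    by (simp add: prod.inter_filter flip: if_if_eq_conj)
  finally have 1: "sort_sign P (map f (b # L)) =
     (if Q b then (\<Prod>c\<in>?S. if f c < f b then -1 else 1) else 1) * inv_sign ?S f"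
    using IH by simp
  show ?case
  proof (cases "Q b")
    case True
    then have "{c \<in> set (b # L). Q c} = insert b ?S" by auto
    moreover have "inv_sign (insert b ?S) f = (\<Prod>c\<in>?S. if f c < f b then -1 else 1) * inv_sign ?S f"
      unfolding inv_sign_def by (subst prod_incr_pairs_insert) (use Cons.prems in auto)
    ultimately show ?thesis
      unfolding 1 using True by simp
  next
    case False
    then have "{c \<in> set (b # L). Q c} = ?S" by auto
    then show ?thesis unfolding 1 using False by simp
  qed
qed (simp add: inv_sign_def incr_pairs_def)

section \<open>Reordering words in supercommuting letters\<close>

lemma mult_of_int_left_commute: "x * (of_int s * y) = of_int s * (x * y :: 'a::ring_1)"
  by (metis mult.assoc mult_of_int_commute)

text \<open>One letter for each label, with the relation between different labels; all words that
  get sorted or reversed below have distinct labels.\<close>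

locale supercommuting =
  fixes y :: "nat \<Rightarrow> 'r::ring_1" and P :: "nat \<Rightarrow> bool" and A :: "nat set"
  assumes commute: "\<lbrakk>a \<in> A; b \<in> A; a \<noteq> b\<rbrakk> \<Longrightarrow> y a * y b = (if P a \<and> P b then - (y b * y a) else y b * y a)"
begin

lemma prod_list_insort:
  assumes "c \<in> A" "set ds \<subseteq> A" "c \<notin> set ds" "sorted ds"
  shows "y c * prod_list (map y ds) =
    of_int (prod_list (map (\<lambda>d. if P c \<and> P d \<and> d < c then -1 else 1) ds)) * prod_list (map y (insort c ds))"
  using assms
proof (induction ds)
  case (Cons d ds)
  show ?case
  proof (cases "c < d")
    case True
    then have "map (\<lambda>d. if P c \<and> P d \<and> d < c then -1 else (1::int)) ds = map (\<lambda>_. 1) ds"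
      using Cons.prems by (intro map_cong) auto
    with True show ?thesis by (simp add: map_replicate_const)
  next
    case False
    then have "d < c" using Cons.prems by auto
    have "y c * prod_list (map y (d # ds)) = (y c * y d) * prod_list (map y ds)"
      by (simp add: mult.assoc)
    also have "\<dots> = of_int (if P c \<and> P d then -1 else 1) * (y d * (y c * prod_list (map y ds)))"
      using commute[of c d] Cons.prems by (simp add: mult.assoc)
    also have "y c * prod_list (map y ds) = of_int (prod_list (map (\<lambda>d. if P c \<and> P d \<and> d < c then -1 else 1) ds))
        * prod_list (map y (insort c ds))"
      using Cons by simp
    finally show ?thesis using \<open>d < c\<close>
      by (simp add: mult_of_int_left_commute[of "y d"] mult.assoc)
  qed
qed simp

lemma prod_list_sort:
  assumes "set cs \<subseteq> A" "distinct cs"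
  shows "prod_list (map y cs) = of_int (sort_sign P cs) * prod_list (map y (sort cs))"
  using assms
proof (induction cs)
  case (Cons c cs)
  let ?f = "\<lambda>d. if P c \<and> P d \<and> d < c then -1 else (1::int)"
  \<comment> \<open>The sign of inserting \<open>c\<close> depends only on which letters the tail
    contains, so it agrees for \<open>cs\<close>, where \<open>sort_sign\<close> reads it, and for
    \<open>sort cs\<close>, where the insertion happens.\<close>
  have "prod_list (map ?f (sort cs)) = prod_list (map ?f cs)"
    by (simp flip: prod_mset_prod_list)
  moreover have "y c * prod_list (map y (sort cs)) =
      of_int (prod_list (map ?f (sort cs))) * prod_list (map y (insort c (sort cs)))"
    using Cons.prems by (intro prod_list_insort) auto
  moreover have "y c * prod_list (map y cs) = of_int (sort_sign P cs) * (y c * prod_list (map y (sort cs)))"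
    using Cons by (simp add: mult_of_int_left_commute[of "y c"])
  ultimately have "y c * prod_list (map y cs) = of_int (sort_sign P cs) *
      (of_int (prod_list (map ?f cs)) * prod_list (map y (insort c (sort cs))))"
    by simp
  then show ?case
    by (simp add: mult.commute flip: of_int_mult mult.assoc)
qed simp

text \<open>Reversal exchanges every pair of letters once, and only pairs of odd letters cost a
  sign.\<close>

lemma prod_list_rev:
  assumes "set L \<subseteq> A" "sorted_wrt (<) L"
  shows "prod_list (map y (rev L)) = of_int ((-1) ^ card (incr_pairs {b \<in> set L. P b})) * prod_list (map y L)"
proof -
  have move: "prod_list (map y ds) * y c =
     of_int (prod_list (map (\<lambda>d. if P c \<and> P d then -1 else 1) ds)) * (y c * prod_list (map y ds))"
    if "c \<in> A" "set ds \<subseteq> A" "c \<notin> set ds" for c ds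
    using that
  proof (induction ds)
    case (Cons d ds)
    let ?s = "prod_list (map (\<lambda>d. if P c \<and> P d then -1 else (1::int)) ds)"
    have "prod_list (map y (d # ds)) * y c = y d * (of_int ?s * (y c * prod_list (map y ds)))"
      using Cons by (simp add: mult.assoc)
    also have "\<dots> = of_int ?s * ((y d * y c) * prod_list (map y ds))"
      by (simp only: mult.assoc mult_of_int_left_commute[of "y d"])
    also have "y d * y c = of_int (if P c \<and> P d then -1 else 1) * (y c * y d)"
      using commute[of d c] Cons.prems by auto
    finally show ?case
      by (simp add: mult.assoc)
  qed simp
  \<comment> \<open>The power of -1 is written as a product over pairs, so that the pairs containing
    a new smallest letter split off.\<close>
  have "prod_list (map y (rev L)) = of_int (\<Prod>x\<in>incr_pairs {b \<in> set L. P b}. -1) * prod_list (map y L)"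
    using assms
  proof (induction L)
    case (Cons b L)
    let ?S = "{b \<in> set L. P b}"
    have dist: "distinct L" using Cons.prems strict_sorted_iff by auto
    have "prod_list (map (\<lambda>d. if P b \<and> P d then -1 else (1::int)) L) = (\<Prod>d\<in>set L. if P b \<and> P d then -1 else 1)"
      by (simp add: prod.distinct_set_conv_list[OF dist])
    also have "\<dots> = (if P b then (\<Prod>c\<in>?S. -1) else 1)"
      by (simp add: prod_minus_one_if)
    finally have 0: "prod_list (map (\<lambda>d. if P b \<and> P d then -1 else (1::int)) L) =
      (if P b then (\<Prod>c\<in>?S. -1) else 1)" .
    have 1: "prod_list (map (\<lambda>d. if P b \<and> P d then -1 else (1::int)) L)
      * (\<Prod>x\<in>incr_pairs ?S. -1) = (\<Prod>x\<in>incr_pairs {c \<in> set (b # L). P c}. -1)"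
    proof (cases "P b")
      case True
      then have "{c \<in> set (b # L). P c} = insert b ?S" by auto
        moreover have "(\<Prod>x\<in>incr_pairs (insert b ?S). -1 :: int) =
          (\<Prod>c\<in>?S. -1) * (\<Prod>x\<in>incr_pairs ?S. -1)"
        by (subst prod_incr_pairs_insert) (use Cons.prems in auto)
      ultimately show ?thesis
        unfolding 0 using True by (simp only: if_True)
    next
      case False
      then have "{c \<in> set (b # L). P c} = ?S" by auto
      then show ?thesis unfolding 0 using False by simp
    qed
    have "prod_list (map y (rev (b # L))) = of_int (\<Prod>x\<in>incr_pairs ?S. -1) * (prod_list (map y L) * y b)"
      using Cons by (simp add: mult.assoc)
    also have "prod_list (map y L) * y b =
       of_int (prod_list (map (\<lambda>d. if P b \<and> P d then -1 else 1) L)) * (y b * prod_list (map y L))"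
      using Cons.prems by (intro move) auto
    finally show ?case
      unfolding 1[symmetric] mult.commute[of _ "\<Prod>x\<in>_. _"]
      by (simp only: of_int_mult mult.assoc list.map prod_list.Cons)
  qed (simp add: incr_pairs_def)
  then show ?thesis by simp
qed

end

text \<open>Such a permutation is the same as an arbitrary permutation of one fibre \<open>B\<close>
  together with a fibre-preserving one of the rest \<open>C\<close>; composition and restriction are
  mutually inverse. Values that are not attained contribute \<open>fact 0 = 1\<close>.\<close>

lemma card_fibre_preserving_permutations:
  assumes "finite V" "finite A" "j ` A \<subseteq> V"
  shows "card {p. p permutes A \<and> (\<forall>a\<in>A. j (p a) = j a)} = (\<Prod>v\<in>V. fact (card {a \<in> A. j a = v}))"
  using assms
proof (induction V arbitrary: A rule: finite_induct)
  case empty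
  then show ?case by (simp cong: conj_cong)
next
  case (insert v V)
  define B where "B = {a \<in> A. j a = v}"
  define C where "C = {a \<in> A. j a \<noteq> v}"
  let ?Q = "{q. q permutes C \<and> (\<forall>a\<in>C. j (q a) = j a)}"
  have fin: "finite B" "finite C" using insert by (auto simp: B_def C_def)
  have A: "A = B \<union> C" "B \<inter> C = {}" by (auto simp: B_def C_def)
  have "bij_betw (\<lambda>(p, q). p \<circ> q) ({p. p permutes B} \<times> ?Q)
      {p. p permutes A \<and> (\<forall>a\<in>A. j (p a) = j a)}"
  proof (rule bij_betw_byWitness[where f' = "\<lambda>p. (restrict_id p B, restrict_id p C)"])
    show "\<forall>x\<in>{p. p permutes B} \<times> ?Q. (\<lambda>p. (restrict_id p B, restrict_id p C)) ((\<lambda>(p, q). p \<circ> q) x) = x"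
    proof (rule ballI)
      fix x assume "x \<in> {p. p permutes B} \<times> ?Q"
      then obtain p q where x: "x = (p, q)" and p: "p permutes B" and q: "q permutes C" by auto
      have "q a \<in> C" if "a \<in> C" for a using permutes_in_image[OF q] that by simp
      then have *: "p (q a) = q a" if "a \<in> C" for a using permutes_not_in[OF p] A that by blast
      have "q a = a" if "a \<in> B" for a using permutes_not_in[OF q] A that by blast
      with * show "(\<lambda>p. (restrict_id p B, restrict_id p C)) ((\<lambda>(p, q). p \<circ> q) x) = x"
        unfolding x using permutes_not_in[OF p] permutes_not_in[OF q] by (auto simp: restrict_id_def fun_eq_iff)
    qed
    have img: "p ` B = B" "p ` C = C" if p: "p permutes A" "\<forall>a\<in>A. j (p a) = j a" for p
    proof -
      have pA: "p a \<in> A" if "a \<in> A" for a using permutes_in_image[OF p(1)] that by simp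
      have "p ` B \<subseteq> B" "p ` C \<subseteq> C" using p(2) pA by (auto simp: B_def C_def)
      moreover have "inj_on p B" "inj_on p C" using permutes_inj_on[OF p(1)] by auto
      ultimately show "p ` B = B" "p ` C = C" using endo_inj_surj fin by blast+
    qed
    show "\<forall>p\<in>{p. p permutes A \<and> (\<forall>a\<in>A. j (p a) = j a)}.
        (\<lambda>(p, q). p \<circ> q) (restrict_id p B, restrict_id p C) = p"
    proof (rule ballI)
      fix p assume "p \<in> {p. p permutes A \<and> (\<forall>a\<in>A. j (p a) = j a)}"
      then have p: "p permutes A" "\<forall>a\<in>A. j (p a) = j a" by auto
      have "(restrict_id p B \<circ> restrict_id p C) a = p a" for a
        using img[OF p] A permutes_not_in[OF p(1), of a]
        by (cases "a \<in> B"; cases "a \<in> C") (auto simp: restrict_id_def)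
      then show "(\<lambda>(p, q). p \<circ> q) (restrict_id p B, restrict_id p C) = p" by auto
    qed
    show "(\<lambda>(p, q). p \<circ> q) ` ({p. p permutes B} \<times> ?Q) \<subseteq> {p. p permutes A \<and> (\<forall>a\<in>A. j (p a) = j a)}"
    proof (rule image_subsetI)
      fix x assume "x \<in> {p. p permutes B} \<times> ?Q"
      then obtain p q where x: "x = (p, q)" and p: "p permutes B"
        and q: "q permutes C" "\<forall>a\<in>C. j (q a) = j a" by auto
      have pq: "p \<circ> q permutes A"
        using p q(1) A by (intro permutes_compose) (auto intro: permutes_subset)
      have "j ((p \<circ> q) a) = j a" if a: "a \<in> A" for a
      proof (cases "a \<in> C")
        case True
        then have "q a \<in> C" using permutes_in_image[OF q(1)] by simp
        then have "p (q a) = q a" using permutes_not_in[OF p] A by blast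
        then show ?thesis using q(2) True by simp
      next
        case False
        then have "a \<in> B" "q a = a" using A a permutes_not_in[OF q(1)] by auto
        moreover have "p a \<in> B" using permutes_in_image[OF p] \<open>a \<in> B\<close> by simp
        ultimately show ?thesis by (simp add: B_def)
      qed
      with pq show "(\<lambda>(p, q). p \<circ> q) x \<in> {p. p permutes A \<and> (\<forall>a\<in>A. j (p a) = j a)}"
        by (simp add: x)
    qed
    show "(\<lambda>p. (restrict_id p B, restrict_id p C)) ` {p. p permutes A \<and> (\<forall>a\<in>A. j (p a) = j a)}
        \<subseteq> {p. p permutes B} \<times> ?Q"
    proof (rule image_subsetI)
      fix p assume "p \<in> {p. p permutes A \<and> (\<forall>a\<in>A. j (p a) = j a)}"
      then have p: "p permutes A" "\<forall>a\<in>A. j (p a) = j a" by auto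
      have "bij_betw p B B" "bij_betw p C C"
        using img[OF p] permutes_inj_on[OF p(1)] by (auto simp: bij_betw_def)
      then have "restrict_id p B permutes B" "restrict_id p C permutes C"
        by (auto intro: permutes_restrict_id)
      moreover have "j (restrict_id p C a) = j a" if "a \<in> C" for a
        using p(2) A that by (auto simp: restrict_id_def)
      ultimately show "(restrict_id p B, restrict_id p C) \<in> {p. p permutes B} \<times> ?Q" by simp
    qed
  qed
  then have "card {p. p permutes A \<and> (\<forall>a\<in>A. j (p a) = j a)} = card {p. p permutes B} * card ?Q"
    by (simp add: bij_betw_same_card[symmetric] card_cartesian_product)
  also have "card ?Q = (\<Prod>v\<in>V. fact (card {a \<in> C. j a = v}))"
    using insert.prems fin by (intro insert.IH) (auto simp: C_def)
  also have "\<dots> = (\<Prod>v\<in>V. fact (card {a \<in> A. j a = v}))"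
    using insert.hyps by (intro prod.cong refl arg_cong[where f = fact] arg_cong[where f = card]) (auto simp: C_def)
  also have "card {p. p permutes B} = fact (card B)"
    by (rule card_permutations[OF refl fin(1)])
  finally show ?case using insert.hyps by (simp add: B_def)
qed

section \<open>The coefficients as sums over permutations\<close>

lemma bij_betw_elt: "finite \<aa> \<Longrightarrow> bij_betw (elt \<aa>) {1..card \<aa>} \<aa>"
proof -
  assume fin: "finite \<aa>"
  have "bij_betw (\<lambda>s. s - 1) {1..card \<aa>} {..<card \<aa>}"
    by (rule bij_betw_byWitness[where f' = Suc]) auto
  moreover have "bij_betw ((!) (sorted_list_of_set \<aa>)) {..<card \<aa>} \<aa>"
    using fin by (intro bij_betw_nth) auto
  moreover have "elt \<aa> = (!) (sorted_list_of_set \<aa>) \<circ> (\<lambda>s. s - 1)"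
    by (simp add: fun_eq_iff elt_def)
  ultimately show ?thesis by (metis bij_betw_trans)
qed

lemma elt_strict_mono:
  assumes "finite \<aa>" "s \<in> {1..card \<aa>}" "t \<in> {1..card \<aa>}"
  shows "elt \<aa> s < elt \<aa> t \<longleftrightarrow> s < t"
proof -
  have "elt \<aa> s < elt \<aa> t" if "s < t" "s \<in> {1..card \<aa>}" "t \<in> {1..card \<aa>}" for s t
    unfolding elt_def using that assms(1)
    by (intro sorted_wrt_nth_less[OF strict_sorted_list_of_set]) auto
  then show ?thesis using assms(2,3) by (metis linorder_neqE_nat order_less_asym)
qed

text \<open>Applied to \<open>A\<close> in increasing order, both maps list the same set in
  increasing order.\<close>

lemma strict_mono_on_unique:
  fixes f g :: "nat \<Rightarrow> nat"
  assumes "finite A" "strict_mono_on A f" "strict_mono_on A g" "f ` A = g ` A" "x \<in> A"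
  shows "f x = g x"
proof -
  let ?L = "sorted_list_of_set A"
  have sorted: "sorted_wrt (<) (map h ?L)" if "strict_mono_on A h" for h :: "nat \<Rightarrow> nat"
    unfolding sorted_wrt_map
    by (rule sorted_wrt_mono_rel[OF _ strict_sorted_list_of_set])
      (use assms(1) that in \<open>auto dest: strict_mono_onD\<close>)
  have "map f ?L = map g ?L"
    using assms(1,4) by (intro strict_sorted_equal[OF sorted[OF assms(3)] sorted[OF assms(2)]]) simp
  then show ?thesis using assms(1,5) by simp
qed

lemma ex_strict_mono_bij:
  fixes A B :: "nat set"
  assumes "finite A" "finite B" "card A = card B"
  shows "\<exists>f. bij_betw f A B \<and> strict_mono_on A f"
proof -
  obtain h where h: "bij_betw h {..<card A} A" "strict_mono_on {..<card A} h"
    using ex_bij_betw_strict_mono_card[OF assms(1)] .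
  obtain g where g: "bij_betw g {..<card A} B" "strict_mono_on {..<card A} g"
    using ex_bij_betw_strict_mono_card[OF assms(2)] assms(3) by auto
  define h' where "h' = inv_into {..<card A} h"
  have h': "bij_betw h' A {..<card A}" unfolding h'_def by (rule bij_betw_inv_into[OF h(1)])
  have hh': "h (h' x) = x" if "x \<in> A" for x
    unfolding h'_def using that h(1) by (intro f_inv_into_f) (simp add: bij_betw_def)
  have "strict_mono_on A h'"
  proof (rule strict_mono_onI)
    fix x y assume xy: "x \<in> A" "y \<in> A" "x < y"
    then have "h' x \<in> {..<card A}" "h' y \<in> {..<card A}" using h' by (auto dest: bij_betwE)
    then show "h' x < h' y"
      using strict_mono_on_less[OF h(2)] xy hh' by metis
  qed
  then have "strict_mono_on A (g \<circ> h')"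
    using g(2) h' by (auto simp: strict_mono_on_def dest: bij_betwE)
  then show ?thesis using bij_betw_trans[OF h' g(1)] by blast
qed

lemma finite_fibre [simp]: "finite (fibre k j i)"
  by (simp add: fibre_def)

text \<open>Removes the definite description. The increasing bijections from the fibres of
  \<open>j2\<close> to those of \<open>j1\<close> glue to a permutation \<open>\<sigma>\<close> of
  \<open>\<aa>\<close>, and conjugation with \<open>elt \<aa>\<close> turns it into one of
  positions. It is the only one with the required property because an increasing map on a finite set
  is determined by its image.\<close>

lemma J_perm:
  assumes \<aa>: "\<aa> \<subseteq> {1..k}" and j1: "j1 \<in> J_set m n k \<aa>" and j2: "j2 \<in> J_set m n k \<aa>"
    and equiv: "J_equiv k j1 j2"
  obtains \<sigma> where "\<sigma> permutes \<aa>" "j1 \<circ> \<sigma> = j2"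
    "J_perm m n k \<aa> j1 j2 permutes {1..card \<aa>}"
    "\<And>s. s \<in> {1..card \<aa>} \<Longrightarrow> elt \<aa> (J_perm m n k \<aa> j1 j2 s) = \<sigma> (elt \<aa> s)"
proof -
  have fin: "finite \<aa>" using \<aa> finite_subset by blast
  have supp1: "j1 a = 0 \<longleftrightarrow> a \<notin> \<aa>" and supp2: "j2 a = 0 \<longleftrightarrow> a \<notin> \<aa>" if "a \<in> {1..k}" for a
    using j1 j2 that by (auto simp: J_set_def)
  \<comment> \<open>Both are \<open>undefined\<close> there, which
    \<open>j1 \<circ> \<sigma> = j2\<close>, an equality of functions on all of \<open>nat\<close>,
    requires.\<close>
  have ext: "j1 a = j2 a" if "a \<notin> {1..k}" for a
    using j1 j2 that by (auto simp: J_set_def PiE_def extensional_def)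
  have range2: "j2 a \<in> {1..m + n}" if "a \<in> \<aa>" for a
  proof -
    have "a \<in> {1..k}" using that \<aa> by blast
    then have "j2 a \<in> {0..m + n}" "j2 a \<noteq> 0" using j2 supp2 that by (auto simp: J_set_def)
    then show ?thesis by auto
  qed
  have "\<exists>f. bij_betw f (fibre k j2 i) (fibre k j1 i) \<and> strict_mono_on (fibre k j2 i) f" for i
    using equiv by (intro ex_strict_mono_bij) (auto simp: J_equiv_def)
  then obtain f where f: "\<And>i. bij_betw (f i) (fibre k j2 i) (fibre k j1 i)"
    "\<And>i. strict_mono_on (fibre k j2 i) (f i)"
    by metis
  define \<sigma> where "\<sigma> b = (if b \<in> \<aa> then f (j2 b) b else b)" for b
  have in_fibre: "\<sigma> b \<in> fibre k j1 (j2 b)" if b: "b \<in> \<aa>" for b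
  proof -
    have "b \<in> fibre k j2 (j2 b)" using b \<aa> by (auto simp: fibre_def)
    then show ?thesis using f(1)[of "j2 b"] b by (auto simp: \<sigma>_def dest: bij_betwE)
  qed
  have \<sigma>_in: "\<sigma> b \<in> \<aa>" if b: "b \<in> \<aa>" for b
    using in_fibre[OF b] supp1[of "\<sigma> b"] range2[OF b] by (auto simp: fibre_def)
  have j\<sigma>: "j1 (\<sigma> b) = j2 b" if b: "b \<in> \<aa>" for b
    using in_fibre[OF b] by (simp add: fibre_def)
  have inj: "inj_on \<sigma> \<aa>"
  proof (rule inj_onI)
    fix b c assume bc: "b \<in> \<aa>" "c \<in> \<aa>" "\<sigma> b = \<sigma> c"
    then have eq: "j2 b = j2 c" using j\<sigma> by metis
    have "b \<in> fibre k j2 (j2 b)" "c \<in> fibre k j2 (j2 b)"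
      using bc eq \<aa> by (auto simp: fibre_def)
    then show "b = c"
      using bc eq f(1)[of "j2 b"] by (auto simp: \<sigma>_def bij_betw_def dest: inj_onD)
  qed
  have "\<sigma> ` \<aa> = \<aa>" using \<sigma>_in inj fin by (intro endo_inj_surj) auto
  then have perm: "\<sigma> permutes \<aa>"
    using inj by (intro bij_imp_permutes) (auto simp: bij_betw_def \<sigma>_def)
  have comp: "j1 \<circ> \<sigma> = j2"
  proof
    fix a show "(j1 \<circ> \<sigma>) a = j2 a"
      using j\<sigma>[of a] supp1[of a] supp2[of a] ext[of a]
      by (cases "a \<in> \<aa>"; cases "a \<in> {1..k}") (simp_all add: \<sigma>_def)
  qed
  let ?I = "{1..card \<aa>}" and ?e = "elt \<aa>"
  have e: "bij_betw ?e ?I \<aa>" by (rule bij_betw_elt[OF fin])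
  define \<pi> where "\<pi> s = (if s \<in> ?I then inv_into ?I ?e (\<sigma> (?e s)) else s)" for s
  have e_in: "?e s \<in> \<aa>" if "s \<in> ?I" for s using e that by (auto dest: bij_betwE)
  have "bij_betw (inv_into ?I ?e \<circ> (\<sigma> \<circ> ?e)) ?I ?I"
    by (rule bij_betw_trans[OF bij_betw_trans[OF e permutes_imp_bij[OF perm]] bij_betw_inv_into[OF e]])
  then have "bij_betw \<pi> ?I ?I"
    by (rule bij_betw_cong[THEN iffD1, rotated]) (simp add: \<pi>_def)
  then have \<pi>: "\<pi> permutes ?I"
    by (rule bij_imp_permutes) (simp only: \<pi>_def if_False)
  have e\<pi>: "?e (\<pi> s) = \<sigma> (?e s)" if s: "s \<in> ?I" for s
  proof -
    have "\<sigma> (?e s) \<in> ?e ` ?I" using \<sigma>_in[OF e_in[OF s]] e by (simp add: bij_betw_def)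
    then show ?thesis using s by (simp add: \<pi>_def f_inv_into_f)
  qed
  define S where "S i = {s \<in> ?I. ?e s \<in> fibre k j2 i}" for i
  have fibre_sub: "fibre k j2 i \<subseteq> \<aa>" if "i \<in> {1..m + n}" for i
  proof
    fix b assume "b \<in> fibre k j2 i"
    then have "b \<in> {1..k}" "j2 b \<noteq> 0" using that by (auto simp: fibre_def)
    then show "b \<in> \<aa>" using supp2[of b] by simp
  qed
  have eS: "?e ` S i = fibre k j2 i" if "i \<in> {1..m + n}" for i
  proof -
    have "fibre k j2 i \<subseteq> ?e ` ?I" using fibre_sub[OF that] e by (simp add: bij_betw_def)
    then show ?thesis unfolding S_def by blast
  qed
  have \<sigma>f: "\<sigma> b = f i b" if "i \<in> {1..m + n}" "b \<in> fibre k j2 i" for i b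
    using fibre_sub[OF that(1)] that(2) by (auto simp: \<sigma>_def fibre_def)
  have P: "(\<lambda>s. ?e (\<pi> s)) ` S i = fibre k j1 i" "strict_mono_on (S i) (\<lambda>s. ?e (\<pi> s))"
    if i: "i \<in> {1..m + n}" for i
  proof -
    have "(\<lambda>s. ?e (\<pi> s)) ` S i = f i ` ?e ` S i"
      unfolding image_image
    proof (rule image_cong[OF refl])
      fix s assume "s \<in> S i"
      then show "?e (\<pi> s) = f i (?e s)" using \<sigma>f[OF i] e\<pi> by (auto simp: S_def)
    qed
    then show "(\<lambda>s. ?e (\<pi> s)) ` S i = fibre k j1 i"
      using eS[OF i] f(1)[of i] by (simp add: bij_betw_def)
    show "strict_mono_on (S i) (\<lambda>s. ?e (\<pi> s))"
    proof (rule strict_mono_onI)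
      fix s t assume st: "s \<in> S i" "t \<in> S i" "s < t"
      then have "?e s < ?e t" using elt_strict_mono[OF fin] by (auto simp: S_def)
      then show "?e (\<pi> s) < ?e (\<pi> t)"
        using st f(2)[of i] \<sigma>f[OF i] e\<pi> by (auto simp: S_def dest: strict_mono_onD)
    qed
  qed
  have J: "J_perm m n k \<aa> j1 j2 = \<pi>"
    unfolding J_perm_def Let_def S_def[symmetric]
  proof (rule the_equality)
    show "\<pi> permutes ?I \<and> (\<forall>i\<in>{1..m + n}. (\<lambda>s. ?e (\<pi> s)) ` S i = fibre k j1 i
        \<and> strict_mono_on (S i) (\<lambda>s. ?e (\<pi> s)))"
      using \<pi> P by blast
    fix \<rho> assume \<rho>: "\<rho> permutes ?I \<and> (\<forall>i\<in>{1..m + n}. (\<lambda>s. ?e (\<rho> s)) ` S i = fibre k j1 i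
        \<and> strict_mono_on (S i) (\<lambda>s. ?e (\<rho> s)))"
    show "\<rho> = \<pi>"
    proof
      fix s show "\<rho> s = \<pi> s"
      proof (cases "s \<in> ?I")
        case True
        let ?i = "j2 (?e s)"
        have i: "?i \<in> {1..m + n}" using range2[OF e_in[OF True]] .
        have "s \<in> S ?i" using True e_in[OF True] \<aa> by (auto simp: S_def fibre_def)
        moreover have "finite (S ?i)" by (simp add: S_def)
        moreover have "strict_mono_on (S ?i) (\<lambda>s. ?e (\<rho> s))" "(\<lambda>s. ?e (\<rho> s)) ` S ?i = fibre k j1 ?i"
          using \<rho> i by auto
        ultimately have "?e (\<rho> s) = ?e (\<pi> s)"
          using P[OF i] by (intro strict_mono_on_unique[where A = "S ?i" and f = "\<lambda>s. ?e (\<rho> s)"]) auto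
        moreover have "\<rho> s \<in> ?I" "\<pi> s \<in> ?I"
          using True \<rho> \<pi> permutes_in_image by metis+
        ultimately show ?thesis using e by (auto simp: bij_betw_def dest: inj_onD)
      next
        case False
        then show ?thesis using \<rho> \<pi> permutes_not_in by metis
      qed
    qed
  qed
  show thesis
    using that[OF perm comp] \<pi> e\<pi> unfolding J by blast
qed

text \<open>The two permutations differ by a \<open>\<tau>\<close> that preserves the fibres of
  \<open>j2\<close>. By \<open>small\<close> the even fibres have at most one element, so
  \<open>\<tau>\<close> moves only odd positions; there \<open>sign\<close> and
  \<open>inv_sign S\<close> both change by \<open>sign \<tau>\<close>, and the changes
  cancel.\<close>

lemma sign_inv_sign_cong:
  fixes j1 j2 :: "nat \<Rightarrow> nat"
  assumes fin: "finite \<aa>" and \<sigma>: "\<sigma> permutes \<aa>" "j1 \<circ> \<sigma> = j2" and \<rho>: "\<rho> permutes \<aa>" "j1 \<circ> \<rho> = j2"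
    and small: "\<And>b c. \<lbrakk>b \<in> \<aa>; c \<in> \<aa>; j2 b = j2 c; j2 b \<le> m\<rbrakk> \<Longrightarrow> b = c"
  defines "S \<equiv> {b \<in> \<aa>. m < j2 b}"
  shows "sign \<sigma> * inv_sign S \<sigma> = sign \<rho> * inv_sign S \<rho>"
proof -
  define \<tau> where "\<tau> = inv \<sigma> \<circ> \<rho>"
  have \<tau>: "\<tau> permutes \<aa>" unfolding \<tau>_def by (intro permutes_compose \<rho> permutes_inv \<sigma>)
  have \<rho>_eq: "\<rho> = \<sigma> \<circ> \<tau>"
    unfolding \<tau>_def by (simp add: fun_eq_iff permutes_inverses(1)[OF \<sigma>(1)])
  have j: "j2 (\<tau> b) = j2 b" for b
    using \<sigma>(2) \<rho>(2) unfolding \<rho>_eq by (metis comp_apply)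
  have "\<tau> b = b" if "b \<in> \<aa> - S" for b
    using small[of "\<tau> b" b] that permutes_in_image[OF \<tau>, of b] j[of b] by (auto simp: S_def)
  then have \<tau>S: "\<tau> permutes S" using permutes_superset[OF \<tau>] by blast
  have finS: "finite S" using fin by (simp add: S_def)
  have "sign \<rho> = sign \<sigma> * sign \<tau>"
    unfolding \<rho>_eq using \<sigma> \<tau> fin by (intro sign_compose) (auto simp: permutation_permutes)
  moreover have "inv_sign S \<rho> = inv_sign S \<sigma> * sign \<tau>"
    unfolding \<rho>_eq using inv_sign_compose[OF finS \<tau>S, of \<sigma>] permutes_inj_on[OF \<sigma>(1)]
      inv_sign_permutes[OF \<tau>S finS] by simp
  ultimately show ?thesis by (simp add: mult.left_commute mult.commute)
qed

lemma J_set_small: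
  assumes "\<aa> \<subseteq> {1..k}" "j \<in> J_set m n k \<aa>" "b \<in> \<aa>" "c \<in> \<aa>" "j b = j c" "j b \<le> m"
  shows "b = c"
proof -
  have "b \<in> {1..k}" "c \<in> {1..k}" using assms by auto
  then have "j b \<noteq> 0" "{b, c} \<subseteq> fibre k j (j b)" using assms by (auto simp: J_set_def fibre_def)
  moreover from this have "card (fibre k j (j b)) \<le> 1" using assms(2,6) by (auto simp: J_set_def)
  ultimately show ?thesis
    by (metis card_le_Suc0_iff_eq finite_fibre insert_subset One_nat_def)
qed

text \<open>\<open>J_sgn\<close> counts the pairs whose order is kept, while sorting the
  \<open>X\<close> counts those reversed. Together they are all pairs, whose number is the cost of
  reversing the \<open>D\<close>.\<close>

lemma inv_sign_noninversions:
  assumes fin: "finite S" and inj: "inj_on f S"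
  shows "(-1) ^ card {(b, c). (b, c) \<in> incr_pairs S \<and> f b < f c} = inv_sign S f * (-1) ^ card (incr_pairs S)"
proof -
  let ?A = "{(b, c). (b, c) \<in> incr_pairs S \<and> f b < f c}"
  let ?B = "{(b, c). (b, c) \<in> incr_pairs S \<and> f c < f b}"
  have sub: "?A \<subseteq> incr_pairs S" "?B \<subseteq> incr_pairs S" by auto
  have "f b \<noteq> f c" if "(b, c) \<in> incr_pairs S" for b c
    using that inj by (auto simp: incr_pairs_def dest: inj_onD)
  then have un: "incr_pairs S = ?A \<union> ?B" using sub by (auto simp: neq_iff)
  have "card (?A \<union> ?B) = card ?A + card ?B"
    using sub finite_incr_pairs[OF fin] by (intro card_Un_disjoint) (auto intro: finite_subset)
  then have "card (incr_pairs S) = card ?A + card ?B" using un by (simp only:)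
  moreover have "(-1 :: int) ^ t * (-1) ^ t = 1" for t :: nat by (simp flip: power_add mult_2)
  ultimately show ?thesis
    unfolding inv_sign_card[OF fin] by (simp add: power_add mult.left_commute)
qed

text \<open>Any relabelling \<open>\<rho>\<close> computes the coefficient, not only the one that
  increases on fibres. Hence all permutations leading to the same \<open>j1\<close> contribute the
  same term.\<close>

lemma J_coeff_eq:
  assumes \<aa>: "\<aa> \<subseteq> {1..k}" and j1: "j1 \<in> J_set m n k \<aa>" and j2: "j2 \<in> J_set m n k \<aa>"
    and equiv: "J_equiv k j1 j2" and \<rho>: "\<rho> permutes \<aa>" "j1 \<circ> \<rho> = j2"
  defines "S \<equiv> {b \<in> \<aa>. m < j2 b}"
  shows "J_coeff m n k \<aa> j1 j2 = (-1) ^ card \<aa> * (-1) ^ card (incr_pairs S) * (sign \<rho> * inv_sign S \<rho>)"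
proof -
  have fin: "finite \<aa>" using \<aa> finite_subset by blast
  obtain \<sigma> where \<sigma>: "\<sigma> permutes \<aa>" "j1 \<circ> \<sigma> = j2"
    and \<pi>: "J_perm m n k \<aa> j1 j2 permutes {1..card \<aa>}"
    and e\<pi>: "\<And>s. s \<in> {1..card \<aa>} \<Longrightarrow> elt \<aa> (J_perm m n k \<aa> j1 j2 s) = \<sigma> (elt \<aa> s)"
    using J_perm[OF \<aa> j1 j2 equiv] by blast
  let ?\<pi> = "J_perm m n k \<aa> j1 j2" and ?I = "{1..card \<aa>}" and ?e = "elt \<aa>"
  have e: "inj_on ?e ?I" "?e ` ?I = \<aa>" using bij_betw_elt[OF fin] by (auto simp: bij_betw_def)
  \<comment> \<open>\<open>J_coeff\<close> takes the sign of a permutation of positions; transport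
    along \<open>elt \<aa>\<close> preserves it.\<close>
  have "map_permutation ?I ?e ?\<pi> = \<sigma>"
  proof
    fix x show "map_permutation ?I ?e ?\<pi> x = \<sigma> x"
    proof (cases "x \<in> \<aa>")
      case True
      then obtain s where "s \<in> ?I" "x = ?e s" using e(2) by blast
      then show ?thesis
        using True e(2) inv_into_f_f[OF e(1)] e\<pi> by (simp add: map_permutation_def restrict_id_def)
    next
      case False
      then show ?thesis
        using e(2) permutes_not_in[OF \<sigma>(1)] by (simp add: map_permutation_def restrict_id_def)
    qed
  qed
  then have sign: "sign ?\<pi> = sign \<sigma>"
    using sign_map_permutation[OF e(1) \<pi>] by simp
  let ?P = "{(s, s'). 1 \<le> s \<and> s < s' \<and> s' \<le> card \<aa> \<and> ?\<pi> s < ?\<pi> s' \<and> j2 (?e s) > m \<and> j2 (?e s') > m}"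
  let ?Q = "{(b, c). (b, c) \<in> incr_pairs S \<and> \<sigma> b < \<sigma> c}"
  \<comment> \<open>\<open>elt \<aa>\<close> is increasing, so it carries the pairs of odd positions
    with preserved order to such pairs of elements.\<close>
  have "bij_betw (map_prod ?e ?e) ?P ?Q"
  proof (rule bij_betw_imageI)
    show "inj_on (map_prod ?e ?e) ?P"
      by (rule inj_on_subset[OF map_prod_inj_on[OF e(1) e(1)]]) auto
    have less: "?e s < ?e t \<longleftrightarrow> s < t" if "s \<in> ?I" "t \<in> ?I" for s t
      using elt_strict_mono[OF fin that] .
    have \<pi>_in: "?\<pi> s \<in> ?I" if "s \<in> ?I" for s using permutes_in_image[OF \<pi>] that by simp
    have \<sigma>_less: "\<sigma> (?e s) < \<sigma> (?e t) \<longleftrightarrow> ?\<pi> s < ?\<pi> t" if "s \<in> ?I" "t \<in> ?I" for s t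
      using less[OF \<pi>_in[OF that(1)] \<pi>_in[OF that(2)]] e\<pi> that by simp
    show "map_prod ?e ?e ` ?P = ?Q"
    proof (rule set_eqI)
      fix x :: "nat \<times> nat"
      obtain b c where x: "x = (b, c)" by fastforce
      have "x \<in> ?Q \<longleftrightarrow> b \<in> ?e ` ?I \<and> c \<in> ?e ` ?I \<and> b < c \<and> \<sigma> b < \<sigma> c \<and> m < j2 b \<and> m < j2 c"
        unfolding x e(2) by (auto simp: incr_pairs_def S_def)
      also have "\<dots> \<longleftrightarrow> (\<exists>s\<in>?I. \<exists>t\<in>?I. b = ?e s \<and> c = ?e t \<and> s < t \<and> ?\<pi> s < ?\<pi> t \<and> m < j2 b \<and> m < j2 c)"
        using less \<sigma>_less by blast
      also have "\<dots> \<longleftrightarrow> x \<in> map_prod ?e ?e ` ?P"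
        unfolding x by force
      finally show "x \<in> map_prod ?e ?e ` ?P \<longleftrightarrow> x \<in> ?Q" ..
    qed
  qed
  then have "J_sgn m n k \<aa> j1 j2 = (-1) ^ card ?Q"
    by (simp add: J_sgn_def Let_def bij_betw_same_card)
  also have "\<dots> = inv_sign S \<sigma> * (-1) ^ card (incr_pairs S)"
    using fin permutes_inj_on[OF \<sigma>(1)] by (intro inv_sign_noninversions) (auto simp: S_def)
  finally have "J_coeff m n k \<aa> j1 j2 = (-1) ^ card \<aa> * (-1) ^ card (incr_pairs S) * (sign \<sigma> * inv_sign S \<sigma>)"
    by (simp add: J_coeff_def sign)
  also have "sign \<sigma> * inv_sign S \<sigma> = sign \<rho> * inv_sign S \<rho>"
    unfolding S_def using J_set_small[OF \<aa> j2] by (intro sign_inv_sign_cong[OF fin \<sigma> \<rho>]) auto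
  finally show ?thesis .
qed

text \<open>The relabellings are the \<open>\<sigma> \<circ> \<tau>\<close> with
  \<open>\<tau>\<close> preserving the fibres of \<open>j2\<close>. Even labels contribute
  \<open>fact 0\<close> or \<open>fact 1\<close>, so only the odd factorials remain.\<close>

lemma card_relabelling_permutations:
  assumes \<aa>: "\<aa> \<subseteq> {1..k}" and j2: "j2 \<in> J_set m n k \<aa>" and \<sigma>: "\<sigma> permutes \<aa>" "j1 \<circ> \<sigma> = j2"
  shows "card {\<rho>. \<rho> permutes \<aa> \<and> j1 \<circ> \<rho> = j2} = (\<Prod>i=m+1..m+n. fact (card (fibre k j2 i)))"
proof -
  have fin: "finite \<aa>" using \<aa> finite_subset by blast
  let ?F = "{\<tau>. \<tau> permutes \<aa> \<and> (\<forall>a\<in>\<aa>. j2 (\<tau> a) = j2 a)}"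
  have rng: "j2 a \<in> {1..m + n}" if "a \<in> \<aa>" for a
  proof -
    have "a \<in> {1..k}" using that \<aa> by blast
    then have "j2 a \<in> {0..m + n}" "j2 a \<noteq> 0" using j2 that by (auto simp: J_set_def)
    then show ?thesis by auto
  qed
  have fib: "{a \<in> \<aa>. j2 a = v} = fibre k j2 v" if "v \<in> {1..m + n}" for v
  proof (rule set_eqI)
    fix a
    have "a \<in> {1..k} \<Longrightarrow> j2 a = 0 \<longleftrightarrow> a \<notin> \<aa>" using j2 by (simp add: J_set_def)
    then show "a \<in> {a \<in> \<aa>. j2 a = v} \<longleftrightarrow> a \<in> fibre k j2 v"
      using \<aa> that by (cases "a \<in> {1..k}") (auto simp: fibre_def)
  qed
  have inv: "\<sigma> (inv \<sigma> a) = a" "inv \<sigma> (\<sigma> a) = a" for a using permutes_inverses[OF \<sigma>(1)] by auto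
  have "bij_betw (\<lambda>\<tau>. \<sigma> \<circ> \<tau>) ?F {\<rho>. \<rho> permutes \<aa> \<and> j1 \<circ> \<rho> = j2}"
  proof (rule bij_betw_byWitness[where f' = "\<lambda>\<rho>. inv \<sigma> \<circ> \<rho>"])
    show "(\<lambda>\<tau>. \<sigma> \<circ> \<tau>) ` ?F \<subseteq> {\<rho>. \<rho> permutes \<aa> \<and> j1 \<circ> \<rho> = j2}"
    proof (rule image_subsetI)
      fix \<tau> assume "\<tau> \<in> ?F"
      then have \<tau>: "\<tau> permutes \<aa>" "\<forall>a\<in>\<aa>. j2 (\<tau> a) = j2 a" by auto
      have "j1 (\<sigma> (\<tau> a)) = j2 a" for a
        using \<tau> permutes_not_in[OF \<tau>(1), of a] \<sigma>(2) by (cases "a \<in> \<aa>") (auto simp: fun_eq_iff)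
      then show "\<sigma> \<circ> \<tau> \<in> {\<rho>. \<rho> permutes \<aa> \<and> j1 \<circ> \<rho> = j2}"
        using permutes_compose[OF \<tau>(1) \<sigma>(1)] by auto
    qed
    show "(\<lambda>\<rho>. inv \<sigma> \<circ> \<rho>) ` {\<rho>. \<rho> permutes \<aa> \<and> j1 \<circ> \<rho> = j2} \<subseteq> ?F"
    proof (rule image_subsetI)
      fix \<rho> assume "\<rho> \<in> {\<rho>. \<rho> permutes \<aa> \<and> j1 \<circ> \<rho> = j2}"
      then have \<rho>: "\<rho> permutes \<aa>" "j1 \<circ> \<rho> = j2" by auto
      have "j2 (inv \<sigma> (\<rho> a)) = j2 a" for a
        using \<sigma>(2) \<rho>(2) inv by (metis comp_apply)
      then show "inv \<sigma> \<circ> \<rho> \<in> ?F"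
        using permutes_compose[OF \<rho>(1) permutes_inv[OF \<sigma>(1)]] by auto
    qed
  qed (auto simp: fun_eq_iff inv)
  then have "card {\<rho>. \<rho> permutes \<aa> \<and> j1 \<circ> \<rho> = j2} = card ?F"
    by (simp add: bij_betw_same_card)
  also have "\<dots> = (\<Prod>v\<in>{1..m+n}. fact (card {a \<in> \<aa>. j2 a = v}))"
    using rng by (intro card_fibre_preserving_permutations fin) auto
  also have "\<dots> = (\<Prod>v\<in>{1..m+n}. fact (card (fibre k j2 v)))"
    using fib by (intro prod.cong) auto
  also have "\<dots> = (\<Prod>i=m+1..m+n. fact (card (fibre k j2 i)))"
  proof (rule prod.mono_neutral_right)
    show "\<forall>i\<in>{1..m+n} - {m+1..m+n}. fact (card (fibre k j2 i)) = (1::nat)"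
    proof
      fix i assume "i \<in> {1..m+n} - {m+1..m+n}"
      then have "card (fibre k j2 i) \<le> 1" using j2 by (auto simp: J_set_def)
      then show "fact (card (fibre k j2 i)) = (1::nat)"
        by (metis fact_0 fact_1 le_neq_implies_less less_one)
    qed
  qed auto
  finally show ?thesis .
qed

lemma fibre_comp_inv:
  assumes \<sigma>: "\<sigma> permutes \<aa>" and \<aa>: "\<aa> \<subseteq> {1..k}"
  shows "fibre k (j \<circ> inv \<sigma>) i = \<sigma> ` fibre k j i"
proof -
  have s: "\<sigma> permutes {1..k}" using permutes_subset[OF \<sigma> \<aa>] .
  show ?thesis
  proof (rule set_eqI)
    fix a
    have "a \<in> \<sigma> ` fibre k j i \<longleftrightarrow> inv \<sigma> a \<in> fibre k j i"
      by (metis (no_types, lifting) image_iff permutes_inverses[OF \<sigma>])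
    then show "a \<in> fibre k (j \<circ> inv \<sigma>) i \<longleftrightarrow> a \<in> \<sigma> ` fibre k j i"
      using permutes_in_image[OF permutes_inv[OF s], of a] by (auto simp: fibre_def)
  qed
qed

text \<open>
  When an even index \<open>i\<close> is used twice, the permutations of \<open>\<aa>\<close> cancel in pairs. This is
  stated for integer coefficients, where \<open>S = - S\<close> implies \<open>S = 0\<close>.
\<close>

lemma sum_sign_eq_0:
  fixes j1 j2 :: "nat \<Rightarrow> nat"
  assumes "b \<in> \<aa>" "c \<in> \<aa>" "b \<noteq> c" "j2 b = j2 c" "j2 b \<le> m" "finite \<aa>"
  shows "(\<Sum>\<sigma> | \<sigma> permutes \<aa> \<and> j1 \<circ> \<sigma> = j2. sign \<sigma> * inv_sign {b \<in> \<aa>. m < j2 b} \<sigma>) = 0"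
    (is "sum ?h ?A = 0")
proof -
  let ?t = "transpose b c"
  have t: "?t permutes \<aa>" using assms by (intro permutes_swap_id) auto
  have j: "j2 (?t a) = j2 a" for a using assms(4) by (auto simp: transpose_def)
  have A: "\<sigma> \<circ> ?t \<in> ?A" if "\<sigma> \<in> ?A" for \<sigma>
    using that permutes_compose[OF t] j by (auto simp: fun_eq_iff)
  have h: "?h (\<sigma> \<circ> ?t) = - ?h \<sigma>" if "\<sigma> \<in> ?A" for \<sigma>
  proof -
    have "permutation \<sigma>" using that assms(6) by (auto simp: permutation_permutes)
    then have "sign (\<sigma> \<circ> ?t) = - sign \<sigma>"
      using assms(3) by (simp add: sign_compose permutation_swap_id sign_swap_id)
    \<comment> \<open>\<open>b\<close> and \<open>c\<close> are even positions, hence outside the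
      set over which inversions are counted.\<close>
    moreover have "inv_sign {b \<in> \<aa>. m < j2 b} (\<sigma> \<circ> ?t) = inv_sign {b \<in> \<aa>. m < j2 b} \<sigma>"
      unfolding inv_sign_def
      using assms(4,5) by (intro prod.cong refl) (auto simp: incr_pairs_def transpose_def)
    ultimately show ?thesis by simp
  qed
  have "sum ?h ?A = (\<Sum>\<sigma>\<in>?A. ?h (\<sigma> \<circ> ?t))"
    by (rule sum.reindex_bij_witness[of _ "\<lambda>\<sigma>. \<sigma> \<circ> ?t" "\<lambda>\<sigma>. \<sigma> \<circ> ?t"])
      (use A in \<open>auto simp: comp_assoc\<close>)
  also have "\<dots> = - sum ?h ?A" using h by (simp add: sum_negf)
  finally show ?thesis by simp
qed

text \<open>With the column labels \<open>j2\<close> fixed, the permutations are grouped by the row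
  labels \<open>j1 = j2 \<circ> inv \<sigma>\<close>. If \<open>j2\<close> lies in
  \<open>J_set\<close>, each group is constant and gets counted; otherwise an even label is repeated
  and each group sums to 0.\<close>

lemma sum_permutes_relabel:
  fixes g :: "(nat \<Rightarrow> nat) \<Rightarrow> 'r::ring_1"
  assumes \<aa>: "\<aa> \<subseteq> {1..k}" and j2: "j2 \<in> {1..k} \<rightarrow>\<^sub>E {0..m + n}" "{b \<in> {1..k}. j2 b \<noteq> 0} = \<aa>"
  defines "S \<equiv> {b \<in> \<aa>. m < j2 b}"
  shows "(\<Sum>\<sigma> | \<sigma> permutes \<aa>. of_int ((-1) ^ card \<aa> * (-1) ^ card (incr_pairs S) * (sign \<sigma> * inv_sign S \<sigma>))
      * g (j2 \<circ> inv \<sigma>)) =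
    (if j2 \<in> J_set m n k \<aa> then \<Sum>j1 | j1 \<in> J_set m n k \<aa> \<and> J_equiv k j1 j2.
       of_int (J_coeff m n k \<aa> j1 j2) * of_nat (\<Prod>i=m+1..m+n. fact (card (fibre k j2 i))) * g j1 else 0)"
    (is "sum ?h ?P = _")
proof -
  have fin: "finite \<aa>" using \<aa> finite_subset by blast
  let ?c = "(-1) ^ card \<aa> * (-1) ^ card (incr_pairs S) :: int"
  let ?A = "\<lambda>j1. {\<sigma>. \<sigma> permutes \<aa> \<and> j1 \<circ> \<sigma> = j2}"
  have relabel: "j2 \<circ> inv \<sigma> = j1 \<longleftrightarrow> j1 \<circ> \<sigma> = j2" if "\<sigma> permutes \<aa>" for j1 \<sigma>
    unfolding fun_eq_iff comp_def using permutes_inverses[OF that] by metis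
  have finP: "finite ?P" using finite_permutations[OF fin] .
  \<comment> \<open>\<open>T\<close> stays open: it becomes the set of all \<open>j1\<close>
    equivalent to \<open>j2\<close> in the first case and the bare image in the second.\<close>
  have group: "sum ?h ?P = (\<Sum>j1\<in>T. of_int (?c * (\<Sum>\<sigma>\<in>?A j1. sign \<sigma> * inv_sign S \<sigma>)) * g j1)"
    if T: "finite T" "(\<lambda>\<sigma>. j2 \<circ> inv \<sigma>) ` ?P \<subseteq> T" for T
  proof -
    have "sum ?h ?P = (\<Sum>j1\<in>T. \<Sum>\<sigma>\<in>{\<sigma> \<in> ?P. j2 \<circ> inv \<sigma> = j1}. ?h \<sigma>)"
      by (rule sum.group[OF finP T, symmetric])
    also have "\<dots> = (\<Sum>j1\<in>T. \<Sum>\<sigma>\<in>{\<sigma> \<in> ?P. j2 \<circ> inv \<sigma> = j1}. of_int (?c * (sign \<sigma> * inv_sign S \<sigma>)) * g j1)"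
      by (intro sum.cong refl) simp
    also have "\<dots> = (\<Sum>j1\<in>T. \<Sum>\<sigma>\<in>?A j1. of_int (?c * (sign \<sigma> * inv_sign S \<sigma>)) * g j1)"
    proof (rule sum.cong[OF refl], rule sum.cong)
      show "{\<sigma> \<in> ?P. j2 \<circ> inv \<sigma> = j1} = ?A j1" for j1 using relabel by blast
    qed simp
    finally show ?thesis by (simp only: sum_distrib_left sum_distrib_right of_int_sum)
  qed
  show ?thesis
  proof (cases "j2 \<in> J_set m n k \<aa>")
    case True
    let ?T = "{j1. j1 \<in> J_set m n k \<aa> \<and> J_equiv k j1 j2}"
    have "finite (J_set m n k \<aa>)"
      by (rule finite_subset[of _ "{1..k} \<rightarrow>\<^sub>E {0..m + n}"]) (auto simp: J_set_def intro: finite_PiE)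
    then have finT: "finite ?T" by simp
    have "(\<lambda>\<sigma>. j2 \<circ> inv \<sigma>) ` ?P \<subseteq> ?T"
    proof (rule image_subsetI)
      fix \<sigma> assume "\<sigma> \<in> ?P"
      then have \<sigma>: "\<sigma> permutes \<aa>" by simp
      have inv: "inv \<sigma> a \<in> {1..k} \<longleftrightarrow> a \<in> {1..k}" "inv \<sigma> a \<in> \<aa> \<longleftrightarrow> a \<in> \<aa>" for a
        using permutes_in_image[OF permutes_inv[OF permutes_subset[OF \<sigma> \<aa>]]]
          permutes_in_image[OF permutes_inv[OF \<sigma>]] by auto
      have card: "card (fibre k (j2 \<circ> inv \<sigma>) i) = card (fibre k j2 i)" for i
        unfolding fibre_comp_inv[OF \<sigma> \<aa>] by (rule card_image[OF permutes_inj_on[OF \<sigma>]])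
      have "(j2 \<circ> inv \<sigma>) a = undefined" if "a \<notin> {1..k}" for a
        using inv(1)[of a] that j2(1) by (auto simp: PiE_def extensional_def)
      moreover have "(j2 \<circ> inv \<sigma>) a \<in> {0..m + n}" if "a \<in> {1..k}" for a
        using inv(1)[of a] that j2(1) by auto
      ultimately have "j2 \<circ> inv \<sigma> \<in> {1..k} \<rightarrow>\<^sub>E {0..m + n}" by blast
      moreover have "(j2 \<circ> inv \<sigma>) a = 0 \<longleftrightarrow> a \<notin> \<aa>" if "a \<in> {1..k}" for a
        using inv[of a] that True by (auto simp: J_set_def)
      ultimately show "j2 \<circ> inv \<sigma> \<in> ?T"
        using True card by (simp add: J_set_def J_equiv_def)
    qed
    then have "sum ?h ?P = (\<Sum>j1\<in>?T. of_int (?c * (\<Sum>\<sigma>\<in>?A j1. sign \<sigma> * inv_sign S \<sigma>)) * g j1)"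
      by (rule group[OF finT])
    also have "\<dots> = (\<Sum>j1\<in>?T. of_int (J_coeff m n k \<aa> j1 j2)
        * of_nat (\<Prod>i=m+1..m+n. fact (card (fibre k j2 i))) * g j1)"
    proof (rule sum.cong[OF refl])
      fix j1 assume "j1 \<in> ?T"
      then have j1: "j1 \<in> J_set m n k \<aa>" "J_equiv k j1 j2" by auto
      obtain \<sigma> where \<sigma>: "\<sigma> permutes \<aa>" "j1 \<circ> \<sigma> = j2" using J_perm[OF \<aa> j1(1) True j1(2)] by blast
      have "?c * (\<Sum>\<sigma>\<in>?A j1. sign \<sigma> * inv_sign S \<sigma>) = (\<Sum>\<sigma>\<in>?A j1. J_coeff m n k \<aa> j1 j2)"
        unfolding sum_distrib_left
        using J_coeff_eq[OF \<aa> j1(1) True j1(2)] by (intro sum.cong refl) (auto simp: S_def)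
      also have "\<dots> = J_coeff m n k \<aa> j1 j2 * int (\<Prod>i=m+1..m+n. fact (card (fibre k j2 i)))"
        unfolding sum_constant card_relabelling_permutations[OF \<aa> True \<sigma>] by (rule mult.commute)
      finally show "of_int (?c * (\<Sum>\<sigma>\<in>?A j1. sign \<sigma> * inv_sign S \<sigma>)) * g j1 =
        of_int (J_coeff m n k \<aa> j1 j2) * of_nat (\<Prod>i=m+1..m+n. fact (card (fibre k j2 i))) * g j1"
        by (simp only: of_int_mult of_int_of_nat_eq)
    qed
    finally show ?thesis using True by simp
  next
    case False
    then obtain i where i: "i \<in> {1..m}" "\<not> card (fibre k j2 i) \<le> 1"
      using j2 by (auto simp: J_set_def)
    then obtain b c where bc: "b \<in> fibre k j2 i" "c \<in> fibre k j2 i" "b \<noteq> c"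
      by (metis card_le_Suc0_iff_eq finite_fibre One_nat_def)
    have "sum ?h ?P = (\<Sum>j1\<in>(\<lambda>\<sigma>. j2 \<circ> inv \<sigma>) ` ?P.
        of_int (?c * (\<Sum>\<sigma>\<in>?A j1. sign \<sigma> * inv_sign S \<sigma>)) * g j1)"
      by (rule group) (use finP in auto)
    also have "\<dots> = 0"
    proof (rule sum.neutral, rule ballI)
      fix j1
      have "(\<Sum>\<sigma>\<in>?A j1. sign \<sigma> * inv_sign S \<sigma>) = 0"
        unfolding S_def using bc i j2(2) by (intro sum_sign_eq_0[of b _ c] fin) (auto simp: fibre_def)
      then show "of_int (?c * (\<Sum>\<sigma>\<in>?A j1. sign \<sigma> * inv_sign S \<sigma>)) * g j1 = 0" by simp
    qed
    finally show ?thesis using False by simp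
  qed
qed

section \<open>The normal ordered expansion\<close>

lemma prod_list_commute:
  fixes c :: "'a::monoid_mult"
  assumes "\<And>x. x \<in> set xs \<Longrightarrow> c * x = x * c"
  shows "c * prod_list xs = prod_list xs * c"
  using assms
proof (induction xs)
  case (Cons x xs)
  have "c * (x * prod_list xs) = x * (c * prod_list xs)"
    using Cons.prems by (simp flip: mult.assoc)
  also have "c * prod_list xs = prod_list xs * c" using Cons by simp
  finally show ?case by (simp add: mult.assoc)
qed simp

lemma sum_PiE_insert:
  assumes "b \<notin> S"
  shows "(\<Sum>j\<in>insert b S \<rightarrow>\<^sub>E B. f j) = (\<Sum>v\<in>B. \<Sum>g\<in>S \<rightarrow>\<^sub>E B. f (g(b := v)))"
proof -
  have "(\<Sum>j\<in>insert b S \<rightarrow>\<^sub>E B. f j) = (\<Sum>(v, g)\<in>B \<times> (S \<rightarrow>\<^sub>E B). f (g(b := v)))"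
    unfolding PiE_insert_eq
    by (subst sum.reindex[OF inj_combinator[OF assms]]) (simp add: case_prod_unfold)
  then show ?thesis by (simp add: sum.cartesian_product)
qed

context capelli_system
begin

text \<open>The contribution of one choice in every column: \<open>j b = 0\<close> takes the
  diagonal part, present only if \<open>\<sigma> b = b\<close>, and any other value of
  \<open>j b\<close> is the index of the chosen summand. The \<open>D\<close> are reversed because
  each sandwich encloses the later columns.\<close>

definition ordered_term :: "(nat \<Rightarrow> nat) \<Rightarrow> (nat \<Rightarrow> nat) \<Rightarrow> nat list \<Rightarrow> 'r" where
  "ordered_term \<sigma> j bs = (let cs = filter (\<lambda>b. j b \<noteq> 0) bs in
     (if \<forall>b\<in>set bs. j b = 0 \<longrightarrow> \<sigma> b = b then of_int ((-1) ^ length cs) else 0)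
     * (prod_list (map (\<lambda>b. X (j b) (\<sigma> b)) cs) * prod_list (map (\<lambda>b. D (j b) b) (rev cs)))
     * prod_list (map (\<lambda>b. F (j b)) cs)
     * prod_list (map T (filter (\<lambda>b. j b = 0) bs)))"

lemma ordered_term_Nil: "ordered_term \<sigma> j [] = 1"
  by (simp add: ordered_term_def)

lemma ordered_term_cong:
  assumes "\<And>b. b \<in> set bs \<Longrightarrow> j b = j' b"
  shows "ordered_term \<sigma> j bs = ordered_term \<sigma> j' bs"
proof -
  have f: "filter (\<lambda>b. j b \<noteq> 0) bs = filter (\<lambda>b. j' b \<noteq> 0) bs"
    "filter (\<lambda>b. j b = 0) bs = filter (\<lambda>b. j' b = 0) bs"
    using assms by (auto intro: filter_cong)
  have m: "map (\<lambda>b. X (j b) (\<sigma> b)) (filter (\<lambda>b. j' b \<noteq> 0) bs) = map (\<lambda>b. X (j' b) (\<sigma> b)) (filter (\<lambda>b. j' b \<noteq> 0) bs)"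
    "map (\<lambda>b. D (j b) b) (rev (filter (\<lambda>b. j' b \<noteq> 0) bs)) = map (\<lambda>b. D (j' b) b) (rev (filter (\<lambda>b. j' b \<noteq> 0) bs))"
    "map (\<lambda>b. F (j b)) (filter (\<lambda>b. j' b \<noteq> 0) bs) = map (\<lambda>b. F (j' b)) (filter (\<lambda>b. j' b \<noteq> 0) bs)"
    using assms by auto
  have c: "(\<forall>b\<in>set bs. j b = 0 \<longrightarrow> \<sigma> b = b) \<longleftrightarrow> (\<forall>b\<in>set bs. j' b = 0 \<longrightarrow> \<sigma> b = b)"
    using assms by auto
  show ?thesis unfolding ordered_term_def Let_def f m c ..
qed

lemma ordered_term_Cons_0:
  assumes "j b = 0"
  shows "ordered_term \<sigma> j (b # bs) = (if \<sigma> b = b then ordered_term \<sigma> j bs * T b else 0)"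
proof -
  have "T b * prod_list (map T (filter (\<lambda>b. j b = 0) bs)) = prod_list (map T (filter (\<lambda>b. j b = 0) bs)) * T b"
    by (rule prod_list_commute) (auto simp: T_T)
  then show ?thesis using assms by (auto simp: ordered_term_def Let_def mult.assoc)
qed

text \<open>The new \<open>X\<close> joins the front of the \<open>X\<close> word and the new
  \<open>D\<close> the end of the reversed \<open>D\<close> word. All other moves are through
  factors that commute, so the only sign is the minus of the entry.\<close>

lemma ordered_term_Cons:
  assumes "j b \<noteq> 0"
  shows "ordered_term \<sigma> j (b # bs) = - (X (j b) (\<sigma> b) * F (j b) * ordered_term \<sigma> j bs * D (j b) b)"
proof -
  let ?i = "j b" and ?cs = "filter (\<lambda>b. j b \<noteq> 0) bs"
  define ok where "ok \<longleftrightarrow> (\<forall>b\<in>set bs. j b = 0 \<longrightarrow> \<sigma> b = b)"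
  \<comment> \<open>Kept as an integer, so that its image in the ring can be moved past every
    element.\<close>
  define s :: int where "s = (if ok then (-1) ^ length ?cs else 0)"
  define WX where "WX = prod_list (map (\<lambda>b. X (j b) (\<sigma> b)) ?cs)"
  define WD where "WD = prod_list (map (\<lambda>b. D (j b) b) (rev ?cs))"
  define WF where "WF = prod_list (map (\<lambda>b. F (j b)) ?cs)"
  define WT where "WT = prod_list (map T (filter (\<lambda>b. j b = 0) bs))"
  have FX: "F ?i * WX = WX * F ?i" unfolding WX_def by (rule prod_list_commute) (auto simp: F_X)
  have FD: "F ?i * WD = WD * F ?i" unfolding WD_def by (rule prod_list_commute) (auto simp: F_D)
  have DF: "D ?i b * WF = WF * D ?i b" unfolding WF_def by (rule prod_list_commute) (auto simp: F_D)
  have DT: "D ?i b * WT = WT * D ?i b" unfolding WT_def by (rule prod_list_commute) (auto simp: T_D)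
  have s': "of_int s = (if \<forall>b\<in>set bs. j b = 0 \<longrightarrow> \<sigma> b = b then of_int ((-1) ^ length ?cs) else (0 :: 'r))"
    unfolding ok_def[symmetric] by (simp add: s_def)
  have 1: "ordered_term \<sigma> j bs = of_int s * (WX * WD) * WF * WT"
    unfolding ordered_term_def Let_def s' WX_def WD_def WF_def WT_def ..
  have c: "of_int (- s) = (if \<forall>b\<in>set (b # bs). j b = 0 \<longrightarrow> \<sigma> b = b
      then of_int ((-1) ^ length (filter (\<lambda>b. j b \<noteq> 0) (b # bs))) else (0 :: 'r))"
  proof -
    have "(\<forall>b\<in>set (b # bs). j b = 0 \<longrightarrow> \<sigma> b = b) \<longleftrightarrow> ok" using assms by (auto simp: ok_def)
    then show ?thesis using assms by (simp add: s_def)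
  qed
  have "ordered_term \<sigma> j (b # bs) = of_int (- s) * (X ?i (\<sigma> b) * WX * (WD * D ?i b)) * (F ?i * WF) * WT"
    unfolding ordered_term_def Let_def c[symmetric]
    using assms by (simp add: WX_def WD_def WF_def WT_def mult.assoc)
  also have "\<dots> = - (of_int s * (X ?i (\<sigma> b) * WX * (WD * (D ?i b * F ?i)) * WF * WT))"
    by (simp add: mult.assoc)
  also have "WD * (D ?i b * F ?i) = (WD * F ?i) * D ?i b"
    by (simp add: mult.assoc F_D)
  also have "of_int s * (X ?i (\<sigma> b) * WX * (WD * F ?i * D ?i b) * WF * WT) =
      of_int s * (X ?i (\<sigma> b) * (WX * F ?i) * WD * (D ?i b * WF) * WT)"
    by (simp add: mult.assoc flip: FD)
  also have "\<dots> = of_int s * (X ?i (\<sigma> b) * F ?i * WX * WD * WF * (D ?i b * WT))"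
    unfolding DF FX[symmetric] by (simp add: mult.assoc)
  also have "\<dots> = X ?i (\<sigma> b) * F ?i * (of_int s * (WX * WD) * WF * WT) * D ?i b"
    unfolding DT
    by (simp only: mult.assoc mult_of_int_left_commute[of "F ?i"] mult_of_int_left_commute[of "X ?i (\<sigma> b)"])
  finally show ?thesis unfolding 1 .
qed

lemma normal_prod_expand:
  assumes "distinct bs"
  shows "normal_prod (map (\<lambda>b. (\<sigma> b, b)) bs) = (\<Sum>j\<in>set bs \<rightarrow>\<^sub>E {0..r}. ordered_term \<sigma> j bs)"
  using assms
proof (induction bs)
  case (Cons b bs)
  let ?E = "set bs \<rightarrow>\<^sub>E {0..r}" and ?N = "normal_prod (map (\<lambda>b. (\<sigma> b, b)) bs)"
  have b: "b \<notin> set bs" and IH: "?N = (\<Sum>j\<in>?E. ordered_term \<sigma> j bs)" using Cons by auto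
  have upd: "ordered_term \<sigma> (g(b := v)) bs = ordered_term \<sigma> g bs" for g v
    using b by (intro ordered_term_cong) auto
  have "(\<Sum>j\<in>set (b # bs) \<rightarrow>\<^sub>E {0..r}. ordered_term \<sigma> j (b # bs)) =
      (\<Sum>v=0..r. \<Sum>g\<in>?E. ordered_term \<sigma> (g(b := v)) (b # bs))"
    using sum_PiE_insert[OF b] by simp
  also have "\<dots> = (\<Sum>g\<in>?E. ordered_term \<sigma> (g(b := 0)) (b # bs)) +
      (\<Sum>v=1..r. \<Sum>g\<in>?E. ordered_term \<sigma> (g(b := v)) (b # bs))"
    by (simp add: sum.atLeast_Suc_atMost)
  also have "(\<Sum>g\<in>?E. ordered_term \<sigma> (g(b := 0)) (b # bs)) = (if \<sigma> b = b then ?N * T b else 0)"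
    by (simp add: ordered_term_Cons_0 upd IH sum_distrib_right)
  also have "(\<Sum>v=1..r. \<Sum>g\<in>?E. ordered_term \<sigma> (g(b := v)) (b # bs)) =
      (\<Sum>v=1..r. - (X v (\<sigma> b) * F v * ?N * D v b))"
  proof (rule sum.cong[OF refl])
    fix v assume "v \<in> {1..r}"
    then have "v \<noteq> 0" by simp
    then have "(\<Sum>g\<in>?E. ordered_term \<sigma> (g(b := v)) (b # bs)) =
       (\<Sum>g\<in>?E. - (X v (\<sigma> b) * F v * ordered_term \<sigma> g bs * D v b))"
      by (intro sum.cong refl, subst ordered_term_Cons) (simp_all add: upd)
    then show "(\<Sum>g\<in>?E. ordered_term \<sigma> (g(b := v)) (b # bs)) = - (X v (\<sigma> b) * F v * ?N * D v b)"
      by (simp add: IH sum_negf sum_distrib_left sum_distrib_right)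
  qed
  finally show ?case by (simp add: sum_negf)
qed (simp add: ordered_term_Nil)

abbreviation x_prod :: "nat set \<Rightarrow> (nat \<Rightarrow> nat) \<Rightarrow> 'r" where
  "x_prod \<aa> j \<equiv> prod_list (map (\<lambda>a. X (j a) a) (sorted_list_of_set \<aa>))"

abbreviation d_prod :: "nat set \<Rightarrow> (nat \<Rightarrow> nat) \<Rightarrow> 'r" where
  "d_prod \<aa> j \<equiv> prod_list (map (\<lambda>a. D (j a) a) (sorted_list_of_set \<aa>))"

abbreviation ft_prod :: "nat set \<Rightarrow> (nat \<Rightarrow> nat) \<Rightarrow> 'r" where
  "ft_prod \<aa> j \<equiv> prod_list (map (\<lambda>a. F (j a)) (sorted_list_of_set \<aa>))
     * prod_list (map T (sorted_list_of_set ({1..k} - \<aa>)))"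

text \<open>The \<open>X\<close> come in column order. In terms of their rows
  \<open>a = \<sigma> b\<close> the labels are \<open>j \<circ> inv \<sigma>\<close>, and sorting
  the rows costs the inversions of \<open>\<sigma>\<close> among odd labels; the \<open>D\<close>
  only have to be reversed.\<close>

lemma ordered_term_sorted:
  assumes \<aa>: "\<aa> \<subseteq> {1..k}" and j: "j \<in> {1..k} \<rightarrow>\<^sub>E {0..r}" "{b \<in> {1..k}. j b \<noteq> 0} = \<aa>"
    and \<sigma>: "\<sigma> permutes \<aa>"
  defines "S \<equiv> {b \<in> \<aa>. m < j b}"
  shows "ordered_term \<sigma> j [1..<Suc k] =
    of_int ((-1) ^ card \<aa> * (-1) ^ card (incr_pairs S) * inv_sign S \<sigma>)
      * (x_prod \<aa> (j \<circ> inv \<sigma>) * d_prod \<aa> j * ft_prod \<aa> j)"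
proof -
  have fin: "finite \<aa>" using \<aa> finite_subset by blast
  let ?L = "sorted_list_of_set \<aa>"
  have setL: "set ?L = \<aa>" using fin by simp
  have filters: "filter (\<lambda>b. j b \<noteq> 0) [1..<Suc k] = ?L"
    "filter (\<lambda>b. j b = 0) [1..<Suc k] = sorted_list_of_set ({1..k} - \<aa>)"
  proof -
    have s: "sorted_wrt (<) (filter Q [1..<Suc k])" for Q
      by (intro sorted_wrt_filter sorted_wrt_upt)
    show "filter (\<lambda>b. j b \<noteq> 0) [1..<Suc k] = ?L"
      using j(2) by (intro strict_sorted_equal[OF strict_sorted_list_of_set s]) (auto simp: setL simp del: upt_Suc)
    show "filter (\<lambda>b. j b = 0) [1..<Suc k] = sorted_list_of_set ({1..k} - \<aa>)"
      using j(2) by (intro strict_sorted_equal[OF strict_sorted_list_of_set s]) (auto simp del: upt_Suc)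
  qed
  have fixed: "\<forall>b\<in>set [1..<Suc k]. j b = 0 \<longrightarrow> \<sigma> b = b"
    using j(2) permutes_not_in[OF \<sigma>] by (auto simp del: upt_Suc)
  have rng: "j a \<in> {1..r}" if "a \<in> \<aa>" for a
  proof -
    have "a \<in> {1..k}" "j a \<noteq> 0" using that j(2) by auto
    then have "j a \<in> {0..r}" using j(1) by auto
    with \<open>j a \<noteq> 0\<close> show ?thesis by simp
  qed
  let ?j' = "j \<circ> inv \<sigma>"
  have inv: "inv \<sigma> (\<sigma> b) = b" for b using permutes_inverses[OF \<sigma>] by simp
  have rng': "?j' a \<in> {1..r}" if "a \<in> \<aa>" for a
    using rng[of "inv \<sigma> a"] permutes_in_image[OF permutes_inv[OF \<sigma>]] that by simp
  have mem: "a \<in> {1..k}" if "a \<in> \<aa>" for a using that \<aa> by blast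
  interpret x: supercommuting "\<lambda>a. X (?j' a) a" "\<lambda>a. m < ?j' a" \<aa>
  proof
    fix a b assume ab: "a \<in> \<aa>" "b \<in> \<aa>"
    show "X (?j' a) a * X (?j' b) b = (if m < ?j' a \<and> m < ?j' b
        then - (X (?j' b) b * X (?j' a) a) else X (?j' b) b * X (?j' a) a)"
      using X_X[OF rng'[OF ab(1)] rng'[OF ab(2)] mem[OF ab(1)] mem[OF ab(2)]]
      by (cases "m < ?j' a \<and> m < ?j' b") (simp_all only: koszul_def simp_thms if_True if_False mult_minus1 mult_1_left)
  qed
  interpret d: supercommuting "\<lambda>a. D (j a) a" "\<lambda>a. m < j a" \<aa>
  proof
    fix a b assume ab: "a \<in> \<aa>" "b \<in> \<aa>"
    show "D (j a) a * D (j b) b = (if m < j a \<and> m < j b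
        then - (D (j b) b * D (j a) a) else D (j b) b * D (j a) a)"
      using D_D[OF rng[OF ab(1)] rng[OF ab(2)] mem[OF ab(1)] mem[OF ab(2)]]
      by (cases "m < j a \<and> m < j b") (simp_all only: koszul_def simp_thms if_True if_False mult_minus1 mult_1_left)
  qed
  have sort: "sort (map \<sigma> ?L) = ?L"
  proof -
    have "distinct (map \<sigma> ?L)" using permutes_inj_on[OF \<sigma>] by (simp add: distinct_map)
    then have "sorted_wrt (<) (sort (map \<sigma> ?L))" by (simp add: strict_sorted_iff)
    then show ?thesis
      using permutes_image[OF \<sigma>] setL
      by (intro strict_sorted_equal[OF strict_sorted_list_of_set]) auto
  qed
  have "prod_list (map (\<lambda>b. X (j b) (\<sigma> b)) ?L) = prod_list (map (\<lambda>a. X (?j' a) a) (map \<sigma> ?L))"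
    by (simp add: comp_def inv)
  also have "\<dots> = of_int (sort_sign (\<lambda>a. m < ?j' a) (map \<sigma> ?L)) * x_prod \<aa> ?j'"
    using x.prod_list_sort[of "map \<sigma> ?L"] permutes_image[OF \<sigma>] permutes_inj_on[OF \<sigma>] setL
    unfolding sort by (simp add: distinct_map)
  also have "sort_sign (\<lambda>a. m < ?j' a) (map \<sigma> ?L) = inv_sign S \<sigma>"
    unfolding S_def using sort_sign_map[OF strict_sorted_list_of_set, of \<aa> "\<lambda>a. m < ?j' a" \<sigma> "\<lambda>b. m < j b"]
    by (simp add: inv setL)
  finally have xs: "prod_list (map (\<lambda>b. X (j b) (\<sigma> b)) ?L) = of_int (inv_sign S \<sigma>) * x_prod \<aa> ?j'" .
  have ds: "prod_list (map (\<lambda>b. D (j b) b) (rev ?L)) = of_int ((-1) ^ card (incr_pairs S)) * d_prod \<aa> j"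
    unfolding S_def using d.prod_list_rev[of ?L] setL strict_sorted_list_of_set[of \<aa>] by simp
  have len: "length ?L = card \<aa>" by simp
  have comm: "of_int p * (of_int q * x * (of_int t * y)) * f * w = of_int (p * t * q) * (x * y * (f * w))"
    for p q t :: int and x y f w :: 'r
  proof -
    have "of_int q * x * (of_int t * y) = of_int (t * q) * (x * y)"
      by (metis mult.assoc mult_of_int_commute of_int_mult mult.commute)
    then show ?thesis by (simp only: of_int_mult mult.assoc)
  qed
  show ?thesis
    unfolding ordered_term_def Let_def filters if_P[OF fixed] xs ds len comm ..
qed

text \<open>The labels \<open>j\<close> are fixed before the permutations are summed. The support of
  \<open>j\<close> becomes \<open>\<aa>\<close>, and a permutation that moves a column outside it
  contributes 0, because an entry off the diagonal has no \<open>T\<close>.\<close>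

lemma cdet_gmat_normal_ordered:
  assumes r: "r = m + n"
  shows "cdet k gmat =
    (\<Sum>\<aa>\<in>Pow {1..k}. \<Sum>(j1, j2)\<in>{(j1, j2). j1 \<in> J_set m n k \<aa> \<and> j2 \<in> J_set m n k \<aa> \<and> J_equiv k j1 j2}.
       of_int (J_coeff m n k \<aa> j1 j2) * of_nat (\<Prod>i=m+1..m+n. fact (card (fibre k j2 i)))
       * (x_prod \<aa> j1 * d_prod \<aa> j2 * ft_prod \<aa> j2))"
proof -
  let ?P = "{\<sigma>. \<sigma> permutes {1..k}}" and ?E = "{1..k} \<rightarrow>\<^sub>E {0..r}"
  let ?supp = "\<lambda>j. {b \<in> {1..k}. j b \<noteq> (0::nat)}"
  let ?J = "J_set m n k"
  let ?f = "\<lambda>j2. of_nat (\<Prod>i=m+1..m+n. fact (card (fibre k j2 i))) :: 'r"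
  let ?g = "\<lambda>\<aa> j2 j1. x_prod \<aa> j1 * d_prod \<aa> j2 * ft_prod \<aa> j2"
  have finE: "finite ?E" by (intro finite_PiE) auto
  have finJ: "finite (?J \<aa>)" for \<aa>
    by (rule finite_subset[OF _ finE]) (auto simp: J_set_def r)
  have inner: "(\<Sum>\<sigma>\<in>?P. of_int (sign \<sigma>) * ordered_term \<sigma> j [1..<Suc k]) =
      (if j \<in> ?J \<aa> then \<Sum>j1 | j1 \<in> ?J \<aa> \<and> J_equiv k j1 j. of_int (J_coeff m n k \<aa> j1 j) * ?f j * ?g \<aa> j j1 else 0)"
    if j: "j \<in> ?E" "?supp j = \<aa>" for j \<aa>
  proof -
    have \<aa>: "\<aa> \<subseteq> {1..k}" using j(2) by auto
    let ?S = "{b \<in> \<aa>. m < j b}"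
    have "(\<Sum>\<sigma>\<in>?P. of_int (sign \<sigma>) * ordered_term \<sigma> j [1..<Suc k]) =
       (\<Sum>\<sigma> | \<sigma> permutes \<aa>. of_int (sign \<sigma>) * ordered_term \<sigma> j [1..<Suc k])"
    proof (rule sum.mono_neutral_right)
      show "finite ?P" by (simp add: finite_permutations)
      show "{\<sigma>. \<sigma> permutes \<aa>} \<subseteq> ?P" using permutes_subset[OF _ \<aa>] by auto
      show "\<forall>\<sigma>\<in>?P - {\<sigma>. \<sigma> permutes \<aa>}. of_int (sign \<sigma>) * ordered_term \<sigma> j [1..<Suc k] = 0"
      proof
        fix \<sigma> assume \<sigma>: "\<sigma> \<in> ?P - {\<sigma>. \<sigma> permutes \<aa>}"
        then have "\<not> (\<forall>b\<in>{1..k} - \<aa>. \<sigma> b = b)" using permutes_superset[of \<sigma> "{1..k}" \<aa>] by blast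
        then have "\<not> (\<forall>b\<in>set [1..<Suc k]. j b = 0 \<longrightarrow> \<sigma> b = b)"
          using j(2) by (auto simp del: upt_Suc)
        then show "of_int (sign \<sigma>) * ordered_term \<sigma> j [1..<Suc k] = 0"
          unfolding ordered_term_def Let_def by (simp only: if_False mult_zero_left mult_zero_right)
      qed
    qed
    also have "\<dots> = (\<Sum>\<sigma> | \<sigma> permutes \<aa>. of_int ((-1) ^ card \<aa> * (-1) ^ card (incr_pairs ?S)
        * (sign \<sigma> * inv_sign ?S \<sigma>)) * ?g \<aa> j (j \<circ> inv \<sigma>))"
    proof (rule sum.cong[OF refl])
      fix \<sigma> assume "\<sigma> \<in> {\<sigma>. \<sigma> permutes \<aa>}"
      then have \<sigma>: "\<sigma> permutes \<aa>" by simp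
      show "of_int (sign \<sigma>) * ordered_term \<sigma> j [1..<Suc k] = of_int ((-1) ^ card \<aa> * (-1) ^ card (incr_pairs ?S)
        * (sign \<sigma> * inv_sign ?S \<sigma>)) * ?g \<aa> j (j \<circ> inv \<sigma>)"
        unfolding ordered_term_sorted[OF \<aa> j \<sigma>] mult.assoc[symmetric, of "of_int _" "of_int _"] of_int_mult[symmetric]
        by (simp only: mult.assoc mult.left_commute[of "sign \<sigma>"])
    qed
    also have "\<dots> = (if j \<in> ?J \<aa> then \<Sum>j1 | j1 \<in> ?J \<aa> \<and> J_equiv k j1 j. of_int (J_coeff m n k \<aa> j1 j) * ?f j * ?g \<aa> j j1 else 0)"
      using j by (intro sum_permutes_relabel[OF \<aa>]) (auto simp: r)
    finally show ?thesis .
  qed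
  have "cdet k gmat = (\<Sum>\<sigma>\<in>?P. \<Sum>j\<in>?E. of_int (sign \<sigma>) * ordered_term \<sigma> j [1..<Suc k])"
  proof -
    have "set [1..<Suc k] = {1..k}" by auto
    then have "normal_prod (graph_list \<sigma> 0) = (\<Sum>j\<in>?E. ordered_term \<sigma> j [1..<Suc k])" for \<sigma>
      using normal_prod_expand[of "[1..<Suc k]" \<sigma>] by (simp del: upt_Suc)
    then show ?thesis unfolding cdet_gmat by (simp only: sum_distrib_left)
  qed
  also have "\<dots> = (\<Sum>j\<in>?E. \<Sum>\<sigma>\<in>?P. of_int (sign \<sigma>) * ordered_term \<sigma> j [1..<Suc k])"
    by (rule sum.swap)
  also have "\<dots> = (\<Sum>\<aa>\<in>Pow {1..k}. \<Sum>j\<in>{j \<in> ?E. ?supp j = \<aa>}. \<Sum>\<sigma>\<in>?P. of_int (sign \<sigma>) * ordered_term \<sigma> j [1..<Suc k])"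
    by (rule sum.group[symmetric]) (use finE in auto)
  also have "\<dots> = (\<Sum>\<aa>\<in>Pow {1..k}. \<Sum>(j1, j2)\<in>{(j1, j2). j1 \<in> ?J \<aa> \<and> j2 \<in> ?J \<aa> \<and> J_equiv k j1 j2}.
       of_int (J_coeff m n k \<aa> j1 j2) * ?f j2 * ?g \<aa> j2 j1)"
  proof (rule sum.cong[OF refl])
    fix \<aa> assume "\<aa> \<in> Pow {1..k}"
    then have \<aa>: "\<aa> \<subseteq> {1..k}" by simp
    let ?h = "\<lambda>j1 j2. of_int (J_coeff m n k \<aa> j1 j2) * ?f j2 * ?g \<aa> j2 j1"
    have "(\<Sum>j\<in>{j \<in> ?E. ?supp j = \<aa>}. \<Sum>\<sigma>\<in>?P. of_int (sign \<sigma>) * ordered_term \<sigma> j [1..<Suc k]) =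
       (\<Sum>j\<in>{j \<in> ?E. ?supp j = \<aa>}. if j \<in> ?J \<aa> then \<Sum>j1 | j1 \<in> ?J \<aa> \<and> J_equiv k j1 j. ?h j1 j else 0)"
      by (intro sum.cong refl inner) auto
    also have "\<dots> = (\<Sum>j\<in>?J \<aa>. \<Sum>j1 | j1 \<in> ?J \<aa> \<and> J_equiv k j1 j. ?h j1 j)"
    proof -
      have "?J \<aa> \<subseteq> {j \<in> ?E. ?supp j = \<aa>}"
      proof
        fix j assume j: "j \<in> ?J \<aa>"
        have "b \<in> ?supp j \<longleftrightarrow> b \<in> \<aa>" for b
        proof -
          have "b \<in> {1..k} \<Longrightarrow> j b = 0 \<longleftrightarrow> b \<notin> \<aa>" using j by (simp add: J_set_def)
          then show ?thesis using \<aa> by (cases "b \<in> {1..k}") auto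
        qed
        then have "?supp j = \<aa>" by (rule set_eqI)
        then show "j \<in> {j \<in> ?E. ?supp j = \<aa>}" using j by (simp add: J_set_def r)
      qed
      then show ?thesis using finE
        by (intro sum.mono_neutral_cong_right) auto
    qed
    also have "\<dots> = (\<Sum>(j2, j1)\<in>Sigma (?J \<aa>) (\<lambda>j2. {j1. j1 \<in> ?J \<aa> \<and> J_equiv k j1 j2}). ?h j1 j2)"
      using finJ by (intro sum.Sigma) auto
    also have "\<dots> = (\<Sum>(j1, j2)\<in>{(j1, j2). j1 \<in> ?J \<aa> \<and> j2 \<in> ?J \<aa> \<and> J_equiv k j1 j2}. ?h j1 j2)"
      by (rule sum.reindex_bij_witness[of _ prod.swap prod.swap]) auto
    finally show "(\<Sum>j\<in>{j \<in> ?E. ?supp j = \<aa>}. \<Sum>\<sigma>\<in>?P. of_int (sign \<sigma>) * ordered_term \<sigma> j [1..<Suc k]) =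
      (\<Sum>(j1, j2)\<in>{(j1, j2). j1 \<in> ?J \<aa> \<and> j2 \<in> ?J \<aa> \<and> J_equiv k j1 j2}. ?h j1 j2)" .
  qed
  finally show ?thesis .
qed

end

section \<open>The Weyl superalgebra\<close>

lemma weyl_of_complex_hom:
  "weyl_of_complex 0 = (0 :: ('m::len0, 'n::len0, 'k::len0) weyl)"
  "weyl_of_complex 1 = (1 :: ('m, 'n, 'k) weyl)"
  "weyl_of_complex (c + d) = (weyl_of_complex c + weyl_of_complex d :: ('m, 'n, 'k) weyl)"
  "weyl_of_complex (c * d) = (weyl_of_complex c * weyl_of_complex d :: ('m, 'n, 'k) weyl)"
  "weyl_of_complex (- c) = (- weyl_of_complex c :: ('m, 'n, 'k) weyl)"
  by (simp_all add: weyl_of_complex.abs_eq zero_weyl_def one_weyl_def plus_weyl.abs_eq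
      times_weyl.abs_eq uminus_weyl.abs_eq mult_single single_add single_uminus)

lemma weyl_of_complex_central:
  "w * weyl_of_complex c = weyl_of_complex c * (w :: ('m::len0, 'n::len0, 'k::len0) weyl)"
proof -
  have "p * Poly_Mapping.single 0 c = Poly_Mapping.single 0 c * p" for p :: free_alg
    by (induction p rule: free_alg_induct) (simp_all add: mult_single mult.commute algebra_simps)
  moreover obtain p where "w = abs_weyl p"
    by (induction w rule: weyl.abs_induct) blast
  ultimately show ?thesis by (simp add: weyl_of_complex.abs_eq times_weyl.abs_eq)
qed

text \<open>A nonzero scalar is invertible, and 1 is not 0 in the quotient. This injectivity keeps
  subdegrees unchanged under \<open>weyl_series\<close>.\<close>

lemma weyl_of_complex_eq_0_iff:
  "weyl_of_complex c = (0 :: ('m::len0, 'n::len0, 'k::len0) weyl) \<longleftrightarrow> c = 0"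
proof
  assume c: "weyl_of_complex c = (0 :: ('m, 'n, 'k) weyl)"
  show "c = 0"
  proof (rule ccontr)
    assume "c \<noteq> 0"
    then have "(1 :: ('m, 'n, 'k) weyl) = weyl_of_complex c * weyl_of_complex (inverse c)"
      by (simp flip: weyl_of_complex_hom)
    then show False using c by simp
  qed
qed (simp add: weyl_of_complex_hom)

lemma weyl_of_complex_sum:
  "weyl_of_complex (\<Sum>a\<in>A. f a) = (\<Sum>a\<in>A. weyl_of_complex (f a) :: ('m::len0, 'n::len0, 'k::len0) weyl)"
  by (induction A rule: infinite_finite_induct) (simp_all add: weyl_of_complex_hom)

lemma weyl_of_complex_of_int:
  "weyl_of_complex (of_int t) = (of_int t :: ('m::len0, 'n::len0, 'k::len0) weyl)"
proof -
  have nat: "weyl_of_complex (of_nat s) = (of_nat s :: ('m, 'n, 'k) weyl)" for s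
    by (induction s) (simp_all add: weyl_of_complex_hom)
  show ?thesis
    by (cases t rule: int_cases2) (simp_all add: weyl_of_complex_hom nat)
qed

section \<open>Scalar Laurent series among the differential operators\<close>

lemma weyl_series_0: "weyl_series 0 = (0 :: ('m::len0, 'n::len0, 'k::len0) weyl fls)"
  by (rule fls_eqI) (simp add: weyl_series_nth weyl_of_complex_hom)

lemma weyl_series_1: "weyl_series 1 = (1 :: ('m::len0, 'n::len0, 'k::len0) weyl fls)"
  by (rule fls_eqI) (simp add: weyl_series_nth weyl_of_complex_hom)

text \<open>Serves multiplicativity: the coefficient formula for a product sums between bounds given
  by the subdegrees of the factors.\<close>

lemma fls_subdegree_weyl_series:
  "fls_subdegree (weyl_series f :: ('m::len0, 'n::len0, 'k::len0) weyl fls) = fls_subdegree f"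
proof (cases "f = 0")
  case False
  then show ?thesis
    by (intro fls_subdegree_eqI) (simp_all add: weyl_series_nth weyl_of_complex_hom weyl_of_complex_eq_0_iff)
qed (simp add: weyl_series_0)

lemma weyl_series_mult:
  "weyl_series (f * g) = (weyl_series f * weyl_series g :: ('m::len0, 'n::len0, 'k::len0) weyl fls)"
  by (rule fls_eqI)
    (simp add: weyl_series_nth fls_times_nth(2) fls_subdegree_weyl_series weyl_of_complex_sum weyl_of_complex_hom)

lemma weyl_series_uminus:
  "weyl_series (- f) = (- weyl_series f :: ('m::len0, 'n::len0, 'k::len0) weyl fls)"
  by (rule fls_eqI) (simp add: weyl_series_nth weyl_of_complex_hom)

lemma weyl_series_central:
  "weyl_series f * fls_const w = fls_const w * (weyl_series f :: ('m::len0, 'n::len0, 'k::len0) weyl fls)"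
  by (rule fls_eqI) (simp add: weyl_series_nth weyl_of_complex_central)

lemma u_deriv_nth: "fls_nth (u_deriv f) t = - (of_int (t - 1) * fls_nth f (t - 1))"
  by (simp add: u_deriv_def fls_X_power_times_conv_shift)

lemma u_deriv_weyl_series:
  "u_deriv (weyl_series f) = (weyl_series (u_deriv f) :: ('m::len0, 'n::len0, 'k::len0) weyl fls)"
  by (rule fls_eqI)
    (simp only: weyl_series_nth u_deriv_nth weyl_of_complex_hom weyl_of_complex_of_int)

lemma u_deriv_const: "u_deriv (fls_const c) = 0"
  by (simp add: u_deriv_def)

text \<open>Differentiates the identity that defines the inverse, so the expansion of the pole in
  powers of 1/u is never written out.\<close>

lemma u_deriv_pole: "u_deriv (pole c) = - (pole c * pole c)"
proof -
  let ?g = "fls_X_inv - fls_const c :: complex fls"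
  have "fls_nth ?g (-1) \<noteq> 0" by simp
  then have g: "?g \<noteq> 0" by (metis fls_zero_nth)
  have "u_deriv (?g + fls_const c) = u_deriv ?g" unfolding u_deriv_add u_deriv_const by simp
  then have "u_deriv ?g = 1" by (simp add: u_deriv_u)
  moreover have "u_deriv (?g * pole c) = 0" using g by (simp add: pole_def)
  ultimately have "?g * u_deriv (pole c) = - pole c"
    unfolding u_deriv_mult by (simp add: eq_neg_iff_add_eq_0 add.commute)
  then have "pole c * (?g * u_deriv (pole c)) = - (pole c * pole c)" by simp
  then show ?thesis using g by (simp add: pole_def flip: mult.assoc)
qed

lemma op_fun_hom:
  "op_fun 0 = 0" "op_fun 1 = 1" "op_fun (f + g) = op_fun f + op_fun g"
  "op_fun (f - g) = op_fun f - op_fun g" "op_fun (- f) = - op_fun f"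
  by (simp_all add: op_fun_def zero_diffop_def one_diffop_def plus_diffop.abs_eq
      minus_diffop.abs_eq uminus_diffop.abs_eq)

lemma op_du_weyl_const:
  "op_du * op_fun (fls_const w) = op_fun (fls_const w) * op_du"
  by (simp add: op_du_op_fun u_deriv_const op_fun_hom)

lemma op_complex_central:
  "op_complex c * op_fun (fls_const w) = op_fun (fls_const w) * op_complex c"
  "op_complex c * op_fun (weyl_series f) = op_fun (weyl_series f) * op_complex c"
  "op_du * op_complex c = op_complex c * op_du"
  unfolding op_complex_def
  by (simp_all add: op_du_op_fun u_deriv_weyl_series u_deriv_const weyl_series_0 op_fun_hom
      weyl_series_central mult.commute[of f] flip: op_fun_mult weyl_series_mult)

lemma weyl_word_op_fun:
  "op_fun (fls_const (weyl_word gs)) = prod_list (map (\<lambda>g. op_fun (fls_const (weyl_gen g))) gs)"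
  by (induction gs)
    (simp_all add: weyl_word_def op_fun_hom op_fun_mult flip: fls_const_mult_const)

lemma weyl_series_prod_list:
  "op_fun (weyl_series (prod_list fs)) = prod_list (map (\<lambda>f. op_fun (weyl_series f)) fs)"
  by (induction fs) (simp_all add: weyl_series_1 weyl_series_mult op_fun_hom op_fun_mult)


section \<open>The concrete entries satisfy the abstract relations\<close>

lemma weyl_gen_commute:
  fixes m n k i j a b :: nat
  assumes "m = LENGTH('m::len0)" "n = LENGTH('n::len0)" "k = LENGTH('k::len0)"
    and "i \<in> {1..m + n}" "j \<in> {1..m + n}" "a \<in> {1..k}" "b \<in> {1..k}"
  shows "weyl_gen (GX i a) * weyl_gen (GX j b) =
      (koszul m i j * (weyl_gen (GX j b) * weyl_gen (GX i a)) :: ('m, 'n, 'k) weyl)"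
    and "weyl_gen (GD i a) * weyl_gen (GD j b) =
      (koszul m i j * (weyl_gen (GD j b) * weyl_gen (GD i a)) :: ('m, 'n, 'k) weyl)"
    and "weyl_gen (GD i a) * weyl_gen (GX j b) =
      (koszul m i j * (weyl_gen (GX j b) * weyl_gen (GD i a))
        + (if i = j \<and> a = b then 1 else 0) :: ('m, 'n, 'k) weyl)"
proof -
  have idx: "(i, a) \<in> index_range LENGTH('m) LENGTH('n) LENGTH('k)"
    "(j, b) \<in> index_range LENGTH('m) LENGTH('n) LENGTH('k)"
    using assms by (auto simp: index_range_def)
  have sc: "supercomm (parity LENGTH('m) i) (parity LENGTH('m) j) v w = v * w - koszul m i j * (w * v)"
    for v w :: "('m, 'n, 'k) weyl"
    by (auto simp: supercomm_def parity_def koszul_def assms(1))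
  note rel = weyl_relations[OF idx, unfolded sc]
  show "weyl_gen (GX i a) * weyl_gen (GX j b) =
      (koszul m i j * (weyl_gen (GX j b) * weyl_gen (GX i a)) :: ('m, 'n, 'k) weyl)"
    using rel(1) by (simp only: right_minus_eq)
  show "weyl_gen (GD i a) * weyl_gen (GD j b) =
      (koszul m i j * (weyl_gen (GD j b) * weyl_gen (GD i a)) :: ('m, 'n, 'k) weyl)"
    using rel(2) by (simp only: right_minus_eq)
  show "weyl_gen (GD i a) * weyl_gen (GX j b) =
      (koszul m i j * (weyl_gen (GX j b) * weyl_gen (GD i a))
        + (if i = j \<and> a = b then 1 else 0) :: ('m, 'n, 'k) weyl)"
    using rel(3) by (simp only: diff_eq_eq add.commute)
qed

lemma op_fun_koszul:
  "op_fun (fls_const (koszul m i j)) = (koszul m i j :: ('m::len0, 'n::len0, 'k::len0) weyl diffop)"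
proof -
  have "fls_const (-1) = (-1 :: ('m, 'n, 'k) weyl fls)" by (rule fls_eqI) simp
  then show ?thesis by (simp add: koszul_def op_fun_hom)
qed

lemma weyl_capelli_system:
  fixes m n k :: nat and z \<Lambda> :: "nat \<Rightarrow> complex"
  assumes "m = LENGTH('m::len0)" "n = LENGTH('n::len0)" "k = LENGTH('k::len0)"
  shows "capelli_system m (m + n) k
    (\<lambda>i a. op_fun (fls_const (weyl_gen (GX i a))) :: ('m, 'n, 'k) weyl diffop)
    (\<lambda>i a. op_fun (fls_const (weyl_gen (GD i a))))
    (\<lambda>i. op_fun (weyl_series (pole (\<Lambda> i))))
    (\<lambda>a. op_du - op_complex (z a))"
proof -
  let ?w = "\<lambda>w. op_fun (fls_const w) :: ('m, 'n, 'k) weyl diffop"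
  let ?s = "\<lambda>f. op_fun (weyl_series f) :: ('m, 'n, 'k) weyl diffop"
  let ?k = "koszul m :: nat \<Rightarrow> nat \<Rightarrow> ('m, 'n, 'k) weyl"
  have w: "?w v * ?w v' = ?w (v * v')" for v v' by (simp flip: op_fun_mult)
  have kw: "koszul m i j * ?w v = ?w (?k i j * v)" for i j v
    by (simp flip: op_fun_koszul op_fun_mult)
  have wadd: "?w (v + v') = ?w v + ?w v'" for v v'
    by (simp flip: op_fun_hom fls_plus_const)
  have sw: "?s f * ?w v = ?w v * ?s f" for f v
    by (simp add: weyl_series_central flip: op_fun_mult)
  have ss: "?s f * ?s g = ?s g * ?s f" for f g
    by (simp add: mult.commute[of f] flip: op_fun_mult weyl_series_mult)
  have Tw: "(op_du - op_complex c) * ?w v = ?w v * (op_du - op_complex c)" for c v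
    by (simp add: algebra_simps op_du_weyl_const op_complex_central)
  show ?thesis
  proof
    fix i j a b :: nat
    assume ij: "i \<in> {1..m + n}" "j \<in> {1..m + n}" "a \<in> {1..k}" "b \<in> {1..k}"
    note comm = weyl_gen_commute[OF assms ij]
    show "?w (weyl_gen (GX i a)) * ?w (weyl_gen (GX j b)) =
        koszul m i j * (?w (weyl_gen (GX j b)) * ?w (weyl_gen (GX i a)))"
      unfolding w kw comm(1) ..
    show "?w (weyl_gen (GD i a)) * ?w (weyl_gen (GD j b)) =
        koszul m i j * (?w (weyl_gen (GD j b)) * ?w (weyl_gen (GD i a)))"
      unfolding w kw comm(2) ..
    show "?w (weyl_gen (GD i a)) * ?w (weyl_gen (GX j b)) =
        koszul m i j * (?w (weyl_gen (GX j b)) * ?w (weyl_gen (GD i a))) + (if i = j \<and> a = b then 1 else 0)"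
      unfolding w kw comm(3) wadd by (simp add: op_fun_hom)
  next
    fix a i
    have du: "op_du * ?s (pole (\<Lambda> i)) = ?s (pole (\<Lambda> i)) * op_du - ?s (pole (\<Lambda> i)) * ?s (pole (\<Lambda> i))"
      by (simp add: op_du_op_fun u_deriv_weyl_series u_deriv_pole weyl_series_uminus weyl_series_mult
          op_fun_hom op_fun_mult)
    show "(op_du - op_complex (z a)) * ?s (pole (\<Lambda> i)) =
        ?s (pole (\<Lambda> i)) * (op_du - op_complex (z a)) - ?s (pole (\<Lambda> i)) * ?s (pole (\<Lambda> i))"
      using du by (simp add: left_diff_distrib right_diff_distrib op_complex_central)
  next
    fix a b
    have "op_complex (z a) * op_complex (z b) = (op_complex (z b) * op_complex (z a) :: ('m, 'n, 'k) weyl diffop)"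
      unfolding op_complex_def by (rule ss)
    then show "(op_du - op_complex (z a)) * (op_du - op_complex (z b)) =
        (op_du - op_complex (z b)) * (op_du - op_complex (z a) :: ('m, 'n, 'k) weyl diffop)"
      by (simp add: left_diff_distrib right_diff_distrib op_complex_central)
  qed (rule sw ss Tw)+
qed

text \<open>Within each word the elements of \<open>\<aa>\<close> strictly increase, so indices
  \<open>i\<close> never have to be compared.\<close>

lemma normal_ordered_words: "normal_ordered (x_word \<aa> j1 @ d_word \<aa> j2)"
proof -
  have "sorted_wrt gen_le (map (\<lambda>a. GX (j1 a) a) (sorted_list_of_set \<aa>))"
    "sorted_wrt gen_le (map (\<lambda>a. GD (j2 a) a) (sorted_list_of_set \<aa>))"
    unfolding sorted_wrt_map
    by (rule sorted_wrt_mono_rel[OF _ strict_sorted_list_of_set], simp)+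
  then show ?thesis by (auto simp: normal_ordered_def x_word_def d_word_def sorted_wrt_append)
qed

theorem proposition5p3:
  fixes m n k :: nat and z \<Lambda> :: "nat \<Rightarrow> complex"
  assumes "m = LENGTH('m::len0)" and "n = LENGTH('n::len0)" and "k = LENGTH('k::len0)"
    and "m + n \<ge> 1" and "k \<ge> 1"
  shows "cdet k (G_matrix (m + n) \<Lambda> z :: nat \<Rightarrow> nat \<Rightarrow> ('m, 'n, 'k) weyl diffop) =
      (\<Sum>\<aa>\<in>Pow {1..k}. \<Sum>(j1, j2)\<in>{(j1, j2). j1 \<in> J_set m n k \<aa> \<and> j2 \<in> J_set m n k \<aa> \<and> J_equiv k j1 j2}.
         of_int (J_coeff m n k \<aa> j1 j2)
         * of_nat (\<Prod>i = m + 1..m + n. fact (card (fibre k j2 i)))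
         * op_fun (fls_const (weyl_word (x_word \<aa> j1) * weyl_word (d_word \<aa> j2)))
         * op_fun (weyl_series (\<Prod>a\<in>\<aa>. pole (\<Lambda> (j2 a))))
         * prod_list (map (\<lambda>a. op_du - op_complex (z a)) (sorted_list_of_set ({1..k} - \<aa>))))
    \<and> (\<forall>\<aa> \<subseteq> {1..k}. \<forall>j1 \<in> J_set m n k \<aa>. \<forall>j2 \<in> J_set m n k \<aa>. J_equiv k j1 j2 \<longrightarrow>
         normal_ordered (x_word \<aa> j1 @ d_word \<aa> j2))"
proof (intro conjI allI ballI impI normal_ordered_words)
  interpret capelli_system m "m + n" k
    "\<lambda>i a. op_fun (fls_const (weyl_gen (GX i a))) :: ('m, 'n, 'k) weyl diffop"
    "\<lambda>i a. op_fun (fls_const (weyl_gen (GD i a)))"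
    "\<lambda>i. op_fun (weyl_series (pole (\<Lambda> i)))" "\<lambda>a. op_du - op_complex (z a)"
    by (rule weyl_capelli_system[OF assms(1-3)])
  \<comment> \<open>The poles have scalar coefficients, so they slide past the constant series of
    \<open>GD i b\<close> into the middle.\<close>
  have G: "G_matrix (m + n) \<Lambda> z = gmat"
  proof (intro ext)
    fix a b
    have "op_fun (fls_const (v * w) * weyl_series f) =
        op_fun (fls_const v) * op_fun (weyl_series f) * op_fun (fls_const w)"
      for v w :: "('m, 'n, 'k) weyl" and f
      by (simp add: mult.assoc weyl_series_central flip: op_fun_mult fls_const_mult_const)
    then show "G_matrix (m + n) \<Lambda> z a b = gmat a b" by (simp add: G_matrix_def gmat_def)
  qed
  have X: "x_prod \<aa> j = op_fun (fls_const (weyl_word (x_word \<aa> j)))" for \<aa> j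
    by (simp add: weyl_word_op_fun x_word_def comp_def)
  have D: "d_prod \<aa> j = op_fun (fls_const (weyl_word (d_word \<aa> j)))" for \<aa> j
    by (simp add: weyl_word_op_fun d_word_def comp_def)
  have F: "prod_list (map (\<lambda>a. op_fun (weyl_series (pole (\<Lambda> (j a))))) (sorted_list_of_set \<aa>)) =
      (op_fun (weyl_series (\<Prod>a\<in>\<aa>. pole (\<Lambda> (j a)))) :: ('m, 'n, 'k) weyl diffop)"
    if "finite \<aa>" for \<aa> j
  proof -
    have "(\<Prod>a\<in>\<aa>. pole (\<Lambda> (j a))) = prod_list (map (\<lambda>a. pole (\<Lambda> (j a))) (sorted_list_of_set \<aa>))"
      using that by (simp flip: prod.distinct_set_conv_list)
    then show ?thesis by (simp add: weyl_series_prod_list comp_def)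
  qed
  show "cdet k (G_matrix (m + n) \<Lambda> z :: nat \<Rightarrow> nat \<Rightarrow> ('m, 'n, 'k) weyl diffop) =
      (\<Sum>\<aa>\<in>Pow {1..k}. \<Sum>(j1, j2)\<in>{(j1, j2). j1 \<in> J_set m n k \<aa> \<and> j2 \<in> J_set m n k \<aa> \<and> J_equiv k j1 j2}.
         of_int (J_coeff m n k \<aa> j1 j2)
         * of_nat (\<Prod>i = m + 1..m + n. fact (card (fibre k j2 i)))
         * op_fun (fls_const (weyl_word (x_word \<aa> j1) * weyl_word (d_word \<aa> j2)))
         * op_fun (weyl_series (\<Prod>a\<in>\<aa>. pole (\<Lambda> (j2 a))))
         * prod_list (map (\<lambda>a. op_du - op_complex (z a)) (sorted_list_of_set ({1..k} - \<aa>))))"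
    unfolding G cdet_gmat_normal_ordered[OF refl]
  proof (intro sum.cong refl, clarify)
    fix \<aa> j1 j2 assume "\<aa> \<subseteq> {1..k}"
    then have fin: "finite \<aa>" using finite_subset by blast
    show "of_int (J_coeff m n k \<aa> j1 j2) * of_nat (\<Prod>i = m + 1..m + n. fact (card (fibre k j2 i)))
         * (x_prod \<aa> j1 * d_prod \<aa> j2 * ft_prod \<aa> j2) =
         of_int (J_coeff m n k \<aa> j1 j2)
         * of_nat (\<Prod>i = m + 1..m + n. fact (card (fibre k j2 i)))
         * op_fun (fls_const (weyl_word (x_word \<aa> j1) * weyl_word (d_word \<aa> j2)))
         * op_fun (weyl_series (\<Prod>a\<in>\<aa>. pole (\<Lambda> (j2 a))))
         * prod_list (map (\<lambda>a. op_du - op_complex (z a)) (sorted_list_of_set ({1..k} - \<aa>)))"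
      unfolding X D F[OF fin] fls_const_mult_const[symmetric] op_fun_mult by (simp only: mult.assoc)
  qed
qed

end
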